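(* Let $n=2$ or $n=3$. For any origin-symmetric convex bodies $K,L$ in $\mathbb{R}^{2n}$ that are invariant with respect to all $R_\theta$, $$\left|\mathrm{Vol}_{2n}(K)^{\frac{n-1}{n}}-\mathrm{Vol}_{2n}(L)^{\frac{n-1}{n}}\right|\le \max_{\xi\in S^{2n-1}}\left|\mathrm{Vol}_{2n-2}(K\cap H_\xi)-\mathrm{Vol}_{2n-2}(L\cap H_\xi)\right|.$$
   Context: $\mathbb{C}^n$ is identified with $\mathbb{R}^{2n}$ via $(\xi_1,\dots,\xi_n)=(\xi_{11}+i\xi_{12},\dots,\xi_{n1}+i\xi_{n2})\mapsto(\xi_{11},\xi_{12},\dots,\xi_{n1},\xi_{n2})$. $S^{2n-1}$ is the Euclidean unit sphere of $\mathbb{R}^{2n}$. For $\xi\in S^{2n-1}$, regarded as a unit vector in $\mathbb{C}^n$, $H_\xi=\{z\in\mathbb{C}^n:\sum_{k=1}^n z_k\overline{\xi_k}=0\}$ is the complex hyperplane through the origin perpendicular to $\xi$; under the identification it is a $(2n-2)$-dimensional real linear subspace of $\mathbb{R}^{2n}$. $\mathrm{Vol}_{2n}$ is Lebesgue measure on $\mathbb{R}^{2n}$ and $\mathrm{Vol}_{2n-2}$ is the $(2n-2)$-dimensional Lebesgue (Euclidean) volume on the subspace $H_\xi$. A convex body is a compact convex set with nonempty interior. For an origin-symmetric convex body $K$ in $\mathbb{R}^{2n}$, $\|\cdot\|_K$ denotes the norm whose closed unit ball is $K$. $R_\theta$ denotes the counterclockwise rotation of $\mathbb{R}^2$ by the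 angle $\theta$ about the origin. $K$ is invariant with respect to all $R_\theta$ if for every $\theta\in[0,2\pi]$ and every $\xi=(\xi_{11},\xi_{12},\dots,\xi_{n1},\xi_{n2})\in\mathbb{R}^{2n}$, $$\|\xi\|_K=\|(R_\theta(\xi_{11},\xi_{12}),\dots,R_\theta(\xi_{n1},\xi_{n2}))\|_K.$$ *)

theory Defs
  imports "HOL-Analysis.Analysis"
begin

(* Complex n-space is complex^'n with n = CARD('n).  The library's euclidean structure on it has
   the basis axis k 1, axis k i, so it already is R^2n under
   (z_1, ..., z_n) |-> (Re z_1, Im z_1, ..., Re z_n, Im z_n): norm is the Euclidean norm,
   sphere 0 1 is S^(2n-1), and lborel is 2n-dimensional Lebesgue measure. *)

definition convex_body :: "'a::euclidean_space set \<Rightarrow> bool" where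
  "convex_body K \<longleftrightarrow> compact K \<and> convex K \<and> interior K \<noteq> {}"

definition origin_symmetric :: "'a::real_vector set \<Rightarrow> bool" where
  "origin_symmetric K \<longleftrightarrow> (\<forall>x\<in>K. - x \<in> K)"

(* For an origin-symmetric convex body K this is the norm with closed unit ball K; see
   body_norm_unit_ball, body_norm_scaleR, body_norm_triangle, body_norm_eq_0_iff below. *)
definition body_norm :: "'a::real_vector set \<Rightarrow> 'a \<Rightarrow> real" where
  "body_norm K x = Inf {t. 0 \<le> t \<and> (\<exists>k\<in>K. x = t *\<^sub>R k)}"

context
  fixes K :: "'a::euclidean_space set"
  assumes K: "convex_body K" "origin_symmetric K"
begin

lemma cball_subset_body: "\<exists>e>0. cball 0 e \<subseteq> K"
proof -
  have conv: "convex K" using K by (simp add: convex_body_def)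
  obtain a where a: "a \<in> interior K" using K by (auto simp: convex_body_def)
  then obtain e where e: "e > 0" "cball a e \<subseteq> K" by (auto simp: mem_interior_cball)
  have "x \<in> K" if "x \<in> cball 0 e" for x
  proof -
    have "a + x \<in> K" "a - x \<in> K" using that e by (auto simp: dist_norm)
    then have "- (a - x) \<in> K" using K(2) unfolding origin_symmetric_def by blast
    from convexD[OF conv \<open>a + x \<in> K\<close> this, of "1/2" "1/2"]
    have "(1/2) *\<^sub>R (a + x) + (1/2) *\<^sub>R (- (a - x)) \<in> K" by simp
    also have "(1/2) *\<^sub>R (a + x) + (1/2) *\<^sub>R (- (a - x)) = x"
      by (simp add: scaleR_right_distrib scaleR_right_diff_distrib flip: scaleR_left_distrib)
    finally show ?thesis .
  qed
  then show ?thesis using e by blast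
qed

lemma zero_in_body: "0 \<in> K"
  using cball_subset_body by auto

lemma scaled_in_body:
  assumes "x \<in> K" "0 \<le> c" "c \<le> 1"
  shows "c *\<^sub>R x \<in> K"
proof -
  have "convex K" using K by (simp add: convex_body_def)
  from convexD[OF this assms(1) zero_in_body, of c "1 - c"] assms show ?thesis by simp
qed

lemma body_norm_set_bdd_below: "bdd_below {t. 0 \<le> t \<and> (\<exists>k\<in>K. x = t *\<^sub>R k)}"
  by (rule bdd_belowI[of _ 0]) auto

lemma body_norm_set_nonempty: "{t. 0 \<le> t \<and> (\<exists>k\<in>K. x = t *\<^sub>R k)} \<noteq> {}"
proof -
  obtain e where e: "e > 0" "cball 0 e \<subseteq> K" using cball_subset_body by blast
  show ?thesis
  proof (cases "x = 0")
    case True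
    then show ?thesis using zero_in_body by auto
  next
    case False
    have "(e / norm x) *\<^sub>R x \<in> K" using e False by (intro subsetD[OF e(2)]) auto
    moreover have "x = (norm x / e) *\<^sub>R ((e / norm x) *\<^sub>R x)" using e False by simp
    moreover have "0 \<le> norm x / e" using e by simp
    ultimately show ?thesis by blast
  qed
qed

lemma body_norm_nonneg: "0 \<le> body_norm K x"
  unfolding body_norm_def by (rule cInf_greatest[OF body_norm_set_nonempty]) auto

lemma body_norm_le: "0 \<le> t \<Longrightarrow> k \<in> K \<Longrightarrow> body_norm K (t *\<^sub>R k) \<le> t"
  unfolding body_norm_def by (rule cInf_lower[OF _ body_norm_set_bdd_below]) auto

lemma body_norm_less_imp:
  assumes "body_norm K x < t"
  shows "(1 / t) *\<^sub>R x \<in> K"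
proof -
  from assms obtain s k where s: "s < t" "0 \<le> s" "k \<in> K" "x = s *\<^sub>R k"
    unfolding body_norm_def cInf_less_iff[OF body_norm_set_nonempty body_norm_set_bdd_below] by auto
  then have "(s / t) *\<^sub>R k \<in> K" by (intro scaled_in_body) auto
  with s show ?thesis by simp
qed

lemma body_norm_unit_ball: "{x. body_norm K x \<le> 1} = K"
proof (intro equalityI subsetI)
  fix x assume "x \<in> K"
  with body_norm_le[of 1 x] show "x \<in> {x. body_norm K x \<le> 1}" by simp
next
  fix x assume "x \<in> {x. body_norm K x \<le> 1}"
  then have x: "body_norm K x \<le> 1" by simp
  have cl: "closed K" using K by (simp add: convex_body_def compact_imp_closed)
  have "(1 / (1 + inverse (real (Suc m)))) *\<^sub>R x \<in> K" for m
      proof (rule body_norm_less_imp)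
    have "inverse (real (Suc m)) > 0" by simp
    with x show "body_norm K x < 1 + inverse (real (Suc m))" by linarith
  qed
  moreover have "(\<lambda>m. (1 / (1 + inverse (real (Suc m)))) *\<^sub>R x) \<longlonglongrightarrow> (1 / (1 + 0)) *\<^sub>R x"
    by (intro tendsto_intros LIMSEQ_inverse_real_of_nat) auto
  ultimately have "(1 / (1 + 0)) *\<^sub>R x \<in> K" by (rule closed_sequentially[OF cl])
  then show "x \<in> K" by simp
qed

lemma body_norm_scaleR_le: "body_norm K (c *\<^sub>R x) \<le> \<bar>c\<bar> * body_norm K x"
proof (rule field_le_epsilon)
  fix e :: real assume e: "e > 0"
  define t where "t = body_norm K x + e / (\<bar>c\<bar> + 1)"
  have tpos: "body_norm K x < t" using e by (simp add: t_def)
  then have t0: "t > 0" using body_norm_nonneg[of x] by simp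
  have k: "(1 / t) *\<^sub>R x \<in> K" by (rule body_norm_less_imp[OF tpos])
  then have "sgn c *\<^sub>R ((1 / t) *\<^sub>R x) \<in> K"
    using K(2) zero_in_body by (auto simp: sgn_if origin_symmetric_def)
  from body_norm_le[OF _ this, of "\<bar>c\<bar> * t"] t0
  have "body_norm K ((\<bar>c\<bar> * t) *\<^sub>R (sgn c *\<^sub>R ((1 / t) *\<^sub>R x))) \<le> \<bar>c\<bar> * t" by simp
  also have "(\<bar>c\<bar> * t) *\<^sub>R (sgn c *\<^sub>R ((1 / t) *\<^sub>R x)) = c *\<^sub>R x"
  proof -
    have "\<bar>c\<bar> * t * (sgn c * (1 / t)) = (\<bar>c\<bar> * sgn c) * (t * (1 / t))" by (simp only: ac_simps)
    also have "\<dots> = c" using t0 by (simp add: abs_mult_sgn)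
    finally show ?thesis by (simp only: scaleR_scaleR mult.assoc)
  qed
  also have "\<bar>c\<bar> * t = \<bar>c\<bar> * body_norm K x + e * (\<bar>c\<bar> / (\<bar>c\<bar> + 1))"
    by (simp add: t_def algebra_simps)
  also have "e * (\<bar>c\<bar> / (\<bar>c\<bar> + 1)) \<le> e * 1" using e by (intro mult_left_mono) auto
  finally show "body_norm K (c *\<^sub>R x) \<le> \<bar>c\<bar> * body_norm K x + e" by simp
qed

lemma body_norm_0: "body_norm K 0 = 0"
  using body_norm_le[OF order_refl zero_in_body] body_norm_nonneg[of 0] by simp

lemma body_norm_scaleR: "body_norm K (c *\<^sub>R x) = \<bar>c\<bar> * body_norm K x"
proof (cases "c = 0")
  case True
  then show ?thesis by (simp add: body_norm_0)
next
  case False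
  have "body_norm K (inverse c *\<^sub>R (c *\<^sub>R x)) \<le> \<bar>inverse c\<bar> * body_norm K (c *\<^sub>R x)"
    by (rule body_norm_scaleR_le)
  then have "\<bar>c\<bar> * body_norm K x \<le> body_norm K (c *\<^sub>R x)"
    using False by (simp add: field_simps abs_inverse)
  then show ?thesis using body_norm_scaleR_le[of c x] by simp
qed

lemma body_norm_triangle: "body_norm K (x + y) \<le> body_norm K x + body_norm K y"
proof (rule field_le_epsilon)
  fix e :: real assume e: "e > 0"
  define s where "s = body_norm K x + e / 2"
  define t where "t = body_norm K y + e / 2"
  have s: "body_norm K x < s" and t: "body_norm K y < t" using e by (auto simp: s_def t_def)
  then have pos: "s > 0" "t > 0" using body_norm_nonneg[of x] body_norm_nonneg[of y] by auto
  have conv: "convex K" using K by (simp add: convex_body_def)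
  have "(s / (s + t)) *\<^sub>R ((1 / s) *\<^sub>R x) + (t / (s + t)) *\<^sub>R ((1 / t) *\<^sub>R y) \<in> K"
    using pos by (intro convexD[OF conv] body_norm_less_imp s t) (auto simp flip: add_divide_distrib)
  from body_norm_le[OF _ this, of "s + t"] pos show
    "body_norm K (x + y) \<le> body_norm K x + body_norm K y + e"
    by (simp add: scaleR_right_distrib s_def t_def)
qed

lemma body_norm_eq_0_iff: "body_norm K x = 0 \<longleftrightarrow> x = 0"
proof
  assume x: "body_norm K x = 0"
  have "bounded K" using K by (simp add: convex_body_def compact_imp_bounded)
  then obtain B where B: "B > 0" "\<And>k. k \<in> K \<Longrightarrow> norm k \<le> B" by (auto simp: bounded_pos)
  show "x = 0"
  proof (rule ccontr)
    assume "x \<noteq> 0"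
    have "body_norm K (((B + 1) / norm x) *\<^sub>R x) \<le> 1"
      using x by (simp add: body_norm_scaleR)
    then have "((B + 1) / norm x) *\<^sub>R x \<in> K"
      using body_norm_unit_ball by blast
    then have "norm (((B + 1) / norm x) *\<^sub>R x) \<le> B" by (rule B)
    then show False using \<open>x \<noteq> 0\<close> B by simp
  qed
qed (simp add: body_norm_0)

end

definition rotation :: "real \<Rightarrow> complex \<Rightarrow> complex" where
  "rotation \<theta> z = Complex (cos \<theta> * Re z - sin \<theta> * Im z) (sin \<theta> * Re z + cos \<theta> * Im z)"

lemma rotation_eq_cis_mult: "rotation \<theta> z = cis \<theta> * z"
  by (simp add: rotation_def complex_eq_iff)

definition rotation_invariant :: "(complex^'n) set \<Rightarrow> bool" where
  "rotation_invariant K \<longleftrightarrow>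
     (\<forall>\<theta>\<in>{0..2 * pi}. \<forall>\<xi>. body_norm K \<xi> = body_norm K (\<chi> k. rotation \<theta> (\<xi> $ k)))"

definition complex_hyperplane :: "complex^'n \<Rightarrow> (complex^'n) set" where
  "complex_hyperplane \<xi> = {z. (\<Sum>k\<in>UNIV. z $ k * cnj (\<xi> $ k)) = 0}"

lemma subspace_complex_hyperplane: "subspace (complex_hyperplane \<xi>)"
  by (simp add: complex_hyperplane_def subspace_def sum.distrib distrib_right flip: scaleR_sum_right)

definition orthonormal_basis_of :: "'a::euclidean_space set \<Rightarrow> 'a set \<Rightarrow> bool" where
  "orthonormal_basis_of H B \<longleftrightarrow>
     pairwise orthogonal B \<and> (\<forall>b\<in>B. norm b = 1) \<and> span B = H"

lemma orthonormal_basis_of_exists: "subspace H \<Longrightarrow> \<exists>B. orthonormal_basis_of H B"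
  unfolding orthonormal_basis_of_def by (erule orthonormal_basis_subspace) blast

(* dim H-dimensional Lebesgue measure on the subspace H, as a Borel measure on the ambient space.
   It is built like the library's lborel, with an orthonormal basis of H in place of Basis; by
   rotation invariance of Lebesgue measure the choice of the basis is immaterial. *)
definition subspace_lborel :: "'a::euclidean_space set \<Rightarrow> 'a measure" where
  "subspace_lborel H =
     (let B = (SOME B. orthonormal_basis_of H B)
      in distr (\<Pi>\<^sub>M b\<in>B. lborel) borel (\<lambda>f. \<Sum>b\<in>B. f b *\<^sub>R b))"

definition section_volume :: "(complex^'n) set \<Rightarrow> complex^'n \<Rightarrow> real" where
  "section_volume K \<xi> =
     measure (subspace_lborel (complex_hyperplane \<xi>)) (K \<inter> complex_hyperplane \<xi>)"

end

theory Submission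
  imports Defs "HOL-Real_Asymp.Real_Asymp"
begin

text \<open>
  Write \<open>n = CARD('n)\<close>, \<open>S\<^sub>M\<close> for the section volume of \<open>M\<close> and \<open>N\<^sub>M\<close> for the norm with unit ball \<open>M\<close>.
  Let \<open>\<epsilon>\<close> exceed the largest difference of the section volumes and let \<open>D\<close> be the ball all of whose
  sections have volume \<open>\<epsilon>\<close>, so that \<open>S\<^sub>K \<le> S\<^sub>L + S\<^sub>D\<close>.  The theorem follows from
  \<open>vol K powr ((n - 1) / n) \<le> vol L powr ((n - 1) / n) + vol D powr ((n - 1) / n)\<close>, because the last summand
  is at most \<open>\<epsilon>\<close> (\<open>volume_cball_powr_le_section_volume\<close>).

  The bridge between sections and volumes is the integral of \<open>1 / N\<^sub>K\<^sup>2\<close>.  By the layer cake formula it is at most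
  \<open>n / (n - 1) * vol M powr ((n - 1) / n) * vol K powr (1 / n)\<close> over a set \<open>M\<close>, with equality
  for \<open>M = K\<close> (\<open>inverse_square_body_norm_integral_le\<close>, \<open>inverse_square_body_norm_integral_self\<close>); this
  takes the place of polar coordinates and Hoelder's inequality.  It remains to turn \<open>S\<^sub>K \<le> S\<^sub>L + S\<^sub>D\<close> into
  an inequality between such integrals.

  For \<open>n = 2\<close> the hyperplanes are the complex lines.  A rotation invariant body meets the line through
  \<open>x\<close> in a disc of radius \<open>norm x / N\<^sub>K x\<close>, so the hypothesis says
  \<open>1 / N\<^sub>K\<^sup>2 \<le> 1 / N\<^sub>L\<^sup>2 + 1 / N\<^sub>D\<^sup>2\<close> pointwise, and it is integrated over \<open>K\<close>.

  For \<open>n = 3\<close> the hypothesis is integrated against a positive measure in \<open>\<xi>\<close> for which the integral of \<open>S\<^sub>M\<close> is a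
  constant times the integral of \<open>1 / N\<^sub>K\<^sup>2\<close> over \<open>M\<close>.  In Fourier terms this measure is the transform of
  \<open>1 / N\<^sub>K\<^sup>2\<close>, that is, up to a constant factor, minus the Laplacian at \<open>0\<close> of the parallel section function of \<open>K\<close>.
  Here it is approximated by a difference quotient.  Let \<open>V\<^sub>K r \<xi>\<close> be the volume
  of the points of \<open>K\<close> within distance \<open>r\<close> of the hyperplane of \<open>\<xi>\<close> (\<open>tube\<close>).  The weight is
  \<open>4 * V\<^sub>K (t / 2) \<xi> - V\<^sub>K t \<xi>\<close>, which is nonnegative since the parallel sections of a symmetric convex body shrink away from
  its centre (\<open>tube_halving\<close>, from the Prekopa-Leindler inequality).  The section volume is replaced by
  \<open>V\<^sub>M s \<xi>\<close> with \<open>s\<close> tending to \<open>0\<close>.  Fubini turns \<open>\<integral> V\<^sub>M s \<xi> * V\<^sub>K r \<xi> d\<xi>\<close> over the unit ball into an integral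
  over \<open>x \<in> M\<close>, \<open>y \<in> K\<close> of the volume of the \<open>\<xi>\<close> that see both points; after division by \<open>s\<^sup>2\<close> that volume tends to a
  multiple of \<open>r\<^sup>2 / (norm x)\<^sup>2 / max q (r\<^sup>2)\<close>, where \<open>q\<close> is the squared distance of \<open>y\<close> from the complex line of
  \<open>x\<close> (\<open>tube_directions_limit\<close>).  Divided by \<open>r\<^sup>2\<close>, the values for \<open>r = t / 2\<close> and \<open>r = t\<close> have a difference in which only the \<open>y\<close> with \<open>q < t\<^sup>2\<close>
  survive, so as \<open>t\<close> tends to \<open>0\<close> the integral over \<open>y\<close> becomes the area of the disc cut out of \<open>K\<close> by the
  line of \<open>x\<close>, and this produces \<open>1 / N\<^sub>K\<^sup>2\<close> (\<open>bump_pairing_bounds\<close>).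
\<close>

section \<open>Linear isometries preserve Lebesgue measure\<close>

definition linear_isometry :: "('a::euclidean_space \<Rightarrow> 'b::euclidean_space) \<Rightarrow> bool" where
  "linear_isometry f \<longleftrightarrow> linear f \<and> (\<forall>x. norm (f x) = norm x)"

lemma linear_isometry_linear: "linear_isometry f \<Longrightarrow> linear f"
  and linear_isometry_norm: "linear_isometry f \<Longrightarrow> norm (f x) = norm x"
  by (auto simp: linear_isometry_def)

lemma linear_isometry_measurable [measurable (raw)]:
  assumes "linear_isometry f" shows "f \<in> borel_measurable borel"
  using assms by (intro borel_measurable_continuous_onI linear_continuous_on)
    (simp add: linear_isometry_def linear_conv_bounded_linear)

lemma linear_isometry_inj: "linear_isometry f \<Longrightarrow> inj f"
  by (metis linear_isometry_linear linear_isometry_norm linear_injective_0 norm_eq_zero)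

lemma linear_isometry_surj:
  fixes f :: "'a::euclidean_space \<Rightarrow> 'b::euclidean_space"
  assumes "linear_isometry f" "DIM('a) = DIM('b)"
  shows "surj f"
proof -
  have lin: "linear f" using assms by (simp add: linear_isometry_def)
  have "dim (range f) = DIM('b)"
    using dim_image_eq[OF lin, of UNIV] linear_isometry_inj[OF assms(1)] assms(2)
    by (simp add: inj_on_subset[of f UNIV])
  moreover have "subspace (range f)" by (rule linear_subspace_image[OF lin subspace_UNIV])
  ultimately show ?thesis by (metis dim_eq_full span_eq_iff)
qed

lemma nn_integral_lborel_shift:
  fixes f :: "'a::euclidean_space \<Rightarrow> ennreal"
  assumes [measurable]: "f \<in> borel_measurable borel"
  shows "(\<integral>\<^sup>+x. f (t + x) \<partial>lborel) = (\<integral>\<^sup>+x. f x \<partial>lborel)"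
proof -
  have "(\<integral>\<^sup>+x. f x \<partial>lborel) = (\<integral>\<^sup>+x. f x \<partial>distr lborel borel ((+) t))"
    by (simp add: lborel_distr_plus)
  also have "\<dots> = (\<integral>\<^sup>+x. f (t + x) \<partial>lborel)" by (subst nn_integral_distr) auto
  finally show ?thesis by simp
qed

lemma nn_integral_lborel_scale:
  fixes f :: "'a::euclidean_space \<Rightarrow> ennreal"
  assumes [measurable]: "f \<in> borel_measurable borel" and c: "c > 0"
  shows "(\<integral>\<^sup>+x. f x \<partial>lborel) = ennreal (c ^ DIM('a)) * (\<integral>\<^sup>+x. f (c *\<^sub>R x) \<partial>lborel)"
proof -
  have "(\<integral>\<^sup>+x. f x \<partial>lborel) =
      (\<integral>\<^sup>+x. f x \<partial>density (distr lborel borel (\<lambda>x. 0 + c *\<^sub>R x)) (\<lambda>_. \<bar>c\<bar>^DIM('a)))"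
    using lborel_affine[of c "0::'a"] c by simp
  also have "\<dots> = (\<integral>\<^sup>+x. \<bar>c\<bar>^DIM('a) * f (c *\<^sub>R x) \<partial>lborel)"
    by (subst nn_integral_density) (auto simp: nn_integral_distr)
  finally show ?thesis using c by (simp add: nn_integral_cmult)
qed

lemma emeasure_lborel_scale:
  fixes A :: "'a::euclidean_space set"
  assumes [measurable]: "A \<in> sets borel" and c: "c > 0"
  shows "emeasure lborel {x. c *\<^sub>R x \<in> A} * ennreal (c ^ DIM('a)) = emeasure lborel A"
proof -
  have "emeasure lborel A = (\<integral>\<^sup>+x. indicator A x \<partial>lborel)" by simp
  also have "\<dots> = ennreal (c ^ DIM('a)) * (\<integral>\<^sup>+x. indicator A (c *\<^sub>R x) \<partial>lborel)"
    by (rule nn_integral_lborel_scale) (use c in auto)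
  also have "(\<integral>\<^sup>+x. indicator A (c *\<^sub>R x) \<partial>lborel)
     = (\<integral>\<^sup>+x. indicator {x. c *\<^sub>R x \<in> A} x \<partial>(lborel :: 'a measure))"
    by (intro nn_integral_cong) (auto simp: indicator_def)
  also have "\<dots> = emeasure lborel {x. c *\<^sub>R x \<in> A}"
    by (rule nn_integral_indicator) (simp, measurable)
  finally show ?thesis by (simp add: mult.commute)
qed

lemma emeasure_lborel_scale_inverse:
  fixes A :: "'a::euclidean_space set"
  assumes [measurable]: "A \<in> sets borel" and c: "c > 0"
  shows "emeasure lborel {x. (1 / c) *\<^sub>R x \<in> A} = ennreal (c ^ DIM('a)) * emeasure lborel A"
proof -
  have "emeasure lborel A * ennreal (c ^ DIM('a)) =
     emeasure lborel {x. (1 / c) *\<^sub>R x \<in> A} * (ennreal ((1 / c) ^ DIM('a)) * ennreal (c ^ DIM('a)))"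
    by (subst emeasure_lborel_scale[OF assms(1), of "1 / c", symmetric]) (use c in \<open>simp_all add: mult.assoc\<close>)
  also have "ennreal ((1 / c) ^ DIM('a)) * ennreal (c ^ DIM('a)) = 1"
    using c by (simp add: power_divide flip: ennreal_mult)
  finally show ?thesis by (simp add: mult.commute)
qed

text \<open>The image measure is translation invariant, and Fubini compares two such measures: with a
  symmetric test set \<open>C\<close>, integrating the indicator of \<open>x + y \<in> A\<close>, \<open>y \<in> C\<close> in either order gives
  \<open>\<mu> A * \<lambda> C = \<lambda> A * \<mu> C\<close>.  The unit ball is a test set of known and equal measure on both sides.\<close>

theorem lborel_linear_isometry:
  fixes f :: "'a::euclidean_space \<Rightarrow> 'b::euclidean_space"
  assumes f: "linear_isometry f" and D: "DIM('a) = DIM('b)"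
  shows "distr lborel borel f = lborel"
proof (rule measure_eqI)
  show "sets (distr lborel borel f) = sets lborel" by simp
  fix A assume "A \<in> sets (distr lborel borel f)"
  then have A[measurable]: "A \<in> sets borel" by simp
  note [measurable] = linear_isometry_measurable[OF f]
  have lin: "linear f" using f by (rule linear_isometry_linear)
  define C where "C = (ball 0 1 :: 'b set)"
  have [measurable]: "C \<in> sets borel" by (simp add: C_def)
  have shift: "(\<integral>\<^sup>+x. indicator A (f x + y) \<partial>lborel) = emeasure (distr lborel borel f) A" for y
  proof -
    obtain z where z: "y = f z" using linear_isometry_surj[OF f D] by (auto simp: surj_def)
    have "(\<integral>\<^sup>+x. indicator A (f x + y) \<partial>lborel) = (\<integral>\<^sup>+x. indicator A (f (z + x)) \<partial>lborel)"
      by (simp add: z linear_add[OF lin] add.commute)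
    also have "\<dots> = (\<integral>\<^sup>+x. indicator A (f x) \<partial>lborel)"
      by (rule nn_integral_lborel_shift) measurable
    also have "\<dots> = (\<integral>\<^sup>+x. indicator A x \<partial>distr lborel borel f)" by (subst nn_integral_distr) auto
    finally show ?thesis by simp
  qed
  have CC: "emeasure lborel {x. f x \<in> ball t 1} = emeasure lborel C" for t
  proof -
    obtain z where z: "t = f z" using linear_isometry_surj[OF f D] by (auto simp: surj_def)
    have "{x. f x \<in> ball t 1} = ball z 1"
      by (auto simp: z dist_norm linear_isometry_norm[OF f] linear_diff[OF lin, symmetric])
    then show ?thesis by (simp add: C_def emeasure_ball D)
  qed
  have "emeasure (distr lborel borel f) A * emeasure lborel C
      = (\<integral>\<^sup>+y. indicator C y * (\<integral>\<^sup>+x. indicator A (f x + y) \<partial>lborel) \<partial>lborel)"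
    by (simp add: shift nn_integral_multc mult.commute)
  also have "\<dots> = (\<integral>\<^sup>+y. (\<integral>\<^sup>+x. indicator C y * indicator A (f x + y) \<partial>lborel) \<partial>lborel)"
    by (simp add: nn_integral_cmult)
  also have "\<dots> = (\<integral>\<^sup>+x. (\<integral>\<^sup>+y. indicator C y * indicator A (f x + y) \<partial>lborel) \<partial>lborel)"
    by (rule lborel_pair.Fubini') measurable
  also have "\<dots> = (\<integral>\<^sup>+x. (\<integral>\<^sup>+y. indicator C (y - f x) * indicator A y \<partial>lborel) \<partial>lborel)"
  proof (rule nn_integral_cong)
    fix x
    show "(\<integral>\<^sup>+y. indicator C y * indicator A (f x + y) \<partial>lborel)
        = (\<integral>\<^sup>+y. indicator C (y - f x) * indicator A y \<partial>lborel)"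
      using nn_integral_lborel_shift[of "\<lambda>y. indicator C (y - f x) * indicator A y" "f x"] by simp
  qed
  also have "\<dots> = (\<integral>\<^sup>+y. (\<integral>\<^sup>+x. indicator C (y - f x) * indicator A y \<partial>lborel) \<partial>lborel)"
    by (rule lborel_pair.Fubini'[symmetric]) measurable
  also have "\<dots> = (\<integral>\<^sup>+y. emeasure lborel C * indicator A y \<partial>lborel)"
  proof (rule nn_integral_cong)
    fix y
    have "(\<integral>\<^sup>+x. indicator C (y - f x) * indicator A y \<partial>lborel)
        = (\<integral>\<^sup>+x. indicator {x. f x \<in> ball y 1} x * indicator A y \<partial>lborel)"
      by (intro nn_integral_cong) (simp add: C_def indicator_def dist_norm norm_minus_commute[of y])
    also have "\<dots> = (\<integral>\<^sup>+x. indicator {x. f x \<in> ball y 1} x \<partial>lborel) * indicator A y"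
      by (rule nn_integral_multc) (simp, measurable)
    also have "(\<integral>\<^sup>+x. indicator {x. f x \<in> ball y 1} x \<partial>lborel) = emeasure lborel {x. f x \<in> ball y 1}"
      by (rule nn_integral_indicator) (simp, measurable)
    finally show "(\<integral>\<^sup>+x. indicator C (y - f x) * indicator A y \<partial>lborel) = emeasure lborel C * indicator A y"
      by (simp only: CC)
  qed
  also have "\<dots> = emeasure lborel A * emeasure lborel C"
    by (subst nn_integral_cmult) (auto simp: mult.commute)
  finally have "emeasure (distr lborel borel f) A * emeasure lborel C = emeasure lborel A * emeasure lborel C" .
  moreover have "emeasure lborel C \<noteq> 0" "emeasure lborel C \<noteq> \<infinity>"
    by (simp_all add: C_def emeasure_ball less_imp_neq[OF unit_ball_vol_pos, symmetric])
  ultimately show "emeasure (distr lborel borel f) A = emeasure lborel A"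
    by (metis ennreal_mult_divide_eq infinity_ennreal_def)
qed

lemma nn_integral_linear_isometry:
  fixes f :: "'a::euclidean_space \<Rightarrow> 'b::euclidean_space"
  assumes f: "linear_isometry f" and D: "DIM('a) = DIM('b)" and [measurable]: "g \<in> borel_measurable borel"
  shows "(\<integral>\<^sup>+x. g x \<partial>lborel) = (\<integral>\<^sup>+x. g (f x) \<partial>lborel)"
  using linear_isometry_measurable[OF f]
  by (subst lborel_linear_isometry[OF f D, symmetric]) (simp add: nn_integral_distr)

lemma emeasure_linear_isometry:
  fixes f :: "'a::euclidean_space \<Rightarrow> 'b::euclidean_space"
  assumes f: "linear_isometry f" and D: "DIM('a) = DIM('b)" and [measurable]: "A \<in> sets borel"
  shows "emeasure lborel A = emeasure lborel {x. f x \<in> A}"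
  using linear_isometry_measurable[OF f]
  by (subst lborel_linear_isometry[OF f D, symmetric]) (simp add: emeasure_distr vimage_def)

lemma lborel_PiM_orthonormal:
  fixes B :: "'a::euclidean_space set" and h :: "'a \<Rightarrow> 'c::euclidean_space"
  assumes h: "bij_betw h B Basis"
  shows "distr (\<Pi>\<^sub>M b\<in>B. lborel) borel (\<lambda>f. \<Sum>b\<in>B. f b *\<^sub>R h b) = lborel"
proof (rule lborel_eqI[symmetric])
  have fin: "finite B" using h bij_betw_finite finite_Basis by blast
  interpret product_sigma_finite "\<lambda>_::'a. lborel :: real measure" ..
  fix l u :: 'c assume lu: "\<And>b. b \<in> Basis \<Longrightarrow> l \<bullet> b \<le> u \<bullet> b"
  have inn: "(\<Sum>b\<in>B. f b *\<^sub>R h b) \<bullet> h b' = f b'" if "b' \<in> B" for f b'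
  proof -
    have "(\<Sum>b\<in>B. f b *\<^sub>R h b) \<bullet> h b' = (\<Sum>b\<in>B. if b = b' then f b' else 0)"
      unfolding inner_sum_left
    proof (intro sum.cong refl)
      fix b assume b: "b \<in> B"
      have "h b \<in> Basis" "h b' \<in> Basis" "h b = h b' \<longleftrightarrow> b = b'"
        using h b that by (auto simp: bij_betw_def inj_on_eq_iff)
      then show "(f b *\<^sub>R h b) \<bullet> h b' = (if b = b' then f b' else 0)" by (auto simp: inner_Basis)
    qed
    then show ?thesis using fin that by simp
  qed
  have eq: "(\<lambda>f. \<Sum>b\<in>B. f b *\<^sub>R h b) -` box l u \<inter> space (\<Pi>\<^sub>M b\<in>B. lborel)
     = (\<Pi>\<^sub>E b\<in>B. {l \<bullet> h b <..< u \<bullet> h b})"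
  proof -
    have B: "Basis = h ` B" using h by (simp add: bij_betw_def)
    show ?thesis by (auto simp: box_def B space_PiM inn PiE_def Pi_def)
  qed
  have "emeasure (distr (\<Pi>\<^sub>M b\<in>B. lborel) borel (\<lambda>f. \<Sum>b\<in>B. f b *\<^sub>R h b)) (box l u)
     = emeasure (\<Pi>\<^sub>M b\<in>B. lborel) (\<Pi>\<^sub>E b\<in>B. {l \<bullet> h b <..< u \<bullet> h b})"
    by (subst emeasure_distr) (auto simp: eq)
  also have "\<dots> = (\<Prod>b\<in>B. emeasure lborel {l \<bullet> h b <..< u \<bullet> h b})"
    by (rule emeasure_PiM) (auto simp: fin)
  also have "\<dots> = (\<Prod>b\<in>B. ennreal ((u - l) \<bullet> h b))"
  proof (intro prod.cong refl)
    fix b assume "b \<in> B"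
    then have "l \<bullet> h b \<le> u \<bullet> h b" using h lu by (auto simp: bij_betw_def)
    then show "emeasure lborel {l \<bullet> h b <..< u \<bullet> h b} = ennreal ((u - l) \<bullet> h b)"
      by (simp add: inner_diff_left)
  qed
  also have "\<dots> = (\<Prod>b\<in>Basis. ennreal ((u - l) \<bullet> b))"
    by (rule prod.reindex_bij_betw[OF h])
  also have "\<dots> = ennreal (\<Prod>b\<in>Basis. (u - l) \<bullet> b)"
    by (rule prod_ennreal) (simp add: lu inner_diff_left)
  finally show "emeasure (distr (\<Pi>\<^sub>M b\<in>B. lborel) borel (\<lambda>f. \<Sum>b\<in>B. f b *\<^sub>R h b)) (box l u)
     = (\<Prod>b\<in>Basis. (u - l) \<bullet> b)" .
qed simp

text \<open>Whatever orthonormal basis of \<open>H\<close> the definition has picked, it differs from the one carried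
  over by \<open>E\<close> by an isometry of the parameter space.\<close>

theorem subspace_lborel_eq_distr:
  fixes E :: "'c::euclidean_space \<Rightarrow> 'a::euclidean_space"
  assumes E: "linear_isometry E" and H: "range E = H"
  shows "subspace_lborel H = distr lborel borel E"
proof -
  note [measurable] = linear_isometry_measurable[OF E]
  have linE: "linear E" using E by (rule linear_isometry_linear)
  have sub: "subspace H" using linear_subspace_image[OF linE subspace_UNIV] H by simp
  define B where "B = (SOME B. orthonormal_basis_of H B)"
  have B: "orthonormal_basis_of H B"
    unfolding B_def by (rule someI_ex) (rule orthonormal_basis_of_exists[OF sub])
  have B1: "pairwise orthogonal B" "\<And>b. b \<in> B \<Longrightarrow> norm b = 1" "span B = H"
    using B by (auto simp: orthonormal_basis_of_def)
  have ind: "independent B" using B1(1) by (rule pairwise_orthogonal_independent) (use B1(2)[of 0] in auto)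
  then have fin: "finite B" by (rule independent_imp_finite)
  have "card B = dim H" using ind B1(3) by (metis dim_eq_card_independent dim_span)
  also have "\<dots> = DIM('c)"
    using dim_image_eq[OF linE linear_isometry_inj[OF E, THEN inj_on_subset], of UNIV] H by (simp add: dim_UNIV)
  finally obtain h where h: "bij_betw h B (Basis :: 'c set)"
    using fin finite_same_card_bij[of B "Basis :: 'c set"] by auto
  define k where "k = inv_into B h"
  have k: "bij_betw k Basis B" unfolding k_def by (rule bij_betw_inv_into[OF h])
  have kh: "k (h b) = b" if "b \<in> B" for b using h that by (simp add: k_def bij_betw_def)
  define G where "G = (\<lambda>x::'c. \<Sum>c\<in>Basis. (x \<bullet> c) *\<^sub>R k c)"
  have linG: "linear G"
    by (rule linearI) (simp_all add: G_def inner_add_left scaleR_left_distrib sum.distrib scaleR_sum_right)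
  have Gh: "G (h b) = b" if b: "b \<in> B" for b
  proof -
    have "h b \<in> Basis" using h b by (auto simp: bij_betw_def)
    then have "G (h b) = (\<Sum>c\<in>Basis. if c = h b then k c else 0)"
      unfolding G_def by (intro sum.cong) (auto simp: inner_Basis)
    then show ?thesis using \<open>h b \<in> Basis\<close> kh[OF b] by simp
  qed
  have isoG: "linear_isometry G"
    unfolding linear_isometry_def
  proof (intro conjI allI linG)
    fix x :: 'c
    have "(norm (G x))\<^sup>2 = (\<Sum>c\<in>Basis. (norm ((x \<bullet> c) *\<^sub>R k c))\<^sup>2)"
      unfolding G_def
    proof (rule norm_sum_Pythagorean)
      show "pairwise (\<lambda>i j. orthogonal ((x \<bullet> i) *\<^sub>R k i) ((x \<bullet> j) *\<^sub>R k j)) Basis"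
        using B1(1) k by (auto simp: pairwise_def bij_betw_def inj_on_def orthogonal_def)
    qed simp
    also have "\<dots> = (\<Sum>c\<in>Basis. (x \<bullet> c)\<^sup>2)"
      using k B1(2) by (intro sum.cong) (auto simp: bij_betw_def)
    also have "\<dots> = (norm x)\<^sup>2"
      by (subst power2_norm_eq_inner, subst euclidean_inner) (simp add: power2_eq_square)
    finally show "norm (G x) = norm x" by simp
  qed
  note [measurable] = linear_isometry_measurable[OF isoG]
  have rG: "range G \<subseteq> H"
    unfolding B1(3)[symmetric] G_def
    by (intro image_subsetI span_sum span_scale span_base) (use k in \<open>auto simp: bij_betw_def\<close>)
  have 1: "subspace_lborel H = distr lborel borel G"
  proof -
    have "distr lborel borel G =
        distr (distr (\<Pi>\<^sub>M b\<in>B. lborel) borel (\<lambda>f. \<Sum>b\<in>B. f b *\<^sub>R h b)) borel G"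
      by (simp add: lborel_PiM_orthonormal[OF h])
    also have "\<dots> = distr (\<Pi>\<^sub>M b\<in>B. lborel) borel (G \<circ> (\<lambda>f. \<Sum>b\<in>B. f b *\<^sub>R h b))"
      by (rule distr_distr) measurable
    also have "G \<circ> (\<lambda>f. \<Sum>b\<in>B. f b *\<^sub>R h b) = (\<lambda>f. \<Sum>b\<in>B. f b *\<^sub>R b)"
      by (auto simp: fun_eq_iff linear_sum[OF linG] linear_scale[OF linG] Gh)
    finally show ?thesis by (simp add: subspace_lborel_def B_def Let_def)
  qed
  define T where "T = inv E \<circ> G"
  have ET: "E (T x) = G x" for x
    unfolding T_def o_def by (rule f_inv_into_f) (use rG H in auto)
  have isoT: "linear_isometry T"
    unfolding linear_isometry_def
  proof (intro conjI allI linearI)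
    fix x y r
    have "E (T (x + y)) = E (T x + T y)" by (simp add: ET linear_add[OF linG] linear_add[OF linE])
    then show "T (x + y) = T x + T y" using linear_isometry_inj[OF E] by (simp add: inj_eq)
    have "E (T (r *\<^sub>R x)) = E (r *\<^sub>R T x)" by (simp add: ET linear_scale[OF linG] linear_scale[OF linE])
    then show "T (r *\<^sub>R x) = r *\<^sub>R T x" using linear_isometry_inj[OF E] by (simp add: inj_eq)
    show "norm (T x) = norm x" by (metis ET linear_isometry_norm[OF E] linear_isometry_norm[OF isoG])
  qed
  note [measurable] = linear_isometry_measurable[OF isoT]
  have "distr lborel borel E = distr (distr lborel borel T) borel E"
    by (simp add: lborel_linear_isometry[OF isoT])
  also have "\<dots> = distr lborel borel (E \<circ> T)" by (rule distr_distr) measurable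
  also have "E \<circ> T = G" by (simp add: fun_eq_iff ET)
  finally show ?thesis using 1 by simp
qed

lemma ex_linear_isometry_onto:
  fixes H :: "'a::euclidean_space set"
  assumes "subspace H" "dim H = DIM('c)"
  obtains E :: "'c::euclidean_space \<Rightarrow> 'a" where "linear_isometry E" "range E = H"
proof -
  obtain f :: "'c \<Rightarrow> 'a" and g where "linear f" "f ` UNIV = H" "\<And>x. x \<in> UNIV \<Longrightarrow> norm (f x) = norm x"
    by (rule isometries_subspaces[of "UNIV::'c set" H]) (use assms in \<open>auto simp: dim_UNIV\<close>)
  then show ?thesis using that by (auto simp: linear_isometry_def)
qed

section \<open>Layer cake\<close>

lemma emeasure_Ico_below: "emeasure lborel {t. 0 \<le> t \<and> ennreal t < c} = c"
proof (cases c)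
  case (real r)
  then have "{t. 0 \<le> t \<and> ennreal t < c} = {0..<r}" by (auto simp: ennreal_less_iff)
  then show ?thesis using real by simp
next
  case top
  then have eq: "{t. 0 \<le> t \<and> ennreal t < c} = {0..}" by auto
  have "emeasure lborel {0::real..} = top"
  proof (rule ccontr)
    assume "emeasure lborel {0::real..} \<noteq> top"
    then obtain r where r: "0 \<le> r" "emeasure lborel {0::real..} = ennreal r"
      by (cases "emeasure lborel {0::real..}") auto
    have "emeasure lborel {0..<r + 1} \<le> emeasure lborel {0::real..}" by (rule emeasure_mono) auto
    then show False using r by (simp add: ennreal_le_iff)
  qed
  then show ?thesis using top eq by simp
qed

lemma (in sigma_finite_measure) nn_integral_layer_cake:
  assumes [measurable]: "f \<in> borel_measurable M"
  shows "(\<integral>\<^sup>+x. f x \<partial>M) =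
    (\<integral>\<^sup>+t. emeasure M {x\<in>space M. ennreal t < f x} * indicator {0..} t \<partial>lborel)"
proof -
  interpret pair_sigma_finite M "lborel :: real measure" ..
  have "(\<integral>\<^sup>+x. f x \<partial>M) = (\<integral>\<^sup>+x. (\<integral>\<^sup>+t. indicator {t. 0 \<le> t \<and> ennreal t < f x} t \<partial>lborel) \<partial>M)"
    by (intro nn_integral_cong) (simp add: emeasure_Ico_below)
  also have "\<dots> = (\<integral>\<^sup>+x. (\<integral>\<^sup>+t. (if 0 \<le> t \<and> ennreal t < f x then 1 else 0) \<partial>lborel) \<partial>M)"
    by (intro nn_integral_cong) (auto simp: indicator_def)
  also have "\<dots> = (\<integral>\<^sup>+t. (\<integral>\<^sup>+x. (if 0 \<le> t \<and> ennreal t < f x then 1 else 0) \<partial>M) \<partial>lborel)"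
    by (rule Fubini'[symmetric]) measurable
  also have "\<dots> = (\<integral>\<^sup>+t. (\<integral>\<^sup>+x. indicator {x\<in>space M. ennreal t < f x} x * indicator {0..} t \<partial>M) \<partial>lborel)"
    by (intro nn_integral_cong) (auto simp: indicator_def)
  also have "\<dots> = (\<integral>\<^sup>+t. emeasure M {x\<in>space M. ennreal t < f x} * indicator {0..} t \<partial>lborel)"
    by (intro nn_integral_cong) (simp add: nn_integral_multc)
  finally show ?thesis .
qed

section \<open>The Prekopa-Leindler inequality at midpoints\<close>

lemma emeasure_lborel_inner_regular:
  fixes A :: "'a::euclidean_space set"
  assumes A[measurable]: "A \<in> sets borel"
  shows "emeasure lborel A = (SUP K \<in> {K. K \<subseteq> A \<and> compact K}. emeasure lborel K)"
proof (rule antisym)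
  have "emeasure lborel A = emeasure lborel (\<Union>n. cball 0 (real n) \<inter> A)"
    by (rule arg_cong[where f="emeasure lborel"]) (auto intro: real_arch_simple)
  also have "\<dots> = (SUP n. emeasure lborel (cball 0 (real n) \<inter> A))"
    by (rule SUP_emeasure_incseq[symmetric]) (auto simp: incseq_def)
  also have "\<dots> \<le> (SUP K \<in> {K. K \<subseteq> A \<and> compact K}. emeasure lborel K)"
  proof (rule SUP_least)
    fix n
    let ?M = "density lborel (indicator (cball 0 (real n) :: 'a set))"
    have M: "emeasure ?M B = emeasure lborel (cball 0 (real n) \<inter> B)" if "B \<in> sets borel" for B
      using that by (intro emeasure_restricted) auto
    have "emeasure lborel (cball 0 (real n) \<inter> A) = emeasure ?M A" by (simp add: M)
    also have "\<dots> = (SUP K \<in> {K. K \<subseteq> A \<and> compact K}. emeasure ?M K)"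
      by (rule inner_regular) (auto simp: M emeasure_cball)
    also have "\<dots> \<le> (SUP K \<in> {K. K \<subseteq> A \<and> compact K}. emeasure lborel K)"
      by (intro SUP_mono) (rule bexI, auto simp: M compact_imp_closed intro!: emeasure_mono)
    finally show "emeasure lborel (cball 0 (real n) \<inter> A) \<le> (SUP K \<in> {K. K \<subseteq> A \<and> compact K}. emeasure lborel K)" .
  qed
  finally show "emeasure lborel A \<le> (SUP K \<in> {K. K \<subseteq> A \<and> compact K}. emeasure lborel K)" .
qed (rule SUP_least, rule emeasure_mono, auto)

text \<open>The two halved translates of \<open>A\<close> and \<open>B\<close> that meet only in the midpoint of \<open>Sup A\<close> and
  \<open>Inf B\<close> both lie in the set of midpoints.\<close>

lemma midpoint_emeasure_compact:
  fixes A B C :: "real set"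
  assumes "compact A" "compact B" "A \<noteq> {}" "B \<noteq> {}" and [measurable]: "C \<in> sets borel"
    and C: "\<And>x y. x \<in> A \<Longrightarrow> y \<in> B \<Longrightarrow> (1/2) * (x + y) \<in> C"
  shows "emeasure lborel A + emeasure lborel B \<le> 2 * emeasure lborel C"
proof -
  obtain a where a: "a \<in> A" "\<And>x. x \<in> A \<Longrightarrow> x \<le> a" using compact_attains_sup[OF assms(1,3)] by auto
  obtain b where b: "b \<in> B" "\<And>x. x \<in> B \<Longrightarrow> b \<le> x" using compact_attains_inf[OF assms(2,4)] by auto
  have [measurable]: "A \<in> sets borel" "B \<in> sets borel" by (auto simp: assms(1,2) compact_imp_closed)
  have half: "emeasure lborel D = 2 * emeasure lborel {z. 2 * z - c \<in> D}" if [measurable]: "D \<in> sets borel" for D :: "real set" and c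
  proof -
    have "emeasure lborel D = (\<integral>\<^sup>+x. indicator D x \<partial>lborel)" by simp
    also have "\<dots> = ennreal \<bar>2\<bar> * (\<integral>\<^sup>+x. indicator D (- c + 2 * x) \<partial>lborel)"
      by (rule nn_integral_real_affine) auto
    also have "(\<integral>\<^sup>+x. indicator D (- c + 2 * x) \<partial>lborel) = (\<integral>\<^sup>+x. indicator {z. 2 * z - c \<in> D} x \<partial>lborel)"
      by (intro nn_integral_cong) (auto simp: indicator_def)
    also have "\<dots> = emeasure lborel {z. 2 * z - c \<in> D}"
      by (rule nn_integral_indicator) simp
    finally show ?thesis by simp
  qed
  let ?A = "{z. 2 * z - b \<in> A}" and ?B = "{z. 2 * z - a \<in> B}"
  have "?A \<inter> ?B \<subseteq> {(a + b) / 2}" 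
  proof
    fix z assume "z \<in> ?A \<inter> ?B"
    then have "2 * z - b \<le> a" "b \<le> 2 * z - a" using a(2) b(2) by auto
    then show "z \<in> {(a + b) / 2}" by simp
  qed
  then have null: "?A \<inter> ?B \<in> null_sets lborel"
    by (rule null_sets_subset[rotated 2]) auto
  have "emeasure lborel ?A + emeasure lborel ?B = emeasure lborel (?A \<union> ?B)"
    by (rule emeasure_Un'[symmetric]) (use null in auto)
  also have "\<dots> \<le> emeasure lborel C"
  proof (rule emeasure_mono)
    show "?A \<union> ?B \<subseteq> C"
    proof
      fix z assume "z \<in> ?A \<union> ?B"
      then show "z \<in> C" using C[of "2 * z - b" b] C[of a "2 * z - a"] a(1) b(1) by auto
    qed
  qed simp
  finally have "2 * (emeasure lborel ?A + emeasure lborel ?B) \<le> 2 * emeasure lborel C"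
    by (rule mult_left_mono) simp
  then show ?thesis by (simp add: half[of A b] half[of B a] distrib_left)
qed

lemma midpoint_emeasure_real:
  fixes A B C :: "real set"
  assumes [measurable]: "A \<in> sets borel" "B \<in> sets borel" "C \<in> sets borel" and ne: "A \<noteq> {}" "B \<noteq> {}"
    and C: "\<And>x y. x \<in> A \<Longrightarrow> y \<in> B \<Longrightarrow> (1/2) * (x + y) \<in> C"
  shows "emeasure lborel A + emeasure lborel B \<le> 2 * emeasure lborel C"
proof -
  obtain a b where ab: "a \<in> A" "b \<in> B" using ne by auto
  have fix_B: "emeasure lborel A + emeasure lborel L \<le> 2 * emeasure lborel C" if L: "compact L" "L \<subseteq> B" for L
  proof -
    have "emeasure lborel A + emeasure lborel L = (SUP K \<in> {K. K \<subseteq> A \<and> compact K}. emeasure lborel K + emeasure lborel L)"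
      unfolding emeasure_lborel_inner_regular[OF assms(1)] by (subst ennreal_SUP_add_left) auto
    also have "\<dots> \<le> 2 * emeasure lborel C"
    proof (rule SUP_least)
      fix K assume "K \<in> {K. K \<subseteq> A \<and> compact K}"
      then have K: "K \<subseteq> A" "compact K" by auto
      have "emeasure lborel K + emeasure lborel L \<le> emeasure lborel (insert a K) + emeasure lborel (insert b L)"
        using K L by (intro add_mono emeasure_mono) (auto simp: compact_imp_closed)
      also have "\<dots> \<le> 2 * emeasure lborel C"
        by (rule midpoint_emeasure_compact) (use K L ab C in auto)
      finally show "emeasure lborel K + emeasure lborel L \<le> 2 * emeasure lborel C" .
    qed
    finally show ?thesis .
  qed
  have "emeasure lborel A + emeasure lborel B = (SUP L \<in> {L. L \<subseteq> B \<and> compact L}. emeasure lborel A + emeasure lborel L)"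
    unfolding emeasure_lborel_inner_regular[OF assms(2)] by (subst ennreal_SUP_add_right) auto
  also have "\<dots> \<le> 2 * emeasure lborel C" by (rule SUP_least) (use fix_B in auto)
  finally show ?thesis .
qed

text \<open>The inequality for weights \<open>1/2\<close>, squared to avoid roots.\<close>

definition prekopa_leindler :: "'a::euclidean_space itself \<Rightarrow> bool" where
  "prekopa_leindler _ \<longleftrightarrow> (\<forall>f g h :: 'a \<Rightarrow> ennreal.
     f \<in> borel_measurable borel \<longrightarrow> g \<in> borel_measurable borel \<longrightarrow> h \<in> borel_measurable borel \<longrightarrow>
     (\<forall>x y. f x * g y \<le> (h ((1/2) *\<^sub>R (x + y)))\<^sup>2) \<longrightarrow>
     (\<integral>\<^sup>+x. f x \<partial>lborel) * (\<integral>\<^sup>+x. g x \<partial>lborel) \<le> (\<integral>\<^sup>+x. h x \<partial>lborel)\<^sup>2)"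

lemma prekopa_leindlerD:
  fixes f g h :: "'a::euclidean_space \<Rightarrow> ennreal"
  assumes "prekopa_leindler TYPE('a)" "f \<in> borel_measurable borel" "g \<in> borel_measurable borel"
    "h \<in> borel_measurable borel" "\<And>x y. f x * g y \<le> (h ((1/2) *\<^sub>R (x + y)))\<^sup>2"
  shows "(\<integral>\<^sup>+x. f x \<partial>lborel) * (\<integral>\<^sup>+x. g x \<partial>lborel) \<le> (\<integral>\<^sup>+x. h x \<partial>lborel)\<^sup>2"
  using assms unfolding prekopa_leindler_def by blast

text \<open>When both suprema are \<open>1\<close>, every level set of \<open>f\<close> and of \<open>g\<close> below height \<open>1\<close> is nonempty, so the
  one-dimensional inequality for sets applies at each height.\<close>

lemma midpoint_nn_integral_real_normalized:
  fixes f g h :: "real \<Rightarrow> ennreal"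
  assumes [measurable]: "f \<in> borel_measurable borel" "g \<in> borel_measurable borel" "h \<in> borel_measurable borel"
    and h: "\<And>x y. f x * g y \<le> (h ((1/2) * (x + y)))\<^sup>2"
    and f1: "(SUP x. f x) = 1" and g1: "(SUP x. g x) = 1"
  shows "(\<integral>\<^sup>+x. f x \<partial>lborel) + (\<integral>\<^sup>+x. g x \<partial>lborel) \<le> 2 * (\<integral>\<^sup>+x. h x \<partial>lborel)"
proof -
  have level: "emeasure lborel {x. ennreal t < f x} + emeasure lborel {x. ennreal t < g x}
     \<le> 2 * emeasure lborel {x. ennreal t < h x}" if t: "0 \<le> t" for t
  proof (cases "t < 1")
    case True
    then have "ennreal t < (SUP x. f x)" "ennreal t < (SUP x. g x)" using f1 g1 t by simp_all
    then have ne: "{x. ennreal t < f x} \<noteq> {}" "{x. ennreal t < g x} \<noteq> {}"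
      by (auto simp: less_SUP_iff)
    show ?thesis
    proof (rule midpoint_emeasure_real[OF _ _ _ ne])
      fix x y assume "x \<in> {x. ennreal t < f x}" "y \<in> {x. ennreal t < g x}"
      then have "ennreal t < f x" "ennreal t < g y" by auto
      moreover have "f x \<le> 1" "g y \<le> 1" using SUP_upper[of x UNIV f] SUP_upper[of y UNIV g] f1 g1 by auto
      ultimately obtain p q where pq: "f x = ennreal p" "g y = ennreal q" "t < p" "t < q"
        using t by (cases "f x"; cases "g y") (auto simp: ennreal_less_iff top_unique)
      have "ennreal t * ennreal t = ennreal (t * t)" using t by (simp add: ennreal_mult)
      also have "\<dots> < ennreal (p * q)" using t pq by (intro ennreal_lessI mult_strict_mono') auto
      also have "\<dots> = f x * g y" using t pq by (simp add: ennreal_mult)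
      finally have "ennreal t * ennreal t < f x * g y" .
      also have "\<dots> \<le> (h ((1/2) * (x + y)))\<^sup>2" by (rule h)
      finally have "\<not> h ((1/2) * (x + y)) \<le> ennreal t"
        by (metis power2_eq_square mult_mono zero_le leD)
      then show "(1/2) * (x + y) \<in> {x. ennreal t < h x}" by simp
    qed measurable
  next
    case False
    have "f x \<le> 1" "g x \<le> 1" for x using SUP_upper[of x UNIV f] SUP_upper[of x UNIV g] f1 g1 by auto
    moreover have "1 \<le> ennreal t" using False by simp
    ultimately have "\<not> ennreal t < f x" "\<not> ennreal t < g x" for x by (meson leD order_trans)+
    then show ?thesis by simp
  qed
  have f_m: "f \<in> borel_measurable lborel" and g_m: "g \<in> borel_measurable lborel"
    and h_m: "h \<in> borel_measurable lborel" by simp_all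
  have "(\<integral>\<^sup>+x. f x \<partial>lborel) + (\<integral>\<^sup>+x. g x \<partial>lborel) =
     (\<integral>\<^sup>+t. emeasure lborel {x. ennreal t < f x} * indicator {0..} t
        + emeasure lborel {x. ennreal t < g x} * indicator {0..} t \<partial>lborel)"
    unfolding lborel.nn_integral_layer_cake[OF f_m]
      lborel.nn_integral_layer_cake[OF g_m]
    by (subst nn_integral_add) auto
  also have "\<dots> \<le> (\<integral>\<^sup>+t. 2 * (emeasure lborel {x. ennreal t < h x} * indicator {0..} t) \<partial>lborel)"
    by (intro nn_integral_mono) (auto simp: indicator_def level)
  also have "\<dots> = 2 * (\<integral>\<^sup>+x. h x \<partial>lborel)"
    unfolding lborel.nn_integral_layer_cake[OF h_m]
    by (subst nn_integral_cmult) auto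
  finally show ?thesis .
qed

text \<open>For bounded functions divide by the suprema and use \<open>4 * a * b \<le> (a + b)\<^sup>2\<close>; the general case follows by
  truncation.\<close>

lemma prekopa_leindler_real: "prekopa_leindler TYPE(real)"
proof -
  have bounded: "(\<integral>\<^sup>+x. f x \<partial>lborel) * (\<integral>\<^sup>+x. g x \<partial>lborel) \<le> (\<integral>\<^sup>+x. h x \<partial>lborel)\<^sup>2"
    if [measurable]: "f \<in> borel_measurable borel" "g \<in> borel_measurable borel" "h \<in> borel_measurable borel"
      and h: "\<And>x y. f x * g y \<le> (h ((1/2) * (x + y)))\<^sup>2"
      and fn: "\<And>x. f x \<le> ennreal n" and gn: "\<And>x. g x \<le> ennreal n"
    for f g h :: "real \<Rightarrow> ennreal" and n
  proof (cases "(SUP x. f x) = 0 \<or> (SUP x. g x) = 0")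
    case True
    moreover have "f x \<le> (SUP x. f x)" "g x \<le> (SUP x. g x)" for x by (auto intro: SUP_upper)
    ultimately have "(\<forall>x. f x = 0) \<or> (\<forall>x. g x = 0)" by (metis le_zero_eq)
    then show ?thesis by auto
  next
    case False
    have "(SUP x. f x) \<le> ennreal n" "(SUP x. g x) \<le> ennreal n" using fn gn by (auto intro: SUP_least)
    then obtain F G where FG: "(SUP x. f x) = ennreal F" "F > 0" "(SUP x. g x) = ennreal G" "G > 0"
      using False by (cases "SUP x. f x"; cases "SUP x. g x") (auto simp: top_unique less_eq_real_def)
    define k where "k = sqrt (F * G)"
    have k: "k > 0" "k\<^sup>2 = F * G" using FG by (auto simp: k_def)
    have "(\<integral>\<^sup>+x. ennreal (1 / F) * f x \<partial>lborel) + (\<integral>\<^sup>+x. ennreal (1 / G) * g x \<partial>lborel)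
        \<le> 2 * (\<integral>\<^sup>+x. ennreal (1 / k) * h x \<partial>lborel)"
    proof (rule midpoint_nn_integral_real_normalized)
      fix x y
      have "ennreal (1 / F) * f x * (ennreal (1 / G) * g y) = ennreal (1 / F) * ennreal (1 / G) * (f x * g y)"
        by (simp add: ac_simps)
      also have "ennreal (1 / F) * ennreal (1 / G) = ennreal ((1 / k)\<^sup>2)"
        using FG k by (simp add: power_divide flip: ennreal_mult)
      also have "ennreal ((1 / k)\<^sup>2) * (f x * g y) \<le> ennreal ((1 / k)\<^sup>2) * (h ((1/2) * (x + y)))\<^sup>2"
        by (rule mult_left_mono[OF h]) simp
      also have "\<dots> = (ennreal (1 / k) * h ((1/2) * (x + y)))\<^sup>2"
        using k by (simp add: power_mult_distrib ennreal_power)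
      finally show "ennreal (1 / F) * f x * (ennreal (1 / G) * g y) \<le> (ennreal (1 / k) * h ((1/2) * (x + y)))\<^sup>2" .
    next
      show "(SUP x. ennreal (1 / F) * f x) = 1"
        using FG by (subst SUP_mult_left_ennreal[symmetric]) (simp flip: ennreal_mult)
      show "(SUP x. ennreal (1 / G) * g x) = 1"
        using FG by (subst SUP_mult_left_ennreal[symmetric]) (simp flip: ennreal_mult)
    qed measurable
    then have le: "ennreal (1 / F) * (\<integral>\<^sup>+x. f x \<partial>lborel) + ennreal (1 / G) * (\<integral>\<^sup>+x. g x \<partial>lborel)
        \<le> 2 * (ennreal (1 / k) * (\<integral>\<^sup>+x. h x \<partial>lborel))"
      by (simp add: nn_integral_cmult)
    show ?thesis
    proof (cases "(\<integral>\<^sup>+x. h x \<partial>lborel)")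
      case top
      then show ?thesis by (simp add: power2_eq_square)
    next
      case (real r)
      have "ennreal (1 / F) * (\<integral>\<^sup>+x. f x \<partial>lborel) \<noteq> top" "ennreal (1 / G) * (\<integral>\<^sup>+x. g x \<partial>lborel) \<noteq> top"
      proof -
        have "2 * (ennreal (1 / k) * (\<integral>\<^sup>+x. h x \<partial>lborel)) \<noteq> top"
          by (simp add: real ennreal_mult_eq_top_iff)
        then show "ennreal (1 / F) * (\<integral>\<^sup>+x. f x \<partial>lborel) \<noteq> top" "ennreal (1 / G) * (\<integral>\<^sup>+x. g x \<partial>lborel) \<noteq> top"
          using le by (metis add.commute ennreal_add_eq_top top.extremum_uniqueI)+
      qed
      then obtain p q where pq: "(\<integral>\<^sup>+x. f x \<partial>lborel) = ennreal p" "0 \<le> p" "(\<integral>\<^sup>+x. g x \<partial>lborel) = ennreal q" "0 \<le> q"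
        using FG by (cases "(\<integral>\<^sup>+x. f x \<partial>lborel)"; cases "(\<integral>\<^sup>+x. g x \<partial>lborel)") (auto simp: ennreal_mult_eq_top_iff)
      have "ennreal (p / F + q / G) \<le> ennreal (2 * (r / k))"
      proof -
        have "ennreal (1 / F) * ennreal p = ennreal (p / F)" "ennreal (1 / G) * ennreal q = ennreal (q / G)"
          "ennreal (1 / k) * ennreal r = ennreal (r / k)"
          using FG pq k real by (subst ennreal_mult[symmetric]; simp)+
        moreover have "ennreal (p / F + q / G) = ennreal (p / F) + ennreal (q / G)"
          using FG pq by (intro ennreal_plus) auto
        moreover have "ennreal (2 * (r / k)) = 2 * ennreal (r / k)"
          using k real by (subst ennreal_mult) auto
        ultimately show ?thesis using le unfolding pq real(2) by simp
      qed
      then have le': "p / F + q / G \<le> 2 * (r / k)" using real k by (subst (asm) ennreal_le_iff) auto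
      have "4 * (a * b) \<le> (a + b)\<^sup>2" for a b :: real
        using zero_le_power2[of "a - b"] by (simp add: power2_eq_square algebra_simps)
      from this[of "p / F" "q / G"] have "4 * ((p / F) * (q / G)) \<le> (p / F + q / G)\<^sup>2" .
      also have "\<dots> \<le> (2 * (r / k))\<^sup>2" using le' pq FG by (intro power_mono) auto
      also have "\<dots> = 4 * (r\<^sup>2 / (F * G))" by (simp add: power_mult_distrib power_divide k)
      finally have "p * q \<le> r\<^sup>2" using FG by (simp add: field_simps)
      then show ?thesis using pq real by (simp add: ennreal_power flip: ennreal_mult)
    qed
  qed
  show ?thesis
    unfolding prekopa_leindler_def
  proof (intro allI impI)
    fix f g h :: "real \<Rightarrow> ennreal"
    assume [measurable]: "f \<in> borel_measurable borel" "g \<in> borel_measurable borel" "h \<in> borel_measurable borel"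
      and h: "\<forall>x y. f x * g y \<le> (h ((1/2) *\<^sub>R (x + y)))\<^sup>2"
    have trunc: "(\<integral>\<^sup>+x. u x \<partial>lborel) = (SUP n. \<integral>\<^sup>+x. min (u x) (of_nat n) \<partial>lborel)"
      if [measurable]: "u \<in> borel_measurable borel" for u :: "real \<Rightarrow> ennreal"
    proof -
      have "(SUP n. min (u x) (of_nat n)) = u x" for x
      proof (rule antisym)
        show "u x \<le> (SUP n. min (u x) (of_nat n))"
        proof (cases "u x")
          case (real r)
          obtain n where "r \<le> of_nat n" using real_arch_simple by auto
          then have "u x = min (u x) (of_nat n)" using real by (simp add: min_def ennreal_of_nat_eq_real_of_nat)
          also have "\<dots> \<le> (SUP n. min (u x) (of_nat n))" by (rule SUP_upper) simp
          finally show ?thesis .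
        qed (simp add: ennreal_SUP_of_nat_eq_top)
      qed (auto intro: SUP_least)
      then have "(\<integral>\<^sup>+x. u x \<partial>lborel) = (\<integral>\<^sup>+x. (SUP n. min (u x) (of_nat n)) \<partial>lborel)" by simp
      also have "\<dots> = (SUP n. \<integral>\<^sup>+x. min (u x) (of_nat n) \<partial>lborel)"
        by (rule nn_integral_monotone_convergence_SUP)
          (auto simp: incseq_def le_fun_def intro: min.coboundedI2)
      finally show ?thesis .
    qed
    have b: "(\<integral>\<^sup>+x. min (f x) (of_nat m) \<partial>lborel) * (\<integral>\<^sup>+x. min (g x) (of_nat n) \<partial>lborel) \<le> (\<integral>\<^sup>+x. h x \<partial>lborel)\<^sup>2" for m n
    proof (rule bounded)
      fix x y
      have "min (f x) (of_nat m) * min (g y) (of_nat n) \<le> f x * g y" by (intro mult_mono) auto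
      also have "\<dots> \<le> (h ((1/2) * (x + y)))\<^sup>2" using h by simp
      finally show "min (f x) (of_nat m) * min (g y) (of_nat n) \<le> (h ((1/2) * (x + y)))\<^sup>2" .
      show "min (f x) (of_nat m) \<le> ennreal (real (max m n))" "min (g x) (of_nat n) \<le> ennreal (real (max m n))"
        by (auto simp: ennreal_of_nat_eq_real_of_nat intro!: min.coboundedI2 ennreal_leI)
    qed measurable
    have "(\<integral>\<^sup>+x. f x \<partial>lborel) * (\<integral>\<^sup>+x. g x \<partial>lborel) =
      (SUP m. SUP n. (\<integral>\<^sup>+x. min (f x) (of_nat m) \<partial>lborel) * (\<integral>\<^sup>+x. min (g x) (of_nat n) \<partial>lborel))"
      unfolding trunc[OF \<open>f \<in> _\<close>] trunc[OF \<open>g \<in> _\<close>] 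
      by (subst SUP_mult_right_ennreal) (simp only: SUP_mult_left_ennreal)
    also have "\<dots> \<le> (\<integral>\<^sup>+x. h x \<partial>lborel)\<^sup>2" by (intro SUP_least b)
    finally show "(\<integral>\<^sup>+x. f x \<partial>lborel) * (\<integral>\<^sup>+x. g x \<partial>lborel) \<le> (\<integral>\<^sup>+x. h x \<partial>lborel)\<^sup>2" .
  qed
qed

lemma prekopa_leindler_prod:
  assumes 1: "prekopa_leindler TYPE('a::euclidean_space)" and 2: "prekopa_leindler TYPE('b::euclidean_space)"
  shows "prekopa_leindler TYPE('a \<times> 'b)"
  unfolding prekopa_leindler_def
proof (intro allI impI)
  fix f g h :: "'a \<times> 'b \<Rightarrow> ennreal"
  assume [measurable]: "f \<in> borel_measurable borel" "g \<in> borel_measurable borel" "h \<in> borel_measurable borel"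
    and h: "\<forall>x y. f x * g y \<le> (h ((1/2) *\<^sub>R (x + y)))\<^sup>2"
  have eq: "(\<integral>\<^sup>+z. u z \<partial>lborel) = (\<integral>\<^sup>+x. \<integral>\<^sup>+y. u (x, y) \<partial>lborel \<partial>lborel)"
    if [measurable]: "u \<in> borel_measurable borel" for u :: "'a \<times> 'b \<Rightarrow> ennreal"
    unfolding lborel_prod[symmetric] by (rule lborel.nn_integral_fst[symmetric]) (simp add: lborel_prod)
  have [measurable]: "(\<lambda>x. \<integral>\<^sup>+y. u (x, y) \<partial>lborel) \<in> borel_measurable borel"
    if "u \<in> borel_measurable borel" for u :: "'a \<times> 'b \<Rightarrow> ennreal"
    using lborel.borel_measurable_nn_integral_fst[of u "borel :: 'a measure"] that
    by (simp add: borel_prod)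
  show "(\<integral>\<^sup>+x. f x \<partial>lborel) * (\<integral>\<^sup>+x. g x \<partial>lborel) \<le> (\<integral>\<^sup>+x. h x \<partial>lborel)\<^sup>2"
    unfolding eq[OF \<open>f \<in> _\<close>] eq[OF \<open>g \<in> _\<close>] eq[OF \<open>h \<in> _\<close>]
  proof (rule prekopa_leindlerD[OF 1])
    fix x x' :: 'a
    show "(\<integral>\<^sup>+y. f (x, y) \<partial>lborel) * (\<integral>\<^sup>+y. g (x', y) \<partial>lborel)
      \<le> (\<integral>\<^sup>+y. h ((1/2) *\<^sub>R (x + x'), y) \<partial>lborel)\<^sup>2"
    proof (rule prekopa_leindlerD[OF 2])
      fix y y' :: 'b
      show "f (x, y) * g (x', y') \<le> (h ((1/2) *\<^sub>R (x + x'), (1/2) *\<^sub>R (y + y')))\<^sup>2"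
        using h[rule_format, of "(x, y)" "(x', y')"] by simp
    qed measurable
  qed measurable
qed

lemma prekopa_leindler_isometry:
  fixes f :: "'a::euclidean_space \<Rightarrow> 'b::euclidean_space"
  assumes f: "linear_isometry f" and D: "DIM('a) = DIM('b)" and pl: "prekopa_leindler TYPE('a)"
  shows "prekopa_leindler TYPE('b)"
  unfolding prekopa_leindler_def
proof (intro allI impI)
  fix u v w :: "'b \<Rightarrow> ennreal"
  assume [measurable]: "u \<in> borel_measurable borel" "v \<in> borel_measurable borel" "w \<in> borel_measurable borel"
    and w: "\<forall>x y. u x * v y \<le> (w ((1/2) *\<^sub>R (x + y)))\<^sup>2"
  note [measurable] = linear_isometry_measurable[OF f]
  have lin: "linear f" using f by (rule linear_isometry_linear)
  show "(\<integral>\<^sup>+x. u x \<partial>lborel) * (\<integral>\<^sup>+x. v x \<partial>lborel) \<le> (\<integral>\<^sup>+x. w x \<partial>lborel)\<^sup>2"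
    unfolding nn_integral_linear_isometry[OF f D \<open>u \<in> _\<close>] nn_integral_linear_isometry[OF f D \<open>v \<in> _\<close>]
      nn_integral_linear_isometry[OF f D \<open>w \<in> _\<close>]
  proof (rule prekopa_leindlerD[OF pl])
    fix x y
    show "u (f x) * v (f y) \<le> (w (f ((1/2) *\<^sub>R (x + y))))\<^sup>2"
      using w[rule_format, of "f x" "f y"] by (simp add: linear_add[OF lin] linear_scale[OF lin])
  qed measurable
qed

lemma linear_isometry_Complex: "linear_isometry (\<lambda>(a, b). Complex a b)"
  by (auto simp: linear_isometry_def norm_prod_def cmod_def complex_eq_iff intro!: linearI)

lemma prekopa_leindler_complex: "prekopa_leindler TYPE(complex)"
  by (rule prekopa_leindler_isometry[OF linear_isometry_Complex])
    (auto intro: prekopa_leindler_prod prekopa_leindler_real)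

text \<open>Midpoints of a point of \<open>A\<close> and a point of \<open>B\<close>: the Brunn-Minkowski inequality in its
  dimension-free multiplicative form.\<close>

lemma midpoint_emeasure:
  fixes A B C :: "'a::euclidean_space set"
  assumes pl: "prekopa_leindler TYPE('a)"
    and [measurable]: "A \<in> sets borel" "B \<in> sets borel" "C \<in> sets borel"
    and C: "\<And>x y. x \<in> A \<Longrightarrow> y \<in> B \<Longrightarrow> (1/2) *\<^sub>R (x + y) \<in> C"
  shows "emeasure lborel A * emeasure lborel B \<le> (emeasure lborel C)\<^sup>2"
proof -
  have "(\<integral>\<^sup>+x. indicator A x \<partial>lborel) * (\<integral>\<^sup>+x. indicator B x \<partial>lborel) \<le> (\<integral>\<^sup>+x. indicator C x \<partial>lborel)\<^sup>2"
    by (rule prekopa_leindlerD[OF pl]) (use C in \<open>auto simp: indicator_def\<close>)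
  then show ?thesis by simp
qed

section \<open>The Hermitian product and coordinates along a complex line\<close>

definition herm :: "complex^'n \<Rightarrow> complex^'n \<Rightarrow> complex" where
  "herm x y = (\<Sum>k\<in>UNIV. x $ k * cnj (y $ k))"

lemma herm_add_left: "herm (x + y) z = herm x z + herm y z"
  and herm_add_right: "herm z (x + y) = herm z x + herm z y"
  and herm_diff_left: "herm (x - y) z = herm x z - herm y z"
  and herm_diff_right: "herm z (x - y) = herm z x - herm z y"
  and herm_smult_left: "herm (c *s x) z = c * herm x z"
  and herm_smult_right: "herm z (c *s x) = cnj c * herm z x"
  and herm_zero [simp]: "herm 0 x = 0" "herm x 0 = 0"
  by (simp_all add: herm_def algebra_simps sum.distrib sum_subtractf sum_distrib_left)

lemma scaleR_eq_smult: "r *\<^sub>R x = of_real r *s (x :: complex^'n)"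
  unfolding scaleR_vec_def vector_scalar_mult_def by (simp add: scaleR_conv_of_real)

lemma herm_scaleR_left: "herm (r *\<^sub>R x) y = of_real r * herm x y"
  and herm_scaleR_right: "herm x (r *\<^sub>R y) = of_real r * herm x y"
  by (simp_all add: scaleR_eq_smult herm_smult_left herm_smult_right)

lemma herm_commute: "herm y x = cnj (herm x y)"
  by (simp add: herm_def mult.commute)

lemma Re_herm: "Re (herm x y) = x \<bullet> y"
  by (simp add: herm_def inner_vec_def inner_complex_def)

lemma herm_self: "herm x x = of_real ((norm x)\<^sup>2)"
proof (rule complex_eqI)
  show "Re (herm x x) = Re (of_real ((norm x)\<^sup>2))" by (simp add: Re_herm power2_norm_eq_inner)
  show "Im (herm x x) = Im (of_real ((norm x)\<^sup>2))" by (simp add: herm_def mult.commute)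
qed

lemma norm_smult: "norm (c *s x) = cmod c * norm (x :: complex^'n)"
proof -
  have "complex_of_real ((norm (c *s x))\<^sup>2) = c * cnj c * of_real ((norm x)\<^sup>2)"
    by (simp only: herm_self[symmetric] herm_smult_left herm_smult_right ac_simps)
  also have "\<dots> = of_real ((cmod c * norm x)\<^sup>2)"
    by (simp only: complex_norm_square[symmetric] power_mult_distrib of_real_mult of_real_power)
  finally have "(norm (c *s x))\<^sup>2 = (cmod c * norm x)\<^sup>2" by (simp only: of_real_eq_iff)
  then show ?thesis by simp
qed

lemma herm_Cauchy_Schwarz: "cmod (herm x y) \<le> norm x * norm y"
proof -
  have "cmod (herm x y) = Re (cnj (sgn (herm x y)) * herm x y)"
  proof (cases "herm x y = 0")
    case False
    have "cnj (sgn (herm x y)) * herm x y = of_real (inverse (cmod (herm x y))) * (herm x y * cnj (herm x y))"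
      by (simp add: sgn_div_norm scaleR_conv_of_real)
    also have "\<dots> = of_real (inverse (cmod (herm x y)) * (cmod (herm x y))\<^sup>2)"
      by (simp only: complex_norm_square[symmetric] of_real_mult)
    finally show ?thesis using False by (simp add: power2_eq_square)
  qed simp
  also have "\<dots> = (cnj (sgn (herm x y)) *s x) \<bullet> y" by (simp add: herm_smult_left flip: Re_herm)
  also have "\<dots> \<le> norm (cnj (sgn (herm x y)) *s x) * norm y" by (rule norm_cauchy_schwarz)
  also have "\<dots> \<le> norm x * norm y"
    by (intro mult_right_mono) (auto simp: norm_smult norm_sgn)
  finally show ?thesis .
qed

lemma continuous_on_herm [continuous_intros]:
  "continuous_on A f \<Longrightarrow> continuous_on A g \<Longrightarrow> continuous_on A (\<lambda>x. herm (f x) (g x))"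
  unfolding herm_def by (intro continuous_intros)

lemma herm_measurable [measurable (raw)]:
  assumes [measurable]: "f \<in> borel_measurable M" "g \<in> borel_measurable M"
  shows "(\<lambda>x. herm (f x) (g x)) \<in> borel_measurable M"
proof -
  have "(\<lambda>p. herm (fst p) (snd p)) \<in> borel_measurable (borel :: ((complex^'n) \<times> (complex^'n)) measure)"
    by (intro borel_measurable_continuous_onI continuous_intros)
  from measurable_compose[OF _ this, of "\<lambda>x. (f x, g x)" M] show ?thesis by simp
qed

lemma complex_hyperplane_herm: "complex_hyperplane \<xi> = {z. herm z \<xi> = 0}"
  by (simp add: complex_hyperplane_def herm_def)

lemma orthogonal_complex_line: "(\<forall>c. orthogonal (c *s e) y) \<longleftrightarrow> herm y e = 0"
proof
  assume o: "\<forall>c. orthogonal (c *s e) y"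
  have "Re (herm (cnj (herm e y) *s e) y) = 0"
    using o by (simp add: Re_herm orthogonal_def)
  then have "Re (complex_of_real ((cmod (herm e y))\<^sup>2)) = 0"
    by (simp only: herm_smult_left complex_norm_square mult.commute)
  then show "herm y e = 0" by (simp add: herm_commute[of y e])
next
  assume "herm y e = 0"
  then have "herm e y = 0" by (simp add: herm_commute[of e y])
  then show "\<forall>c. orthogonal (c *s e) y" by (simp add: orthogonal_def herm_smult_left flip: Re_herm)
qed

lemma complete_linear_isometry:
  fixes G :: "'p::euclidean_space \<Rightarrow> 'a::euclidean_space"
  assumes G: "linear_isometry G" and D: "DIM('p) + DIM('c) = DIM('a)"
  obtains E :: "'c::euclidean_space \<Rightarrow> 'a" where
    "linear_isometry E" "range E = {y. \<forall>p. orthogonal (G p) y}" "linear_isometry (\<lambda>(p, w). G p + E w)"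
proof -
  have linG: "linear G" using G by (rule linear_isometry_linear)
  let ?H = "{y. \<forall>p. orthogonal (G p) y}"
  have "dim {y \<in> UNIV. \<forall>x\<in>range G. orthogonal x y} + dim (range G) = dim (UNIV :: 'a set)"
    by (intro dim_subspace_orthogonal_to_vectors linear_subspace_image[OF linG] subspace_UNIV) auto
  moreover have "dim (range G) = DIM('p)"
    using dim_image_eq[OF linG, of UNIV] linear_isometry_inj[OF G] by (simp add: inj_on_subset[of G UNIV])
  ultimately have "dim ?H = DIM('c)" using D by simp
  moreover have "subspace ?H" by (auto simp: subspace_def orthogonal_def inner_add_right)
  ultimately obtain E :: "'c \<Rightarrow> 'a" where E: "linear_isometry E" "range E = ?H"
    using ex_linear_isometry_onto by blast
  have linE: "linear E" using E(1) by (rule linear_isometry_linear)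
  have "linear_isometry (\<lambda>(p, w). G p + E w)"
    unfolding linear_isometry_def
  proof (intro conjI allI linearI)
    fix z :: "'p \<times> 'c"
    obtain p w where z: "z = (p, w)" by force
    have "E w \<in> ?H" using E(2) by blast
    then have "orthogonal (G p) (E w)" by blast
    then have "(norm (G p + E w))\<^sup>2 = (norm p)\<^sup>2 + (norm w)\<^sup>2"
      by (simp add: norm_add_Pythagorean linear_isometry_norm[OF G] linear_isometry_norm[OF E(1)])
    then show "norm (case z of (p, w) \<Rightarrow> G p + E w) = norm z"
      by (simp add: z norm_Pair real_sqrt_unique)
  qed (auto simp: linear_add[OF linG] linear_add[OF linE] linear_scale[OF linG] linear_scale[OF linE]
        scaleR_right_distrib)
  then show ?thesis using that E by blast
qed

lemma linear_isometry_complex_line: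
  assumes "norm (e :: complex^'n) = 1" shows "linear_isometry (\<lambda>c. c *s e)"
  unfolding linear_isometry_def
  by (auto intro!: linearI simp: norm_smult assms vec_eq_iff algebra_simps)

lemma line_coordinates:
  fixes e :: "complex^'n"
  assumes e: "norm e = 1" and D: "DIM('c) + 2 = DIM(complex^'n)"
  obtains E :: "'c::euclidean_space \<Rightarrow> complex^'n" where
    "linear_isometry E" "range E = complex_hyperplane e" "linear_isometry (\<lambda>(u, w). u *s e + E w)"
    "\<And>u w. herm (u *s e + E w) e = u"
proof -
  obtain E :: "'c \<Rightarrow> complex^'n" where E: "linear_isometry E"
    "range E = {y. \<forall>c. orthogonal (c *s e) y}" "linear_isometry (\<lambda>(u, w). u *s e + E w)"
    by (rule complete_linear_isometry[OF linear_isometry_complex_line[OF e]]) (use D in simp_all)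
  have r: "range E = complex_hyperplane e" using E(2) by (simp only: orthogonal_complex_line complex_hyperplane_herm)
  have "herm (u *s e + E w) e = u" for u w
  proof -
    have "E w \<in> complex_hyperplane e" using r by blast
    then show ?thesis by (simp add: herm_add_left herm_smult_left herm_self e complex_hyperplane_herm)
  qed
  then show ?thesis using that E r by blast
qed

section \<open>Parallel sections near the centre\<close>

text \<open>If \<open>K\<close> contains a ball of radius \<open>e\<close>, the section through \<open>u\<close> and the central one contain each other
  up to a translation by \<open>u\<close> and a factor \<open>1 \<plusminus> norm u / e\<close>: take convex combinations with the points
  \<open>\<plusminus> (e / norm u) u\<close> of that ball.\<close>

lemma slice_shrink:
  fixes F :: "'p::euclidean_space \<times> 'c::euclidean_space \<Rightarrow> 'a::euclidean_space"
  assumes F: "linear_isometry F" and K: "convex K" "cball 0 e \<subseteq> K" and u: "norm u < e"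
    and w: "F (0, w) \<in> K"
  shows "F (u, (1 - norm u / e) *\<^sub>R w) \<in> K"
proof -
  have lin: "linear F" using F by (rule linear_isometry_linear)
  have e: "e > 0" using u norm_ge_zero[of u] by linarith
  let ?t = "norm u / e"
  have "norm (F ((1 / ?t) *\<^sub>R u, 0)) \<le> e"
    using e by (cases "u = 0") (simp_all add: linear_isometry_norm[OF F] norm_Pair)
  then have "F ((1 / ?t) *\<^sub>R u, 0) \<in> K" using K(2) by auto
  then have "(1 - ?t) *\<^sub>R F (0, w) + ?t *\<^sub>R F ((1 / ?t) *\<^sub>R u, 0) \<in> K"
    using u e w by (intro convexD[OF K(1)]) auto
  also have "(1 - ?t) *\<^sub>R F (0, w) + ?t *\<^sub>R F ((1 / ?t) *\<^sub>R u, 0) = F (u, (1 - ?t) *\<^sub>R w)"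
    using e unfolding linear_scale[OF lin, symmetric] linear_add[OF lin, symmetric]
    by (cases "u = 0") simp_all
  finally show ?thesis .
qed

lemma slice_expand:
  fixes F :: "'p::euclidean_space \<times> 'c::euclidean_space \<Rightarrow> 'a::euclidean_space"
  assumes F: "linear_isometry F" and K: "convex K" "cball 0 e \<subseteq> K" and e: "e > 0"
    and w: "F (u, w) \<in> K"
  shows "F (0, (1 / (1 + norm u / e)) *\<^sub>R w) \<in> K"
proof -
  have lin: "linear F" using F by (rule linear_isometry_linear)
  let ?t = "norm u / e"
  have t: "?t \<ge> 0" using e by simp
  have "norm (F ((- 1 / ?t) *\<^sub>R u, 0)) \<le> e"
    using e by (cases "u = 0") (simp_all add: linear_isometry_norm[OF F] norm_Pair)
  then have "F ((- 1 / ?t) *\<^sub>R u, 0) \<in> K" using K(2) by auto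
  moreover have "1 / (1 + r) + r / (1 + r) = 1" if "r \<ge> 0" for r :: real
    using that by (simp flip: add_divide_distrib)
  note this[OF t]
  moreover have "0 \<le> r / (1 + r)" "0 \<le> 1 / (1 + r)" if "r \<ge> 0" for r :: real
    using that by simp_all
  note this[OF t]
  ultimately have "(1 / (1 + ?t)) *\<^sub>R F (u, w) + (?t / (1 + ?t)) *\<^sub>R F ((- 1 / ?t) *\<^sub>R u, 0) \<in> K"
    using w by (intro convexD[OF K(1)]) assumption+
  also have "(1 / (1 + ?t)) *\<^sub>R F (u, w) + (?t / (1 + ?t)) *\<^sub>R F ((- 1 / ?t) *\<^sub>R u, 0)
     = F ((1 / (1 + ?t)) *\<^sub>R (u + ?t *\<^sub>R (- 1 / ?t) *\<^sub>R u), (1 / (1 + ?t)) *\<^sub>R w)"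
    unfolding linear_scale[OF lin, symmetric] linear_add[OF lin, symmetric]
    by (simp add: scaleR_right_distrib)
  also have "u + ?t *\<^sub>R (- 1 / ?t) *\<^sub>R u = 0" using e by (cases "u = 0") simp_all
  finally show ?thesis by simp
qed

lemma slice_measurable [measurable]:
  fixes F :: "'p::euclidean_space \<times> 'c::euclidean_space \<Rightarrow> 'a::euclidean_space"
  assumes F: "linear_isometry F" and K: "K \<in> sets borel"
  shows "{w. F (u, w) \<in> K} \<in> sets borel"
proof -
  note [measurable] = linear_isometry_measurable[OF F] K
  show ?thesis by measurable
qed

lemma slice_emeasure_bounds:
  fixes F :: "'p::euclidean_space \<times> 'c::euclidean_space \<Rightarrow> 'a::euclidean_space"
  assumes F: "linear_isometry F" and K: "convex K" "K \<in> sets borel" "cball 0 e \<subseteq> K" and u: "norm u \<le> s" "s < e"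
  shows "ennreal ((1 - s / e) ^ DIM('c)) * emeasure lborel {w. F (0, w) \<in> K} \<le> emeasure lborel {w. F (u, w) \<in> K}"
    and "emeasure lborel {w. F (u, w) \<in> K} \<le> ennreal ((1 + s / e) ^ DIM('c)) * emeasure lborel {w. F (0, w) \<in> K}"
proof -
  have e: "e > 0" using u norm_ge_zero[of u] by linarith
  let ?t = "norm u / e"
  have t: "0 \<le> ?t" "?t < 1" "?t \<le> s / e" "s / e < 1" using u e by (auto simp: divide_right_mono)
  have m: "{w. F (v, w) \<in> K} \<in> sets borel" for v by (rule slice_measurable[OF F K(2)])
  have "ennreal ((1 - s / e) ^ DIM('c)) * emeasure lborel {w. F (0, w) \<in> K}
     \<le> ennreal ((1 - ?t) ^ DIM('c)) * emeasure lborel {w. F (0, w) \<in> K}"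
    using t by (intro mult_right_mono ennreal_leI power_mono) auto
  also have "\<dots> \<le> ennreal ((1 - ?t) ^ DIM('c)) * emeasure lborel {w. (1 - ?t) *\<^sub>R w \<in> {w. F (u, w) \<in> K}}"
  proof (intro mult_left_mono emeasure_mono)
    show "{w. F (0, w) \<in> K} \<subseteq> {w. (1 - ?t) *\<^sub>R w \<in> {w. F (u, w) \<in> K}}"
      using slice_shrink[OF F K(1,3)] u by auto
    show "{w. (1 - ?t) *\<^sub>R w \<in> {w. F (u, w) \<in> K}} \<in> sets lborel"
      using m[of u] by measurable
  qed simp
  also have "\<dots> = emeasure lborel {w. F (u, w) \<in> K}"
    using t m by (subst mult.commute, intro emeasure_lborel_scale) auto
  finally show "ennreal ((1 - s / e) ^ DIM('c)) * emeasure lborel {w. F (0, w) \<in> K} \<le> emeasure lborel {w. F (u, w) \<in> K}" .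
  have "emeasure lborel {w. F (u, w) \<in> K} \<le> emeasure lborel {w. (1 / (1 + ?t)) *\<^sub>R w \<in> {w. F (0, w) \<in> K}}"
  proof (rule emeasure_mono)
    show "{w. F (u, w) \<in> K} \<subseteq> {w. (1 / (1 + ?t)) *\<^sub>R w \<in> {w. F (0, w) \<in> K}}"
      using slice_expand[OF F K(1,3) e] by auto
    show "{w. (1 / (1 + ?t)) *\<^sub>R w \<in> {w. F (0, w) \<in> K}} \<in> sets lborel"
      using m[of 0] by measurable
  qed
  also have "\<dots> = ennreal ((1 + ?t) ^ DIM('c)) * emeasure lborel {w. F (0, w) \<in> K}"
    using t by (intro emeasure_lborel_scale_inverse m) auto
  also have "\<dots> \<le> ennreal ((1 + s / e) ^ DIM('c)) * emeasure lborel {w. F (0, w) \<in> K}"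
    using t by (intro mult_right_mono ennreal_leI power_mono) auto
  finally show "emeasure lborel {w. F (u, w) \<in> K} \<le> ennreal ((1 + s / e) ^ DIM('c)) * emeasure lborel {w. F (0, w) \<in> K}" .
qed

lemma nn_integral_fibers:
  fixes F :: "'p::euclidean_space \<times> 'c::euclidean_space \<Rightarrow> 'a::euclidean_space"
  assumes F: "linear_isometry F" and D: "DIM('p) + DIM('c) = DIM('a)" and g[measurable]: "g \<in> borel_measurable borel"
  shows "(\<integral>\<^sup>+x. g x \<partial>lborel) = (\<integral>\<^sup>+u. \<integral>\<^sup>+w. g (F (u, w)) \<partial>lborel \<partial>lborel)"
proof -
  note [measurable] = linear_isometry_measurable[OF F]
  have "(\<integral>\<^sup>+x. g x \<partial>lborel) = (\<integral>\<^sup>+z. g (F z) \<partial>lborel)"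
    by (rule nn_integral_linear_isometry[OF F _ g]) (use D in simp)
  also have "\<dots> = (\<integral>\<^sup>+u. \<integral>\<^sup>+w. g (F (u, w)) \<partial>lborel \<partial>lborel)"
    unfolding lborel_prod[symmetric] by (rule lborel.nn_integral_fst[symmetric]) (simp add: lborel_prod)
  finally show ?thesis .
qed


section \<open>Tubes around complex hyperplanes and continuity of the section volume\<close>

text \<open>Thin tubes approximate the section volume and depend on the hyperplane in a way that
  ordinary Lebesgue measure on the whole space can see.\<close>

definition tube :: "(complex^'n) set \<Rightarrow> real \<Rightarrow> complex^'n \<Rightarrow> (complex^'n) set" where
  "tube M s \<xi> = {x \<in> M. cmod (herm x \<xi>) \<le> s * norm \<xi>}"

lemma tube_measurable [measurable]: "M \<in> sets borel \<Longrightarrow> tube M s \<xi> \<in> sets borel"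
proof -
  assume M: "M \<in> sets borel"
  have "closed {x. cmod (herm x \<xi>) \<le> s * norm \<xi>}"
    by (intro closed_Collect_le continuous_intros)
  moreover have "tube M s \<xi> = M \<inter> {x. cmod (herm x \<xi>) \<le> s * norm \<xi>}" by (auto simp: tube_def)
  ultimately show ?thesis using M by auto
qed

lemma tube_scaleR: "c > 0 \<Longrightarrow> tube M s (c *\<^sub>R \<xi>) = tube M s \<xi>"
  by (auto simp: tube_def herm_scaleR_right norm_mult mult.left_commute[of s c])

lemma tube_sgn: "\<xi> \<noteq> 0 \<Longrightarrow> tube M s (sgn \<xi>) = tube M s \<xi>"
  unfolding sgn_div_norm by (rule tube_scaleR) simp

lemma section_volume_coordinates:
  fixes E :: "'c::euclidean_space \<Rightarrow> complex^'n"
  assumes E: "linear_isometry E" "range E = complex_hyperplane \<xi>" and M: "compact M"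
  shows "ennreal (section_volume M \<xi>) = emeasure lborel {w. E w \<in> M}"
proof -
  note [measurable] = linear_isometry_measurable[OF E(1)]
  have [measurable]: "M \<in> sets borel" using M by (simp add: compact_imp_closed)
  have "closed (complex_hyperplane \<xi>)" by (rule closed_subspace[OF subspace_complex_hyperplane])
  then have "M \<inter> complex_hyperplane \<xi> \<in> sets borel" by auto
  then have "section_volume M \<xi> = measure lborel (E -` (M \<inter> complex_hyperplane \<xi>) \<inter> space lborel)"
    unfolding section_volume_def subspace_lborel_eq_distr[OF E] by (intro measure_distr) auto
  also have "E -` (M \<inter> complex_hyperplane \<xi>) \<inter> space lborel = {w. E w \<in> M}"
    using E(2) by auto
  finally have eq: "section_volume M \<xi> = measure lborel {w. E w \<in> M}" .
  obtain R where R: "\<And>x. x \<in> M \<Longrightarrow> norm x \<le> R" using compact_imp_bounded[OF M] by (auto simp: bounded_iff)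
  have "{w. E w \<in> M} \<subseteq> cball 0 \<bar>R\<bar>"
    using R by (force simp: linear_isometry_norm[OF E(1)] dest: R)
  then have "emeasure lborel {w. E w \<in> M} \<le> emeasure lborel (cball (0::'c) \<bar>R\<bar>)"
    by (rule emeasure_mono) simp
  also have "\<dots> < \<infinity>" by (simp add: emeasure_cball)
  finally show ?thesis by (simp add: eq emeasure_eq_ennreal_measure less_top)
qed

lemma tube_emeasure:
  fixes E :: "'c::euclidean_space \<Rightarrow> complex^'n"
  assumes F: "linear_isometry (\<lambda>(u, w). u *s \<xi> + E w)" and h: "\<And>u w. herm (u *s \<xi> + E w) \<xi> = u"
    and \<xi>: "norm \<xi> = 1" and D: "DIM('c) + 2 = DIM(complex^'n)" and M[measurable]: "M \<in> sets borel"
  shows "emeasure lborel (tube M s \<xi>) =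
    (\<integral>\<^sup>+u. indicator (cball 0 s) u * emeasure lborel {w. (\<lambda>(u, w). u *s \<xi> + E w) (u, w) \<in> M} \<partial>lborel)"
proof -
  let ?F = "\<lambda>(u, w). u *s \<xi> + E w"
  have "emeasure lborel (tube M s \<xi>) = (\<integral>\<^sup>+x. indicator (tube M s \<xi>) x \<partial>lborel)" by simp
  also have "\<dots> = (\<integral>\<^sup>+u. \<integral>\<^sup>+w. indicator (tube M s \<xi>) (?F (u, w)) \<partial>lborel \<partial>lborel)"
    by (rule nn_integral_fibers[OF F]) (use D in simp_all)
  also have "\<dots> = (\<integral>\<^sup>+u. \<integral>\<^sup>+w. indicator (cball 0 s) u * indicator {w. ?F (u, w) \<in> M} w \<partial>lborel \<partial>lborel)"
    by (intro nn_integral_cong) (auto simp: tube_def h \<xi> indicator_def)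
  also have "\<dots> = (\<integral>\<^sup>+u. indicator (cball 0 s) u * emeasure lborel {w. ?F (u, w) \<in> M} \<partial>lborel)"
    using slice_measurable[OF F M]
    by (intro nn_integral_cong) (subst nn_integral_cmult, auto)
  finally show ?thesis .
qed

lemma tube_bounds_coordinates:
  assumes D: "DIM('c::euclidean_space) + 2 = DIM(complex^'n)"
    and M: "compact M" "convex M" "cball (0 :: complex^'n) e \<subseteq> M" and s: "0 < s" "s < e" and \<xi>: "norm \<xi> = 1"
  shows "ennreal (pi * s\<^sup>2 * (1 - s / e) ^ DIM('c) * section_volume M \<xi>) \<le> emeasure lborel (tube M s \<xi>)"
    "emeasure lborel (tube M s \<xi>) \<le> ennreal (pi * s\<^sup>2 * (1 + s / e) ^ DIM('c) * section_volume M \<xi>)"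
proof -
  obtain E :: "'c \<Rightarrow> complex^'n" where E: "linear_isometry E" "range E = complex_hyperplane \<xi>"
    "linear_isometry (\<lambda>(u, w). u *s \<xi> + E w)" "\<And>u w. herm (u *s \<xi> + E w) \<xi> = u"
    by (rule line_coordinates[OF \<xi> D]) simp_all
  have mM[measurable]: "M \<in> sets borel" using M(1) by (simp add: compact_imp_closed)
  let ?F = "\<lambda>(u, w). u *s \<xi> + E w"
  have S: "emeasure lborel {w. ?F (0, w) \<in> M} = ennreal (section_volume M \<xi>)"
    using section_volume_coordinates[OF E(1,2) M(1)] by simp
  have S0: "section_volume M \<xi> \<ge> 0" by (simp add: section_volume_def)
  have *: "ennreal (pi * s\<^sup>2 * c ^ DIM('c) * section_volume M \<xi>) =
      (\<integral>\<^sup>+u. indicator (cball (0::complex) s) u * (ennreal (c ^ DIM('c)) * emeasure lborel {w. ?F (0, w) \<in> M}) \<partial>lborel)"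
    if "c \<ge> 0" for c
    using s that S0 by (simp only: S, subst nn_integral_multc)
      (auto simp: emeasure_cball unit_ball_vol_2 mult.assoc ennreal_mult intro!: borel_measurable_indicator)
  show "ennreal (pi * s\<^sup>2 * (1 - s / e) ^ DIM('c) * section_volume M \<xi>) \<le> emeasure lborel (tube M s \<xi>)"
    unfolding tube_emeasure[OF E(3,4) \<xi> D mM]
    using s slice_emeasure_bounds(1)[OF E(3) M(2) mM M(3)]
    by (subst *) (auto intro!: nn_integral_mono simp: indicator_def)
  show "emeasure lborel (tube M s \<xi>) \<le> ennreal (pi * s\<^sup>2 * (1 + s / e) ^ DIM('c) * section_volume M \<xi>)"
    unfolding tube_emeasure[OF E(3,4) \<xi> D mM]
    using s slice_emeasure_bounds(2)[OF E(3) M(2) mM M(3)]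
    by (subst *) (auto intro!: nn_integral_mono simp: indicator_def)
qed

lemma tube_bounds:
  fixes M :: "(complex^'n) set"
  assumes n: "CARD('n) = 2 \<or> CARD('n) = 3"
    and M: "compact M" "convex M" "cball 0 e \<subseteq> M" and s: "0 < s" "s < e" and \<xi>: "norm \<xi> = 1"
  shows "ennreal (pi * s\<^sup>2 * (1 - s / e) ^ (2 * CARD('n) - 2) * section_volume M \<xi>) \<le> emeasure lborel (tube M s \<xi>)"
    "emeasure lborel (tube M s \<xi>) \<le> ennreal (pi * s\<^sup>2 * (1 + s / e) ^ (2 * CARD('n) - 2) * section_volume M \<xi>)"
  using n tube_bounds_coordinates[where 'c=complex, OF _ M s \<xi>]
    tube_bounds_coordinates[where 'c="complex \<times> complex", OF _ M s \<xi>] by auto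

lemma tube_perturb:
  assumes "norm \<xi> = 1" "norm \<eta> = 1" "M \<subseteq> cball 0 R"
  shows "tube M s \<eta> \<subseteq> tube M (s + R * norm (\<xi> - \<eta>)) \<xi>"
proof
  fix x assume x: "x \<in> tube M s \<eta>"
  then have "x \<in> M" "norm x \<le> R" using assms(3) by (auto simp: tube_def)
  have "cmod (herm x \<xi>) \<le> cmod (herm x \<eta>) + cmod (herm x (\<xi> - \<eta>))"
    using norm_triangle_ineq[of "herm x \<eta>" "herm x (\<xi> - \<eta>)"] by (simp flip: herm_add_right)
  also have "cmod (herm x (\<xi> - \<eta>)) \<le> norm x * norm (\<xi> - \<eta>)" by (rule herm_Cauchy_Schwarz)
  also have "\<dots> \<le> R * norm (\<xi> - \<eta>)" using \<open>norm x \<le> R\<close> by (intro mult_right_mono) auto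
  finally show "x \<in> tube M (s + R * norm (\<xi> - \<eta>)) \<xi>"
    using x assms by (auto simp: tube_def)
qed

text \<open>Comparing a tube of width \<open>sqrt d\<close> around one hyperplane with a slightly wider tube around a
  hyperplane at distance \<open>d\<close>: both widths tend to \<open>0\<close>, and their ratio to \<open>1\<close>.\<close>

lemma continuous_on_section_volume:
  fixes M :: "(complex^'n) set"
  assumes n: "CARD('n) = 2 \<or> CARD('n) = 3" and M: "compact M" "convex M" "cball 0 e \<subseteq> M" "e > 0"
  shows "continuous_on (sphere 0 1) (section_volume M)"
proof -
  obtain R where R: "R > 0" "M \<subseteq> cball 0 R"
    using compact_imp_bounded[OF M(1)] by (auto simp: bounded_pos subset_iff)
  define m where "m = 2 * CARD('n) - 2"
  define \<psi> where "\<psi> d = (1 + R * sqrt d)\<^sup>2 * ((1 + (sqrt d + R * d) / e) / (1 - sqrt d / e)) ^ m" for d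
  have psi: "(\<psi> \<longlongrightarrow> 1) (at 0 within {0..})"
  proof -
    have "(\<psi> \<longlongrightarrow> (1 + R * sqrt 0)\<^sup>2 * ((1 + (sqrt 0 + R * 0) / e) / (1 - sqrt 0 / e)) ^ m) (at 0 within {0..})"
      unfolding \<psi>_def by (intro tendsto_intros) (use M(4) in auto)
    then show ?thesis by simp
  qed
  have compare: "section_volume M \<eta> \<le> section_volume M \<xi> * \<psi> (norm (\<xi> - \<eta>))"
    if u: "norm \<xi> = 1" "norm \<eta> = 1" and d: "sqrt (norm (\<xi> - \<eta>)) + R * norm (\<xi> - \<eta>) < e" for \<xi> \<eta>
  proof (cases "\<xi> = \<eta>")
    case True
    then show ?thesis by (simp add: \<psi>_def)
  next
    case False
    define d where "d = norm (\<xi> - \<eta>)"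
    define s where "s = sqrt d"
    have d0: "d > 0" "s > 0" "s\<^sup>2 = d" using False by (auto simp: d_def s_def)
    have se: "s + R * d < e" "s < e"
      using d mult_pos_pos[OF R(1) d0(1)] unfolding s_def d_def by linarith+
    have s': "0 < s + R * d" using R d0 by (simp add: add_pos_pos)
    have S0: "section_volume M \<xi> \<ge> 0" "section_volume M \<eta> \<ge> 0" by (simp_all add: section_volume_def)
    have mM: "M \<in> sets borel" using M(1) by (simp add: compact_imp_closed)
    have "ennreal (pi * s\<^sup>2 * (1 - s / e) ^ m * section_volume M \<eta>) \<le> emeasure lborel (tube M s \<eta>)"
      unfolding m_def by (rule tube_bounds(1)[OF n M(1-3) _ _ u(2)]) (use d0 se in auto)
    also have "\<dots> \<le> emeasure lborel (tube M (s + R * d) \<xi>)"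
      using tube_perturb[OF u R(2), of s] mM by (intro emeasure_mono) (auto simp: d_def)
    also have "\<dots> \<le> ennreal (pi * (s + R * d)\<^sup>2 * (1 + (s + R * d) / e) ^ m * section_volume M \<xi>)"
      unfolding m_def by (rule tube_bounds(2)[OF n M(1-3) s' se(1) u(1)])
    finally have "pi * s\<^sup>2 * (1 - s / e) ^ m * section_volume M \<eta>
        \<le> pi * (s + R * d)\<^sup>2 * (1 + (s + R * d) / e) ^ m * section_volume M \<xi>"
      using S0 s' M(4) by (subst (asm) ennreal_le_iff) (auto intro!: mult_nonneg_nonneg zero_le_power)
    also have "s + R * d = s * (1 + R * s)" using d0(3) by (simp add: algebra_simps power2_eq_square)
    finally have le: "s\<^sup>2 * ((1 - s / e) ^ m * section_volume M \<eta>)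
        \<le> s\<^sup>2 * ((1 + R * s)\<^sup>2 * (1 + s * (1 + R * s) / e) ^ m * section_volume M \<xi>)"
      by (simp add: power_mult_distrib mult.assoc)
    then have "(1 - s / e) ^ m * section_volume M \<eta>
        \<le> (1 + R * s)\<^sup>2 * (1 + s * (1 + R * s) / e) ^ m * section_volume M \<xi>"
      using d0 by (subst (asm) mult_le_cancel_left_pos) auto
    moreover have "(1 - s / e) ^ m > 0" using se M(4) by simp
    ultimately have "section_volume M \<eta>
        \<le> (1 + R * s)\<^sup>2 * (1 + s * (1 + R * s) / e) ^ m * section_volume M \<xi> / (1 - s / e) ^ m"
      by (simp add: pos_le_divide_eq mult.commute)
    also have "\<dots> = section_volume M \<xi> * \<psi> d"
      unfolding \<psi>_def s_def[symmetric] using d0(3)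
      by (simp add: power_divide algebra_simps power2_eq_square)
    finally show ?thesis by (simp add: d_def)
  qed
  show ?thesis
    unfolding continuous_on_def
  proof
    fix \<xi> :: "complex^'n" assume xi: "\<xi> \<in> sphere 0 1"
    have dist: "((\<lambda>\<eta>. norm (\<xi> - \<eta>)) \<longlongrightarrow> 0) (at \<xi> within sphere 0 1)"
      by (rule tendsto_eq_intros refl | simp)+
    have lim: "((\<lambda>\<eta>. \<psi> (norm (\<xi> - \<eta>))) \<longlongrightarrow> 1) (at \<xi> within sphere 0 1)"
      by (rule filterlim_compose[OF psi])
        (auto simp: filterlim_at eventually_at_filter intro!: dist)
    have small: "\<forall>\<^sub>F \<eta> in at \<xi> within sphere 0 1. sqrt (norm (\<xi> - \<eta>)) + R * norm (\<xi> - \<eta>) < e"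
    proof (rule order_tendstoD(2))
      show "((\<lambda>\<eta>. sqrt (norm (\<xi> - \<eta>)) + R * norm (\<xi> - \<eta>)) \<longlongrightarrow> sqrt 0 + R * 0) (at \<xi> within sphere 0 1)"
        by (intro tendsto_intros dist)
    qed (use M(4) in simp)
    have pos: "\<forall>\<^sub>F \<eta> in at \<xi> within sphere 0 1. \<psi> (norm (\<xi> - \<eta>)) > 0"
      by (rule order_tendstoD(1)[OF lim]) simp
    have on: "\<forall>\<^sub>F \<eta> in at \<xi> within sphere 0 1. \<eta> \<in> sphere 0 1"
      by (simp add: eventually_at_filter)
    show "(section_volume M \<longlongrightarrow> section_volume M \<xi>) (at \<xi> within sphere 0 1)"
    proof (rule tendsto_sandwich)
      show "\<forall>\<^sub>F \<eta> in at \<xi> within sphere 0 1. section_volume M \<xi> / \<psi> (norm (\<xi> - \<eta>)) \<le> section_volume M \<eta>"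
        using small pos on
      proof eventually_elim
        case (elim \<eta>)
        have "section_volume M \<xi> \<le> section_volume M \<eta> * \<psi> (norm (\<xi> - \<eta>))"
          using compare[of \<eta> \<xi>] elim xi by (simp add: norm_minus_commute)
        then show ?case using elim by (simp add: pos_divide_le_eq)
      qed
      show "\<forall>\<^sub>F \<eta> in at \<xi> within sphere 0 1. section_volume M \<eta> \<le> section_volume M \<xi> * \<psi> (norm (\<xi> - \<eta>))"
        using small on by eventually_elim (use compare xi in auto)
      show "((\<lambda>\<eta>. section_volume M \<xi> / \<psi> (norm (\<xi> - \<eta>))) \<longlongrightarrow> section_volume M \<xi>) (at \<xi> within sphere 0 1)"
        using tendsto_divide[OF tendsto_const lim, of "section_volume M \<xi>"] by simp
      show "((\<lambda>\<eta>. section_volume M \<xi> * \<psi> (norm (\<xi> - \<eta>))) \<longlongrightarrow> section_volume M \<xi>) (at \<xi> within sphere 0 1)"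
        using tendsto_mult[OF tendsto_const lim, of "section_volume M \<xi>"] by simp
    qed
  qed
qed

section \<open>Monotonicity of tubes: Brunn's theorem\<close>

lemma ennreal_power2_le_imp_le:
  assumes "x\<^sup>2 \<le> (y :: ennreal)\<^sup>2" shows "x \<le> y"
proof (cases y)
  case (real r)
  then have "y\<^sup>2 < top" by (simp add: power2_eq_square ennreal_mult_less_top)
  then have "x \<noteq> top" using assms by (auto simp: power2_eq_square)
  then obtain q where q: "x = ennreal q" "0 \<le> q" by (cases x) auto
  then have "q\<^sup>2 \<le> r\<^sup>2" using real assms by (simp add: ennreal_power ennreal_le_iff)
  then show ?thesis using q real by (auto intro!: ennreal_leI power2_le_imp_le)
qed simp

text \<open>The section through \<open>u\<close> contains the midpoints of those through \<open>2 u\<close> and \<open>0\<close>, and the central one is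
  the largest because it contains the midpoints of those through \<open>v\<close> and \<open>- v\<close>, which have equal volume.\<close>

lemma slice_emeasure_antimono:
  fixes F :: "'p::euclidean_space \<times> 'c::euclidean_space \<Rightarrow> 'a::euclidean_space"
  assumes pl: "prekopa_leindler TYPE('c)"
    and F: "linear_isometry F" and K: "convex K" "K \<in> sets borel" "origin_symmetric K"
  shows "emeasure lborel {w. F (2 *\<^sub>R u, w) \<in> K} \<le> emeasure lborel {w. F (u, w) \<in> K}"
proof -
  have lin: "linear F" using F by (rule linear_isometry_linear)
  define a where "a u = {w. F (u, w) \<in> K}" for u
  have [measurable]: "a u \<in> sets borel" for u unfolding a_def by (rule slice_measurable[OF F K(2)])
  have mid: "(1/2) *\<^sub>R (w + w') \<in> a ((1/2) *\<^sub>R (v + v'))" if "w \<in> a v" "w' \<in> a v'" for v v' w w'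
  proof -
    have "(1/2) *\<^sub>R F (v, w) + (1/2) *\<^sub>R F (v', w') \<in> K"
      using that by (intro convexD[OF K(1)]) (auto simp: a_def)
    then show ?thesis
      by (simp add: a_def linear_add[OF lin, symmetric] linear_scale[OF lin, symmetric] scaleR_right_distrib)
  qed
  have neg: "emeasure lborel (a (- v)) = emeasure lborel (a v)" for v
  proof -
    have "linear_isometry (uminus :: 'c \<Rightarrow> 'c)" by (auto simp: linear_isometry_def intro!: linearI)
    then have "emeasure lborel (a (- v)) = emeasure lborel {w. - w \<in> a (- v)}"
      by (rule emeasure_linear_isometry) auto
    also have "{w. - w \<in> a (- v)} = a v"
    proof -
      have "F (- v, - w) = - F (v, w)" for w using linear_neg[OF lin, of "(v, w)"] by simp
      moreover have "- x \<in> K \<longleftrightarrow> x \<in> K" for x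
      proof
        show "x \<in> K \<Longrightarrow> - x \<in> K" using K(3) by (simp add: origin_symmetric_def)
        show "- x \<in> K \<Longrightarrow> x \<in> K" using K(3) unfolding origin_symmetric_def by (metis minus_minus)
      qed
      ultimately show ?thesis by (simp only: a_def mem_Collect_eq)
    qed
    finally show ?thesis .
  qed
  have central: "emeasure lborel (a v) \<le> emeasure lborel (a 0)" for v
  proof -
    have "emeasure lborel (a v) * emeasure lborel (a (- v)) \<le> (emeasure lborel (a 0))\<^sup>2"
    proof (rule midpoint_emeasure[OF pl])
      fix w w' assume "w \<in> a v" "w' \<in> a (- v)"
      from mid[OF this] show "(1/2) *\<^sub>R (w + w') \<in> a 0" by simp
    qed measurable
    then show ?thesis unfolding neg power2_eq_square[of "emeasure lborel (a v)", symmetric]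
      by (rule ennreal_power2_le_imp_le)
  qed
  have "(emeasure lborel (a (2 *\<^sub>R u)))\<^sup>2 \<le> emeasure lborel (a (2 *\<^sub>R u)) * emeasure lborel (a 0)"
    unfolding power2_eq_square by (rule mult_left_mono[OF central]) simp
  also have "\<dots> \<le> (emeasure lborel (a u))\<^sup>2"
  proof (rule midpoint_emeasure[OF pl])
    fix w w' assume "w \<in> a (2 *\<^sub>R u)" "w' \<in> a 0"
    from mid[OF this] show "(1/2) *\<^sub>R (w + w') \<in> a u" by simp
  qed measurable
  finally show ?thesis unfolding a_def by (rule ennreal_power2_le_imp_le)
qed

lemma tube_halving:
  fixes K :: "(complex^'n) set"
  assumes n: "CARD('n) = 3" and K: "convex K" "K \<in> sets borel" "origin_symmetric K" and \<xi>: "norm \<xi> = 1"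
  shows "emeasure lborel (tube K t \<xi>) \<le> 4 * emeasure lborel (tube K (t / 2) \<xi>)"
proof -
  have D: "DIM(complex \<times> complex) + 2 = DIM(complex^'n)" using n by simp
  obtain E :: "complex \<times> complex \<Rightarrow> complex^'n" where E: "linear_isometry E" "range E = complex_hyperplane \<xi>"
    "linear_isometry (\<lambda>(u, w). u *s \<xi> + E w)" "\<And>u w. herm (u *s \<xi> + E w) \<xi> = u"
    by (rule line_coordinates[OF \<xi> D]) simp_all
  define F where "F = (\<lambda>(u, w). u *s \<xi> + E w)"
  have F: "linear_isometry F" using E(3) by (simp add: F_def)
  note [measurable] = linear_isometry_measurable[OF F] K(2)
  have tube: "emeasure lborel (tube K s \<xi>) =
    (\<integral>\<^sup>+u. indicator (cball 0 s) u * emeasure lborel {w. F (u, w) \<in> K} \<partial>lborel)" for s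
    unfolding F_def by (rule tube_emeasure[OF E(3,4) \<xi> D K(2)])
  have a_m: "(\<lambda>u. emeasure lborel {w. F (u, w) \<in> K}) \<in> borel_measurable borel"
  proof -
    have "(\<lambda>u. emeasure lborel (Pair u -` (F -` K))) \<in> borel_measurable lborel"
      by (rule lborel.measurable_emeasure_Pair) (simp only: lborel_prod sets_lborel measurable_sets_borel[OF linear_isometry_measurable[OF F] K(2)])
    then show ?thesis by (simp add: vimage_def)
  qed
  have "emeasure lborel (tube K t \<xi>) = ennreal (2 ^ DIM(complex)) *
      (\<integral>\<^sup>+u. indicator (cball 0 t) (2 *\<^sub>R u) * emeasure lborel {w. F (2 *\<^sub>R u, w) \<in> K} \<partial>lborel)"
    unfolding tube
    by (rule nn_integral_lborel_scale[OF borel_measurable_times_ennreal[OF borel_measurable_indicator a_m]]) auto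
  also have "\<dots> \<le> ennreal (2 ^ DIM(complex)) *
      (\<integral>\<^sup>+u. indicator (cball 0 (t / 2)) u * emeasure lborel {w. F (u, w) \<in> K} \<partial>lborel)"
  proof (intro mult_left_mono nn_integral_mono mult_mono)
    fix u :: complex
    show "indicator (cball 0 t) (2 *\<^sub>R u) \<le> (indicator (cball 0 (t / 2)) u :: ennreal)"
      by (auto simp: indicator_def)
    show "emeasure lborel {w. F (2 *\<^sub>R u, w) \<in> K} \<le> emeasure lborel {w. F (u, w) \<in> K}"
      by (rule slice_emeasure_antimono[OF _ F K(1,2,3)])
        (intro prekopa_leindler_prod prekopa_leindler_complex)
  qed simp_all
  also have "\<dots> = 4 * emeasure lborel (tube K (t / 2) \<xi>)" by (simp add: tube)
  finally show ?thesis .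
qed

section \<open>Integrals of inverse squared gauges\<close>

lemma nn_integral_power_tail:
  assumes "T > 0" "n \<ge> 2" and that: "c \<ge> 0"
  shows "(\<integral>\<^sup>+t. ennreal (c * (1 / t) ^ n) * indicator {T..} t \<partial>lborel) = ennreal (c * (1 / T) ^ (n - 1) / (n - 1))"
proof -
  obtain k where k: "n = Suc (Suc k)" using assms(2) by (metis add_2_eq_Suc le_Suc_ex)
  have "(\<integral>\<^sup>+t. ennreal (if t > 0 then c * (1 / t) ^ n else 0) * indicator {T..} t \<partial>lborel)
     = ennreal (0 - (- c / Suc k * (1 / T) ^ Suc k))"
  proof (rule nn_integral_FTC_atLeast)
    show "(\<lambda>t. if t > 0 then c * (1 / t) ^ n else 0) \<in> borel_measurable borel" by measurable
    fix x assume x: "T \<le> x"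
    then have "x > 0" using assms by simp
    have "((\<lambda>x. 1 / x) has_real_derivative - (1 / x)\<^sup>2) (at x)"
      using \<open>x > 0\<close> by (auto intro!: derivative_eq_intros simp: power2_eq_square)
    from DERIV_cmult[OF DERIV_power[OF this, of "Suc k"], of "- c / Suc k"]
    have "((\<lambda>x. - c / Suc k * (1 / x) ^ Suc k) has_real_derivative c * ((1 / x)\<^sup>2 * (1 / x) ^ k)) (at x)"
      by (rule DERIV_cong) (simp del: of_nat_Suc)
    also have "c * ((1 / x)\<^sup>2 * (1 / x) ^ k) = (if x > 0 then c * (1 / x) ^ n else 0)"
      using \<open>x > 0\<close> by (simp add: k power2_eq_square)
    finally show "((\<lambda>x. - c / Suc k * (1 / x) ^ Suc k) has_real_derivative (if x > 0 then c * (1 / x) ^ n else 0)) (at x)" .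
    show "0 \<le> (if x > 0 then c * (1 / x) ^ n else 0)" using that by simp
  next
    have "((\<lambda>x::real. - c / Suc k * (1 / x) ^ Suc k) \<longlongrightarrow> - c / Suc k * 0 ^ Suc k) at_top"
      by (intro tendsto_intros tendsto_divide_0[OF tendsto_const filterlim_at_top_imp_at_infinity[OF filterlim_ident]])
    then show "((\<lambda>x. - c / Suc k * (1 / x) ^ Suc k) \<longlongrightarrow> 0) at_top" by simp
  qed
  also have "(\<integral>\<^sup>+t. ennreal (if t > 0 then c * (1 / t) ^ n else 0) * indicator {T..} t \<partial>lborel)
     = (\<integral>\<^sup>+t. ennreal (c * (1 / t) ^ n) * indicator {T..} t \<partial>lborel)"
    using assms(1) by (intro nn_integral_cong) (auto simp: indicator_def)
  finally show ?thesis by (simp add: k mult.commute)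
qed

lemma sublevel_inverse_square:
  assumes "t > 0" "ennreal t < ennreal (1 / y\<^sup>2)" "y \<ge> 0"
  shows "y < sqrt (1 / t)"
proof -
  have "t < 1 / y\<^sup>2" using assms by (simp add: ennreal_less_iff)
  then have "y \<noteq> 0" using assms by auto
  then have "y\<^sup>2 < 1 / t" using \<open>t < 1 / y\<^sup>2\<close> assms by (simp add: field_simps)
  then show ?thesis using assms by (simp add: real_less_rsqrt)
qed

text \<open>Layer cake: at height \<open>t\<close> the level set has measure at most both the volume of \<open>M\<close> and
  \<open>\<kappa> / t ^ n\<close>.  The two bounds cross at \<open>t = (\<kappa> / vol M) powr (1 / n)\<close>.\<close>

lemma inverse_square_gauge_integral_le:
  fixes N :: "'a::euclidean_space \<Rightarrow> real"
  assumes D: "DIM('a) = 2 * n" "n \<ge> 2" and [measurable]: "N \<in> borel_measurable borel" and N0: "\<And>x. N x \<ge> 0"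
    and level: "\<And>r. r > 0 \<Longrightarrow> emeasure lborel {x. N x \<le> r} \<le> ennreal (\<kappa> * r ^ (2 * n))" and \<kappa>: "\<kappa> > 0"
    and M[measurable]: "M \<in> sets borel" and v: "emeasure lborel M = ennreal v" "v > 0"
  shows "(\<integral>\<^sup>+x. ennreal (1 / (N x)\<^sup>2) * indicator M x \<partial>lborel)
     \<le> ennreal (real n / (real n - 1) * v powr ((real n - 1) / n) * \<kappa> powr (1 / n))"
proof -
  define T where "T = (\<kappa> / v) powr (1 / n)"
  have T: "T > 0" "T ^ n = \<kappa> / v" using \<kappa> v D by (auto simp: T_def powr_powr simp flip: powr_realpow)
  have "(\<integral>\<^sup>+x. ennreal (1 / (N x)\<^sup>2) * indicator M x \<partial>lborel) =
     (\<integral>\<^sup>+t. emeasure lborel {x\<in>space lborel. ennreal t < ennreal (1 / (N x)\<^sup>2) * indicator M x} * indicator {0..} t \<partial>lborel)"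
    by (rule lborel.nn_integral_layer_cake) measurable
  also have "\<dots> \<le> (\<integral>\<^sup>+t. ennreal v * indicator {0..T} t + ennreal (\<kappa> * (1 / t) ^ n) * indicator {T..} t \<partial>lborel)"
  proof (rule nn_integral_mono)
    fix t :: real
    let ?A = "{x\<in>space lborel. ennreal t < ennreal (1 / (N x)\<^sup>2) * indicator M x}"
    have [measurable]: "?A \<in> sets lborel" by measurable
    show "emeasure lborel ?A * indicator {0..} t
       \<le> ennreal v * indicator {0..T} t + ennreal (\<kappa> * (1 / t) ^ n) * indicator {T..} t"
    proof (cases "0 \<le> t")
      case t: True
      show ?thesis
      proof (cases "t \<le> T")
        case True
        define a where "a = emeasure lborel ?A"
        have "a \<le> emeasure lborel M"
          unfolding a_def by (rule emeasure_mono) (auto simp: indicator_def split: if_splits)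
        also have "emeasure lborel M = ennreal v * indicator {0..T} t" using t True v by simp
        also have "\<dots> \<le> ennreal v * indicator {0..T} t + ennreal (\<kappa> * (1 / t) ^ n) * indicator {T..} t"
          by simp
        finally have "a \<le> ennreal v * indicator {0..T} t + ennreal (\<kappa> * (1 / t) ^ n) * indicator {T..} t" .
        then show ?thesis using t unfolding a_def by simp
      next
        case False
        then have "t > 0" using T by simp
        have "emeasure lborel ?A \<le> emeasure lborel {x. N x \<le> sqrt (1 / t)}"
          using sublevel_inverse_square[OF \<open>t > 0\<close> _ N0]
          by (intro emeasure_mono) (auto simp: indicator_def less_imp_le split: if_splits)
        also have "\<dots> \<le> ennreal (\<kappa> * sqrt (1 / t) ^ (2 * n))" using \<open>t > 0\<close> by (intro level) simp
        also have "\<kappa> * sqrt (1 / t) ^ (2 * n) = \<kappa> * (1 / t) ^ n" using \<open>t > 0\<close> by (simp add: power_mult)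
        finally show ?thesis using False t by simp
      qed
    qed simp
  qed
  also have "\<dots> = ennreal v * ennreal T + ennreal (\<kappa> * (1 / T) ^ (n - 1) / (n - 1))"
  proof -
    have "(\<integral>\<^sup>+t. ennreal v * indicator {0..T} t \<partial>lborel) = ennreal v * ennreal T"
      using T by (simp add: nn_integral_cmult_indicator)
    then show ?thesis
      using nn_integral_power_tail[OF T(1) D(2) less_imp_le[OF \<kappa>]] by (subst nn_integral_add) simp_all
  qed
  also have "\<dots> = ennreal (v * T + \<kappa> * (1 / T) ^ (n - 1) / (n - 1))"
    using T D v \<kappa> by (simp add: ennreal_plus ennreal_mult)
  also have "v * T + \<kappa> * (1 / T) ^ (n - 1) / (n - 1) = n / (n - 1) * (v * T)"
  proof -
    have "\<kappa> = v * T ^ n" using T v by simp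
    also have "T ^ n = T * T ^ (n - 1)" using D(2) by (simp flip: power_Suc)
    finally have "\<kappa> * (1 / T) ^ (n - 1) = v * T" using T by (simp add: power_divide)
    then show ?thesis using D(2) by (simp add: field_simps of_nat_diff)
  qed
  also have "v * T = v powr ((n - 1) / n) * \<kappa> powr (1 / n)"
  proof -
    have "v powr ((n - 1) / n) = v powr (1 - 1 / n)" using D(2) by (simp add: diff_divide_distrib of_nat_diff)
    then show ?thesis using v \<kappa> D(2) by (simp add: T_def powr_divide powr_diff)
  qed
  finally show ?thesis using D(2) by (simp add: mult.assoc of_nat_diff)
qed

locale symmetric_body =
  fixes K :: "'a::euclidean_space set"
  assumes body: "convex_body K" and symmetric: "origin_symmetric K"
begin

lemma compact_body: "compact K" and convex_body: "convex K"
  using body by (auto simp: convex_body_def)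

lemma body_measurable [measurable]: "K \<in> sets borel"
  using compact_body by (simp add: compact_imp_closed)

lemma continuous_on_body_norm: "continuous_on A (body_norm K)"
proof -
  obtain e where e: "e > 0" "cball 0 e \<subseteq> K" using cball_subset_body[OF body symmetric] by blast
  have le: "body_norm K x \<le> norm x / e" for x
  proof (cases "x = 0")
    case False
    have "(e / norm x) *\<^sub>R x \<in> K" using e False by (intro subsetD[OF e(2)]) auto
    from body_norm_le[OF body symmetric _ this, of "norm x / e"] show ?thesis using e False by simp
  qed (simp add: body_norm_0[OF body symmetric])
  have "(1 / e)-lipschitz_on A (body_norm K)"
  proof (rule lipschitz_onI)
    fix x y
    have "body_norm K x \<le> body_norm K (x - y) + body_norm K y" "body_norm K y \<le> body_norm K (y - x) + body_norm K x"
      using body_norm_triangle[OF body symmetric, of "x - y" y] body_norm_triangle[OF body symmetric, of "y - x" x] by auto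
    then show "dist (body_norm K x) (body_norm K y) \<le> 1 / e * dist x y"
      using le[of "x - y"] le[of "y - x"] by (auto simp: dist_norm norm_minus_commute abs_le_iff)
  qed (use e in simp)
  then show ?thesis by (rule lipschitz_on_continuous_on)
qed

lemma body_norm_measurable [measurable]: "body_norm K \<in> borel_measurable borel"
  by (intro borel_measurable_continuous_onI continuous_on_body_norm)

lemma body_norm_pos: "x \<noteq> 0 \<Longrightarrow> body_norm K x > 0"
  using body_norm_nonneg[OF body symmetric, of x] body_norm_eq_0_iff[OF body symmetric, of x] by linarith

lemma emeasure_body_norm_le:
  assumes "r > 0" shows "emeasure lborel {x. body_norm K x \<le> r} = ennreal (r ^ DIM('a)) * emeasure lborel K"
proof -
  have "{x. body_norm K x \<le> r} = {x. (1 / r) *\<^sub>R x \<in> K}"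
  proof -
    have "y \<in> K \<longleftrightarrow> body_norm K y \<le> 1" for y
      using body_norm_unit_ball[OF body symmetric] by blast
    then show ?thesis using assms by (auto simp: body_norm_scaleR[OF body symmetric] field_simps)
  qed
  then show ?thesis using assms by (simp add: emeasure_lborel_scale_inverse[OF body_measurable])
qed

lemma emeasure_body: "emeasure lborel K = ennreal (measure lborel K)" "measure lborel K > 0"
proof -
  show 1: "emeasure lborel K = ennreal (measure lborel K)"
    using emeasure_compact_finite[OF compact_body] by (simp add: emeasure_eq_ennreal_measure less_top)
  obtain e where e: "e > 0" "cball 0 e \<subseteq> K" using cball_subset_body[OF body symmetric] by blast
  have "0 < emeasure lborel (cball (0::'a) e)" using e by (simp add: emeasure_cball)
  also have "\<dots> \<le> emeasure lborel K" using e by (intro emeasure_mono) auto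
  finally show "measure lborel K > 0" unfolding 1 by simp
qed

lemma inverse_square_body_norm_integral_le:
  assumes D: "DIM('a) = 2 * n" "n \<ge> 2" and M: "M \<in> sets borel" "emeasure lborel M = ennreal v" "v > 0"
  shows "(\<integral>\<^sup>+x. ennreal (1 / (body_norm K x)\<^sup>2) * indicator M x \<partial>lborel)
     \<le> ennreal (real n / (real n - 1) * v powr ((real n - 1) / n) * measure lborel K powr (1 / n))"
proof (rule inverse_square_gauge_integral_le[OF D _ _ _ _ M])
  show "emeasure lborel {x. body_norm K x \<le> r} \<le> ennreal (measure lborel K * r ^ (2 * n))" if "r > 0" for r
    using that by (simp add: emeasure_body_norm_le emeasure_body D mult.commute flip: ennreal_mult)
qed (simp_all add: emeasure_body body_norm_nonneg[OF body symmetric])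

text \<open>For the body itself both bounds on the level sets are attained: the level set at height \<open>t\<close> is
  the dilate of \<open>K\<close> by \<open>min 1 (sqrt (1 / t))\<close>, up to a null set.\<close>

lemma inverse_square_body_norm_integral_self:
  assumes D: "DIM('a) = 2 * n" "n \<ge> 2"
  shows "ennreal (real n / (real n - 1) * measure lborel K) \<le> (\<integral>\<^sup>+x. ennreal (1 / (body_norm K x)\<^sup>2) * indicator K x \<partial>lborel)"
proof -
  let ?\<kappa> = "measure lborel K" and ?N = "body_norm K"
  have "ennreal (real n / (real n - 1) * ?\<kappa>) = ennreal (?\<kappa> + ?\<kappa> * (1 / 1) ^ (n - 1) / (n - 1))"
    using D(2) by (simp add: field_simps of_nat_diff)
  also have "\<dots> = ennreal ?\<kappa> * emeasure lborel {0..<1::real} + (\<integral>\<^sup>+t. ennreal (?\<kappa> * (1 / t) ^ n) * indicator {1..} t \<partial>lborel)"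
    using D emeasure_body by (subst nn_integral_power_tail) (auto simp: ennreal_plus)
  also have "\<dots> = (\<integral>\<^sup>+t. ennreal ?\<kappa> * indicator {0..<1} t + ennreal (?\<kappa> * (1 / t) ^ n) * indicator {1..} t \<partial>lborel)"
    by (subst nn_integral_add) (auto simp: nn_integral_cmult)
  also have "\<dots> \<le> (\<integral>\<^sup>+t. emeasure lborel {x\<in>space lborel. ennreal t < ennreal (1 / (?N x)\<^sup>2) * indicator K x} * indicator {0..} t \<partial>lborel)"
  proof (rule nn_integral_mono)
    fix t :: real
    let ?A = "{x\<in>space lborel. ennreal t < ennreal (1 / (?N x)\<^sup>2) * indicator K x}"
    have [measurable]: "?A \<in> sets lborel" by measurable
    show "ennreal ?\<kappa> * indicator {0..<1} t + ennreal (?\<kappa> * (1 / t) ^ n) * indicator {1..} t \<le> emeasure lborel ?A * indicator {0..} t"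
    proof (cases "0 \<le> t")
      case t: True
      define r where "r = (if t < 1 then 1 else sqrt (1 / t))"
      have r: "0 < r" "r \<le> 1" by (auto simp: r_def)
      have nz: "emeasure lborel {x. ?N x < r} \<le> emeasure lborel (insert 0 ?A)"
      proof (rule emeasure_mono)
        show "{x. ?N x < r} \<subseteq> insert 0 ?A"
        proof
          fix x assume "x \<in> {x. ?N x < r}"
          then have x: "?N x < r" by simp
          show "x \<in> insert 0 ?A"
          proof (cases "x = 0")
            case False
            then have N: "?N x > 0" by (rule body_norm_pos)
            have "x \<in> K" using x r body_norm_unit_ball[OF body symmetric] by auto
            have "(?N x)\<^sup>2 < r\<^sup>2" using x N by (intro power_strict_mono) auto
            moreover have "t * r\<^sup>2 \<le> 1" using t by (auto simp: r_def)
            ultimately have "t * (?N x)\<^sup>2 < 1"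
            proof (cases "t = 0")
              case False
              then have "t * (?N x)\<^sup>2 < t * r\<^sup>2"
                using t \<open>(?N x)\<^sup>2 < r\<^sup>2\<close> by (intro mult_strict_left_mono) auto
              then show ?thesis using \<open>t * r\<^sup>2 \<le> 1\<close> by linarith
            qed simp
            then have "t < 1 / (?N x)\<^sup>2" using N by (simp add: pos_less_divide_eq)
            then show ?thesis using \<open>x \<in> K\<close> t by (simp add: ennreal_less_iff)
          qed simp
        qed
      qed simp
      have "ennreal (?\<kappa> * r ^ (2 * n)) \<le> emeasure lborel {x. ?N x < r}"
      proof -
        have scaled: "ennreal (?\<kappa> * q ^ (2 * n)) \<le> emeasure lborel {x. ?N x < r}" if "0 < q" "q < r" for q
        proof -
          have "ennreal (?\<kappa> * q ^ (2 * n)) = emeasure lborel {x. ?N x \<le> q}"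
            using that by (simp add: emeasure_body_norm_le emeasure_body D mult.commute flip: ennreal_mult)
          also have "\<dots> \<le> emeasure lborel {x. ?N x < r}" using that by (intro emeasure_mono) auto
          finally show ?thesis .
        qed
        \<comment> \<open>the open dilate is exhausted by closed ones, whose volume is known\<close>
        have "((\<lambda>q. ennreal (?\<kappa> * q ^ (2 * n))) \<longlongrightarrow> ennreal (?\<kappa> * r ^ (2 * n))) (at_left r)"
          by (intro tendsto_intros)
        then show ?thesis
        proof (rule tendsto_upperbound)
          show "\<forall>\<^sub>F q in at_left r. ennreal (?\<kappa> * q ^ (2 * n)) \<le> emeasure lborel {x. ?N x < r}"
            using eventually_at_left_real[OF r(1)] by eventually_elim (rule scaled, auto)
        qed simp
      qed
      also note nz
      also have "emeasure lborel (insert 0 ?A) = emeasure lborel ?A"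
        by (cases "0 \<in> ?A") (simp_all add: insert_absorb emeasure_insert)
      also have "?\<kappa> * r ^ (2 * n) = (if t < 1 then ?\<kappa> else ?\<kappa> * (1 / t) ^ n)"
        by (simp add: r_def power_mult)
      finally show ?thesis using t by (auto split: if_splits)
    qed simp
  qed
  also have "\<dots> = (\<integral>\<^sup>+x. ennreal (1 / (?N x)\<^sup>2) * indicator K x \<partial>lborel)"
    by (rule lborel.nn_integral_layer_cake[symmetric]) measurable
  finally show ?thesis .
qed

end

section \<open>Complex lines through a rotation invariant body\<close>

locale complex_body = symmetric_body K for K :: "(complex^'n) set" +
  assumes rotation_invariant: "rotation_invariant K"
begin

lemma body_norm_smult: "body_norm K (c *s x) = cmod c * body_norm K x"
proof -
  have t: "Arg2pi c \<in> {0..2 * pi}" using Arg2pi_ge_0[of c] Arg2pi_lt_2pi[of c] by auto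
  have "c *s x = cmod c *\<^sub>R (\<chi> k. rotation (Arg2pi c) (x $ k))"
    using Arg2pi_eq[of c]
    by (simp add: vec_eq_iff rotation_eq_cis_mult cis_conv_exp scaleR_conv_of_real[where 'a=complex] flip: mult.assoc)
  then have "body_norm K (c *s x) = cmod c * body_norm K (\<chi> k. rotation (Arg2pi c) (x $ k))"
    by (simp add: body_norm_scaleR[OF body symmetric])
  also have "body_norm K (\<chi> k. rotation (Arg2pi c) (x $ k)) = body_norm K x"
    using rotation_invariant t unfolding rotation_invariant_def by metis
  finally show ?thesis .
qed

lemma mem_body_iff: "x \<in> K \<longleftrightarrow> body_norm K x \<le> 1"
  using body_norm_unit_ball[OF body symmetric] by blast

lemma line_section: "x \<noteq> 0 \<Longrightarrow> emeasure lborel {c. c *s x \<in> K} = ennreal (pi / (body_norm K x)\<^sup>2)"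
proof -
  assume "x \<noteq> 0"
  then have N: "body_norm K x > 0" by (rule body_norm_pos)
  then have "{c. c *s x \<in> K} = cball 0 (1 / body_norm K x)"
    by (auto simp: mem_body_iff body_norm_smult pos_le_divide_eq)
  then show ?thesis using N by (simp add: emeasure_cball unit_ball_vol_2 power_divide)
qed

end

lemma symmetric_body_cball: "\<rho> > 0 \<Longrightarrow> symmetric_body (cball (0::'a::euclidean_space) \<rho>)"
  by (auto simp: symmetric_body_def convex_body_def origin_symmetric_def)

lemma body_norm_cball:
  assumes \<rho>: "\<rho> > 0" shows "body_norm (cball (0::'a::euclidean_space) \<rho>) x = norm x / \<rho>"
proof (rule antisym)
  interpret symmetric_body "cball (0::'a) \<rho>" by (rule symmetric_body_cball[OF \<rho>])
  show "body_norm (cball 0 \<rho>) x \<le> norm x / \<rho>"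
  proof (cases "x = 0")
    case False
    have "(\<rho> / norm x) *\<^sub>R x \<in> cball 0 \<rho>" using \<rho> False by simp
    from body_norm_le[OF body symmetric _ this, of "norm x / \<rho>"] show ?thesis using \<rho> False by simp
  qed (simp add: body_norm_0[OF body symmetric])
  show "norm x / \<rho> \<le> body_norm (cball 0 \<rho>) x"
  proof (rule dense_ge)
    fix t assume t: "body_norm (cball 0 \<rho>) x < t"
    then have "t > 0" using body_norm_nonneg[OF body symmetric, of x] by linarith
    have "(1 / t) *\<^sub>R x \<in> cball 0 \<rho>" by (rule body_norm_less_imp[OF body symmetric t])
    then show "norm x / \<rho> \<le> t" using \<open>t > 0\<close> \<rho> by (simp add: field_simps)
  qed
qed

lemma complex_body_cball:
  assumes "\<rho> > 0" shows "complex_body (cball (0 :: complex^'n) \<rho>)"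
proof -
  have "norm (\<chi> k. rotation \<theta> (x $ k)) = norm x" for \<theta> and x :: "complex^'n"
  proof -
    have "(\<chi> k. rotation \<theta> (x $ k)) = cis \<theta> *s x" by (simp add: vec_eq_iff rotation_eq_cis_mult)
    then show ?thesis by (simp add: norm_smult)
  qed
  then show ?thesis using symmetric_body_cball[OF assms] assms
    by (simp add: complex_body_def complex_body_axioms_def rotation_invariant_def body_norm_cball)
qed

lemma section_volume_cball_coordinates:
  assumes D: "DIM('c::euclidean_space) + 2 = DIM(complex^'n)" and "\<rho> > 0" "norm (\<xi> :: complex^'n) = 1"
  shows "section_volume (cball 0 \<rho>) \<xi> = unit_ball_vol DIM('c) * \<rho> ^ DIM('c)"
proof -
  obtain E :: "'c \<Rightarrow> complex^'n" where E: "linear_isometry E" "range E = complex_hyperplane \<xi>"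
    "linear_isometry (\<lambda>(u, w). u *s \<xi> + E w)" "\<And>u w. herm (u *s \<xi> + E w) \<xi> = u"
    by (rule line_coordinates[OF assms(3) D]) simp_all
  have "ennreal (section_volume (cball 0 \<rho>) \<xi>) = emeasure lborel {w. E w \<in> cball 0 \<rho>}"
    by (rule section_volume_coordinates[OF E(1,2)]) simp
  also have "{w. E w \<in> cball 0 \<rho>} = cball 0 \<rho>" by (auto simp: linear_isometry_norm[OF E(1)])
  finally show ?thesis using assms(2) by (simp add: emeasure_cball section_volume_def)
qed

lemma section_volume_cball_dim2:
  assumes "CARD('n) = 2" "\<rho> > 0" "norm (\<xi> :: complex^'n) = 1"
  shows "section_volume (cball 0 \<rho>) \<xi> = pi * \<rho>\<^sup>2"
  using section_volume_cball_coordinates[where 'c=complex, OF _ assms(2,3)] assms(1)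
  by (simp add: unit_ball_vol_2)

lemma section_volume_cball_dim3:
  assumes "CARD('n) = 3" "\<rho> > 0" "norm (\<xi> :: complex^'n) = 1"
  shows "section_volume (cball 0 \<rho>) \<xi> = pi\<^sup>2 / 2 * \<rho> ^ 4"
  using section_volume_cball_coordinates[where 'c="complex \<times> complex", OF _ assms(2,3)] assms(1)
  by (simp add: eval_unit_ball_vol)

lemma volume_cball_powr_le_section_volume:
  assumes n: "CARD('n) = 2 \<or> CARD('n) = 3" and \<rho>: "\<rho> > 0" and \<xi>: "norm (\<xi> :: complex^'n) = 1"
  shows "measure lborel (cball (0 :: complex^'n) \<rho>) powr ((real CARD('n) - 1) / real CARD('n))
     \<le> section_volume (cball 0 \<rho>) \<xi>"
  using n
proof
  assume n: "CARD('n) = 2"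
  have "pi\<^sup>2 / 2 * \<rho> ^ 4 \<le> (pi * \<rho>\<^sup>2)\<^sup>2" by (simp add: power_mult_distrib)
  then have "sqrt (pi\<^sup>2 / 2 * \<rho> ^ 4) \<le> pi * \<rho>\<^sup>2" by (intro real_le_lsqrt) auto
  then show ?thesis
    using n section_volume_cball_dim2[OF n \<rho> \<xi>] \<rho> by (simp add: content_cball eval_unit_ball_vol powr_half_sqrt)
next
  assume n: "CARD('n) = 3"
  define X where "X = pi ^ 3 / 6 * \<rho> ^ 6"
  have X: "X > 0" using \<rho> by (simp add: X_def)
  define Y where "Y = pi\<^sup>2 / 2 * \<rho> ^ 4"
  have Y: "Y > 0" using \<rho> by (simp add: Y_def)
  have "X\<^sup>2 \<le> Y ^ 3"
    using \<rho> by (simp add: X_def Y_def power_mult_distrib power_divide flip: power_mult)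
  then have "(X powr 2) powr (1 / 3) \<le> (Y powr 3) powr (1 / 3)"
    using X Y by (intro powr_mono2) (auto simp: powr_numeral)
  also have "(Y powr 3) powr (1 / 3) = Y" using Y unfolding powr_powr by simp
  finally have "X powr (2 / 3) \<le> pi\<^sup>2 / 2 * \<rho> ^ 4" unfolding powr_powr by (simp add: Y_def)
  then show ?thesis
    using n section_volume_cball_dim3[OF n \<rho> \<xi>] \<rho> by (simp add: X_def content_cball eval_unit_ball_vol)
qed

section \<open>Complex dimension two\<close>

text \<open>In \<open>\<complex>\<^sup>2\<close> every complex hyperplane is a complex line, which meets \<open>K\<close> in a disc.\<close>

lemma line_is_hyperplane_dim2:
  fixes e :: "complex^'n"
  assumes n: "CARD('n) = 2" and e: "norm e = 1"
  obtains \<xi> :: "complex^'n" where "norm \<xi> = 1" "range (\<lambda>c. c *s e) = complex_hyperplane \<xi>"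
proof -
  have D: "DIM(complex) + 2 = DIM(complex^'n)" using n by simp
  obtain E :: "complex \<Rightarrow> complex^'n" where E: "linear_isometry E" "range E = complex_hyperplane e"
    "linear_isometry (\<lambda>(u, w). u *s e + E w)" "\<And>u w. herm (u *s e + E w) e = u"
    by (rule line_coordinates[OF e D]) simp_all
  define \<xi> where "\<xi> = E 1"
  have \<xi>: "norm \<xi> = 1" by (simp add: \<xi>_def linear_isometry_norm[OF E(1)])
  have "herm \<xi> e = 0" using E(2) unfolding \<xi>_def complex_hyperplane_herm by blast
  then have "herm e \<xi> = 0" using herm_commute[of e \<xi>] by simp
  then have sub: "range (\<lambda>c. c *s e) \<subseteq> complex_hyperplane \<xi>"
    by (auto simp: complex_hyperplane_herm herm_smult_left)
  have dim_iso: "dim (range T) = 2" if T: "linear_isometry T" for T :: "complex \<Rightarrow> complex^'n"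
    using dim_image_eq[OF linear_isometry_linear[OF T], of UNIV] linear_isometry_inj[OF T]
    by (simp add: inj_on_subset[of T UNIV])
  obtain E' :: "complex \<Rightarrow> complex^'n" where E': "linear_isometry E'" "range E' = complex_hyperplane \<xi>"
    "linear_isometry (\<lambda>(u, w). u *s \<xi> + E' w)" "\<And>u w. herm (u *s \<xi> + E' w) \<xi> = u"
    by (rule line_coordinates[OF \<xi> D]) simp_all
  have "range (\<lambda>c. c *s e) = complex_hyperplane \<xi>"
  proof (rule subspace_dim_equal[OF _ subspace_complex_hyperplane sub])
    show "subspace (range (\<lambda>c. c *s e))"
      by (rule linear_subspace_image[OF linear_isometry_linear[OF linear_isometry_complex_line[OF e]] subspace_UNIV])
    show "dim (complex_hyperplane \<xi>) \<le> dim (range (\<lambda>c. c *s e))"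
      using dim_iso[OF linear_isometry_complex_line[OF e]] dim_iso[OF E'(1)] E'(2) by simp
  qed
  with \<xi> show ?thesis by (rule that)
qed

lemma inverse_square_comparison_dim2:
  fixes K L D :: "(complex^'n) set"
  assumes n: "CARD('n) = 2" and K: "complex_body K" and L: "complex_body L" and D: "complex_body D"
    and le: "\<And>\<xi>. norm \<xi> = 1 \<Longrightarrow> section_volume K \<xi> \<le> section_volume L \<xi> + section_volume D \<xi>"
    and x: "x \<noteq> 0"
  shows "1 / (body_norm K x)\<^sup>2 \<le> 1 / (body_norm L x)\<^sup>2 + 1 / (body_norm D x)\<^sup>2"
proof -
  define e where "e = sgn x"
  have e: "norm e = 1" "e \<noteq> 0" using x by (auto simp: e_def norm_sgn sgn_zero_iff)
  obtain \<xi> where \<xi>: "norm \<xi> = 1" "range (\<lambda>c. c *s e) = complex_hyperplane \<xi>"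
    by (rule line_is_hyperplane_dim2[OF n e(1)])
  have S: "section_volume M \<xi> = pi / norm x ^ 2 * (norm x ^ 4 / (body_norm M x)\<^sup>2)" if "complex_body M" for M
  proof -
    interpret complex_body M by fact
    have "ennreal (section_volume M \<xi>) = ennreal (pi / (body_norm M e)\<^sup>2)"
      using section_volume_coordinates[OF linear_isometry_complex_line[OF e(1)] \<xi>(2) compact_body]
        line_section[OF e(2)] by simp
    then have "section_volume M \<xi> = pi / (body_norm M e)\<^sup>2" by (simp add: section_volume_def)
    also have "body_norm M e = body_norm M x / norm x"
      unfolding e_def sgn_div_norm by (simp add: body_norm_scaleR[OF body symmetric] divide_inverse mult.commute)
    also have "pi / (body_norm M x / norm x)\<^sup>2 = pi / (norm x)\<^sup>2 * (((norm x)\<^sup>2)\<^sup>2 / (body_norm M x)\<^sup>2)"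
    proof -
      have "pi / (b / a)\<^sup>2 = pi / a\<^sup>2 * ((a\<^sup>2)\<^sup>2 / b\<^sup>2)" if "a \<noteq> 0" for a b :: real
        using that by (simp add: power_divide power2_eq_square)
      then show ?thesis using x by simp
    qed
    also have "((norm x)\<^sup>2)\<^sup>2 = norm x ^ 4" by (simp flip: power_mult)
    finally show ?thesis .
  qed
  define c where "c = pi / norm x ^ 2 * norm x ^ 4"
  have S': "section_volume M \<xi> = c * (1 / (body_norm M x)\<^sup>2)" if "complex_body M" for M
    unfolding S[OF that] c_def by simp
  have "c * (1 / (body_norm K x)\<^sup>2) \<le> c * (1 / (body_norm L x)\<^sup>2 + 1 / (body_norm D x)\<^sup>2)"
    using le[OF \<xi>(1)] unfolding S'[OF K] S'[OF L] S'[OF D] distrib_left .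
  moreover have "c > 0" using x by (simp add: c_def)
  ultimately show ?thesis by (rule mult_left_le_imp_le)
qed

lemma volume_comparison_from_integrals:
  assumes n: "n \<ge> (2::nat)" and pos: "\<kappa> > 0" "v \<ge> 0" "w \<ge> 0"
    and le: "real n / (real n - 1) * \<kappa> \<le> real n / (real n - 1) * v * \<kappa> powr (1 / n)
        + real n / (real n - 1) * w * \<kappa> powr (1 / n)"
  shows "\<kappa> powr ((real n - 1) / n) \<le> v + w"
proof -
  have "real n / (real n - 1) * \<kappa> \<le> real n / (real n - 1) * ((v + w) * \<kappa> powr (1 / n))"
    using le by (simp add: algebra_simps)
  then have "\<kappa> \<le> (v + w) * \<kappa> powr (1 / n)"
    using n by (subst (asm) mult_le_cancel_left_pos) auto
  moreover have "\<kappa> = \<kappa> powr ((real n - 1) / n) * \<kappa> powr (1 / n)"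
    using n pos by (simp add: diff_divide_distrib flip: powr_add)
  ultimately have "\<kappa> powr ((real n - 1) / n) * \<kappa> powr (1 / n) \<le> (v + w) * \<kappa> powr (1 / n)" by simp
  then show ?thesis using pos by (subst (asm) mult_le_cancel_right_pos) auto
qed

lemma volume_comparison_dim2:
  fixes K L D :: "(complex^'n) set"
  assumes n: "CARD('n) = 2" and K: "complex_body K" and L: "complex_body L" and D: "complex_body D"
    and le: "\<And>\<xi>. norm \<xi> = 1 \<Longrightarrow> section_volume K \<xi> \<le> section_volume L \<xi> + section_volume D \<xi>"
  shows "measure lborel K powr ((real CARD('n) - 1) / real CARD('n)) \<le>
     measure lborel L powr ((real CARD('n) - 1) / real CARD('n)) + measure lborel D powr ((real CARD('n) - 1) / real CARD('n))"
proof -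
  interpret K: complex_body K by fact
  interpret L: complex_body L by fact
  interpret D: complex_body D by fact
  have dim: "DIM(complex^'n) = 2 * 2" "2 \<le> (2::nat)" using n by simp_all
  have "ennreal (real 2 / (real 2 - 1) * measure lborel K) \<le> (\<integral>\<^sup>+x. ennreal (1 / (body_norm K x)\<^sup>2) * indicator K x \<partial>lborel)"
    by (rule K.inverse_square_body_norm_integral_self[OF dim])
  also have "\<dots> \<le> (\<integral>\<^sup>+x. ennreal (1 / (body_norm L x)\<^sup>2) * indicator K x + ennreal (1 / (body_norm D x)\<^sup>2) * indicator K x \<partial>lborel)"
  proof (rule nn_integral_mono_AE, rule AE_mp[OF AE_lborel_singleton[of 0]], rule AE_I2, rule impI)
    fix x :: "complex^'n" assume "x \<noteq> 0"
    from inverse_square_comparison_dim2[OF n K L D le this]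
    show "ennreal (1 / (body_norm K x)\<^sup>2) * indicator K x
        \<le> ennreal (1 / (body_norm L x)\<^sup>2) * indicator K x + ennreal (1 / (body_norm D x)\<^sup>2) * indicator K x"
      by (cases "x \<in> K") (simp_all flip: ennreal_plus)
  qed
  also have "\<dots> = (\<integral>\<^sup>+x. ennreal (1 / (body_norm L x)\<^sup>2) * indicator K x \<partial>lborel)
     + (\<integral>\<^sup>+x. ennreal (1 / (body_norm D x)\<^sup>2) * indicator K x \<partial>lborel)"
    by (rule nn_integral_add) measurable
  also have "\<dots> \<le> ennreal (real 2 / (real 2 - 1) * measure lborel K powr ((real 2 - 1) / real 2) * measure lborel L powr (1 / real 2))
      + ennreal (real 2 / (real 2 - 1) * measure lborel K powr ((real 2 - 1) / real 2) * measure lborel D powr (1 / real 2))"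
    by (intro add_mono L.inverse_square_body_norm_integral_le[OF dim] D.inverse_square_body_norm_integral_le[OF dim]
        K.emeasure_body K.body_measurable)
  finally have "real 2 / (real 2 - 1) * measure lborel K \<le>
     real 2 / (real 2 - 1) * measure lborel L powr (1 / 2) * measure lborel K powr (1 / real 2) +
     real 2 / (real 2 - 1) * measure lborel D powr (1 / 2) * measure lborel K powr (1 / real 2)"
    by (simp add: ac_simps flip: ennreal_plus)
  from volume_comparison_from_integrals[OF dim(2) K.emeasure_body(2) _ _ this] show ?thesis
    using n by simp
qed

section \<open>Volumes of cones in three complex variables\<close>

lemma emeasure_cmod_square_le:
  "emeasure lborel {z. (cmod z)\<^sup>2 \<le> a} = ennreal (pi * max 0 a)"
proof (cases "a \<ge> 0")
  case True
  then have "{z. (cmod z)\<^sup>2 \<le> a} = cball 0 (sqrt a)"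
    using real_le_rsqrt sqrt_ge_absD by (auto simp: real_sqrt_le_iff intro: power2_le_imp_le real_le_rsqrt dest: sqrt_ge_absD)
  then show ?thesis using True by (simp add: emeasure_cball unit_ball_vol_2)
next
  case False
  then have "\<not> (cmod z)\<^sup>2 \<le> a" for z using zero_le_power2[of "cmod z"] by linarith
  then show ?thesis using False by simp
qed

text \<open>The squared modulus turns Lebesgue measure on \<open>\<complex>\<close> into \<open>\<pi>\<close> times Lebesgue measure on the
  half line; conditions on squared moduli become linear ones.\<close>

lemma distr_cmod_square:
  "distr lborel borel (\<lambda>z::complex. (cmod z)\<^sup>2) = density lborel (\<lambda>p. ennreal pi * indicator {0..} p)" (is "?M = ?N")
proof (rule measure_eqI_generator_eq[where E="range atMost" and A="\<lambda>i::nat. {..real i}" and \<Omega>=UNIV])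
  show "Int_stable (range atMost :: real set set)" by (auto simp: Int_stable_def)
  have M: "emeasure ?M {..a} = ennreal (pi * max 0 a)" for a
    by (subst emeasure_distr) (auto simp: vimage_def emeasure_cmod_square_le)
  have N: "emeasure ?N {..a} = ennreal (pi * max 0 a)" for a
  proof -
    have "emeasure ?N {..a} = (\<integral>\<^sup>+p. ennreal pi * indicator {0..} p * indicator {..a} p \<partial>lborel)"
      by (rule emeasure_density) auto
    also have "\<dots> = (\<integral>\<^sup>+p. ennreal pi * indicator {0..a} p \<partial>lborel)"
      by (intro nn_integral_cong) (auto simp: indicator_def)
    also have "\<dots> = ennreal pi * ennreal (max 0 a)"
      by (subst nn_integral_cmult_indicator) (auto simp: max_def)
    finally show ?thesis by (simp add: ennreal_mult)
  qed
  show "emeasure ?M X = emeasure ?N X" if "X \<in> range atMost" for X using that M N by auto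
  show "emeasure ?M {..real i} \<noteq> \<infinity>" for i by (simp add: M)
  show "(\<Union>i. {..real i}) = UNIV" by (auto intro: real_arch_simple)
qed (auto simp: borel_eq_atMost)

lemma nn_integral_cmod_square:
  assumes [measurable]: "g \<in> borel_measurable borel"
  shows "(\<integral>\<^sup>+z. g ((cmod z)\<^sup>2) \<partial>lborel) = (\<integral>\<^sup>+p. ennreal pi * indicator {0..} p * g p \<partial>lborel)"
proof -
  have "(\<integral>\<^sup>+z. g ((cmod z)\<^sup>2) \<partial>lborel) = (\<integral>\<^sup>+p. g p \<partial>distr lborel borel (\<lambda>z::complex. (cmod z)\<^sup>2))"
    by (subst nn_integral_distr) auto
  then show ?thesis by (simp add: distr_cmod_square nn_integral_density)
qed

lemma simplex_integral:
  assumes "\<alpha> \<ge> 0" "\<beta> > 0" "\<rho> \<ge> 0"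
  shows "(\<integral>\<^sup>+q. \<integral>\<^sup>+p. indicator {0..} q * indicator {0..} p *
      (if p \<le> \<beta> * (p + q) \<and> p + q \<le> \<rho> then ennreal (\<alpha> * (p + q)) else 0) \<partial>lborel \<partial>lborel)
    = ennreal (\<alpha> * min 1 \<beta> * \<rho> ^ 3 / 3)"
proof -
  let ?g = "\<lambda>p q. indicator {0..} q * indicator {0..} p * (if p \<le> \<beta> * (p + q) \<and> p + q \<le> \<rho> then ennreal (\<alpha> * (p + q)) else 0) :: ennreal"
  let ?h = "\<lambda>p t. (if 0 \<le> p \<and> p \<le> min 1 \<beta> * t \<and> t \<le> \<rho> then ennreal (\<alpha> * t) else 0) :: ennreal"
  have "(\<integral>\<^sup>+q. \<integral>\<^sup>+p. ?g p q \<partial>lborel \<partial>lborel)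
    = (\<integral>\<^sup>+p. \<integral>\<^sup>+q. ?g p q \<partial>lborel \<partial>lborel)"
    by (rule lborel_pair.Fubini') measurable
  \<comment> \<open>pass from \<open>q\<close> to \<open>t = p + q\<close>\<close>
  also have "\<dots> = (\<integral>\<^sup>+p. \<integral>\<^sup>+t. ?h p t \<partial>lborel \<partial>lborel)"
  proof (rule nn_integral_cong)
    fix p :: real
    have "(\<integral>\<^sup>+t. ?h p t \<partial>lborel)
       = (\<integral>\<^sup>+q. ?h p (p + q) \<partial>lborel)"
      by (rule nn_integral_lborel_shift[symmetric]) measurable
    also have "\<dots> = (\<integral>\<^sup>+q. ?g p q \<partial>lborel)"
    proof (rule nn_integral_cong)
      fix q :: real
      have "p \<le> min 1 \<beta> * (p + q) \<longleftrightarrow> 0 \<le> q \<and> p \<le> \<beta> * (p + q)" if "0 \<le> p"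
      proof (cases "0 \<le> p + q")
        case True
        then have "min 1 \<beta> * (p + q) = min (p + q) (\<beta> * (p + q))"
          by (simp add: min_mult_distrib_right)
        then show ?thesis by auto
      next
        case False
        then have "min 1 \<beta> * (p + q) < 0" using assms by (intro mult_pos_neg) auto
        then show ?thesis using that False by auto
      qed
      then show "?h p (p + q)
        = ?g p q"
        by (auto simp: indicator_def)
    qed
    finally show "(\<integral>\<^sup>+q. ?g p q \<partial>lborel)
      = (\<integral>\<^sup>+t. ?h p t \<partial>lborel)" by simp
  qed
  also have "\<dots> = (\<integral>\<^sup>+t. \<integral>\<^sup>+p. ?h p t \<partial>lborel \<partial>lborel)"
    by (rule lborel_pair.Fubini') measurable
  also have "\<dots> = (\<integral>\<^sup>+t. ennreal (\<alpha> * min 1 \<beta> * t\<^sup>2) * indicator {0..\<rho>} t \<partial>lborel)"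
  proof (rule nn_integral_cong)
    fix t :: real
    have "(\<integral>\<^sup>+p. ?h p t \<partial>lborel)
       = (\<integral>\<^sup>+p. (ennreal (\<alpha> * t) * indicator {..\<rho>} t) * indicator {0..min 1 \<beta> * t} p \<partial>lborel)"
      by (rule nn_integral_cong) (auto simp: indicator_def)
    also have "\<dots> = (ennreal (\<alpha> * t) * indicator {..\<rho>} t) * emeasure lborel {0..min 1 \<beta> * t}"
      by (rule nn_integral_cmult_indicator) simp
    also have "\<dots> = ennreal (\<alpha> * min 1 \<beta> * t\<^sup>2) * indicator {0..\<rho>} t"
    proof (cases "t \<ge> 0")
      case True
      then show ?thesis using assms
        by (simp add: indicator_def power2_eq_square ac_simps flip: ennreal_mult)
    next
      case False
      then have "\<alpha> * t \<le> 0" using assms by (simp add: mult_nonneg_nonpos)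
      then show ?thesis using False by (simp add: ennreal_neg)
    qed
    finally show "(\<integral>\<^sup>+p. ?h p t \<partial>lborel)
      = ennreal (\<alpha> * min 1 \<beta> * t\<^sup>2) * indicator {0..\<rho>} t" .
  qed
  also have "\<dots> = ennreal (\<alpha> * min 1 \<beta> * \<rho> ^ 3 / 3 - \<alpha> * min 1 \<beta> * 0 ^ 3 / 3)"
    by (rule nn_integral_FTC_Icc)
      (use assms in \<open>auto intro!: derivative_eq_intros simp: power2_eq_square\<close>)
  finally show ?thesis by simp
qed

text \<open>The form that two tube conditions take in adapted coordinates: the set of common directions is squeezed between
  two such cones, with \<open>\<alpha>\<close>, \<open>\<beta>\<close> and \<open>\<rho>\<close> changed by factors that tend to \<open>1\<close> in the limit.\<close>

definition split_cone :: "real \<Rightarrow> real \<Rightarrow> real \<Rightarrow> complex \<Rightarrow> complex \<Rightarrow> complex \<Rightarrow> bool" where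
  "split_cone \<alpha> \<beta> \<rho> w b a \<longleftrightarrow> (cmod a)\<^sup>2 \<le> \<alpha> * ((cmod b)\<^sup>2 + (cmod w)\<^sup>2) \<and>
     (cmod b)\<^sup>2 \<le> \<beta> * ((cmod b)\<^sup>2 + (cmod w)\<^sup>2) \<and> (cmod b)\<^sup>2 + (cmod w)\<^sup>2 \<le> \<rho>"

lemma cone_integral:
  assumes "\<alpha> \<ge> 0" "\<beta> > 0" "\<rho> \<ge> 0"
  shows "(\<integral>\<^sup>+w. \<integral>\<^sup>+b. \<integral>\<^sup>+a. (if split_cone \<alpha> \<beta> \<rho> w b a then 1 else 0) \<partial>lborel \<partial>lborel \<partial>lborel)
     = ennreal (pi ^ 3 * \<alpha> * min 1 \<beta> * \<rho> ^ 3 / 3)" (is "?I = _")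
proof -
  define g where "g p q = (if p \<le> \<beta> * (p + q) \<and> p + q \<le> \<rho> then ennreal (pi * \<alpha> * (p + q)) else 0)" for p q
  have g_m [measurable]: "(\<lambda>z. g (fst z) (snd z)) \<in> borel_measurable (borel \<Otimes>\<^sub>M borel)"
    unfolding g_def by measurable
  have [measurable]: "(\<lambda>p. g p q) \<in> borel_measurable borel" for q unfolding g_def by measurable
  have inner: "(\<integral>\<^sup>+a. (if split_cone \<alpha> \<beta> \<rho> w b a then 1 else 0) \<partial>lborel)
     = g ((cmod b)\<^sup>2) ((cmod w)\<^sup>2)" for b w :: complex
  proof (cases "(cmod b)\<^sup>2 \<le> \<beta> * ((cmod b)\<^sup>2 + (cmod w)\<^sup>2) \<and> (cmod b)\<^sup>2 + (cmod w)\<^sup>2 \<le> \<rho>")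
    case True
    let ?c = "\<alpha> * ((cmod b)\<^sup>2 + (cmod w)\<^sup>2)"
    have "(\<integral>\<^sup>+a. (if split_cone \<alpha> \<beta> \<rho> w b a then 1 else 0) \<partial>lborel) = (\<integral>\<^sup>+a. indicator {a. (cmod a)\<^sup>2 \<le> ?c} a \<partial>lborel)"
      using True by (intro nn_integral_cong) (simp add: indicator_def split_cone_def)
    also have "\<dots> = emeasure lborel {a. (cmod a)\<^sup>2 \<le> ?c}"
      by (rule nn_integral_indicator) (simp add: closed_Collect_le continuous_intros)
    also have "\<dots> = ennreal (pi * ?c)" using assms by (simp add: emeasure_cmod_square_le max_def)
    finally show ?thesis using True by (simp add: g_def mult.assoc)
  qed (auto simp: g_def split_cone_def)
  have "?I = (\<integral>\<^sup>+w. \<integral>\<^sup>+b. g ((cmod b)\<^sup>2) ((cmod w)\<^sup>2) \<partial>lborel \<partial>lborel)" by (simp only: inner)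
  also have "\<dots> = (\<integral>\<^sup>+w. (\<integral>\<^sup>+p. ennreal pi * indicator {0..} p * g p ((cmod w)\<^sup>2) \<partial>lborel) \<partial>lborel)"
    by (intro nn_integral_cong nn_integral_cmod_square) measurable
  also have "\<dots> = (\<integral>\<^sup>+q. ennreal pi * indicator {0..} q * (\<integral>\<^sup>+p. ennreal pi * indicator {0..} p * g p q \<partial>lborel) \<partial>lborel)"
  proof (rule nn_integral_cmod_square)
    have "(\<lambda>z. g (snd z) (fst z)) \<in> borel_measurable (borel \<Otimes>\<^sub>M lborel)"
      unfolding g_def by measurable
    then show "(\<lambda>q. \<integral>\<^sup>+p. ennreal pi * indicator {0..} p * g p q \<partial>lborel) \<in> borel_measurable borel"
      by (intro lborel.borel_measurable_nn_integral) (auto simp: split_beta')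
  qed
  also have "\<dots> = (\<integral>\<^sup>+q. \<integral>\<^sup>+p. indicator {0..} q * indicator {0..} p *
      (if p \<le> \<beta> * (p + q) \<and> p + q \<le> \<rho> then ennreal (pi ^ 3 * \<alpha> * (p + q)) else 0) \<partial>lborel \<partial>lborel)"
  proof (rule nn_integral_cong)
    fix q :: real
    have "ennreal pi * indicator {0..} q * (\<integral>\<^sup>+p. ennreal pi * indicator {0..} p * g p q \<partial>lborel)
       = (\<integral>\<^sup>+p. ennreal pi * indicator {0..} q * (ennreal pi * indicator {0..} p * g p q) \<partial>lborel)"
      by (rule nn_integral_cmult[symmetric]) measurable
    also have "\<dots> = (\<integral>\<^sup>+p. indicator {0..} q * indicator {0..} p *
      (if p \<le> \<beta> * (p + q) \<and> p + q \<le> \<rho> then ennreal (pi ^ 3 * \<alpha> * (p + q)) else 0) \<partial>lborel)"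
      by (intro nn_integral_cong)
        (use assms in \<open>auto simp: indicator_def g_def power3_eq_cube ac_simps simp flip: ennreal_mult\<close>)
    finally show "ennreal pi * indicator {0..} q * (\<integral>\<^sup>+p. ennreal pi * indicator {0..} p * g p q \<partial>lborel)
      = (\<integral>\<^sup>+p. indicator {0..} q * indicator {0..} p *
      (if p \<le> \<beta> * (p + q) \<and> p + q \<le> \<rho> then ennreal (pi ^ 3 * \<alpha> * (p + q)) else 0) \<partial>lborel)" .
  qed
  also have "\<dots> = ennreal (pi ^ 3 * \<alpha> * min 1 \<beta> * \<rho> ^ 3 / 3)"
    by (rule simplex_integral) (use assms in auto)
  finally show ?thesis .
qed

section \<open>Pairs of tubes in complex dimension three\<close>

text \<open>The directions \<open>\<xi>\<close> in the unit ball whose tubes of widths \<open>s\<close> and \<open>r\<close> contain \<open>x\<close> and \<open>y\<close>.\<close>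

definition tube_directions :: "real \<Rightarrow> real \<Rightarrow> complex^'n \<Rightarrow> complex^'n \<Rightarrow> (complex^'n) set" where
  "tube_directions s r x y = {\<xi> \<in> cball 0 1. cmod (herm x \<xi>) \<le> s * norm \<xi> \<and> cmod (herm y \<xi>) \<le> r * norm \<xi>}"

text \<open>The squared distance of \<open>y\<close> from the complex line through \<open>x\<close>.\<close>

definition dist_line_square :: "complex^'n \<Rightarrow> complex^'n \<Rightarrow> real" where
  "dist_line_square x y = (norm y)\<^sup>2 - (cmod (herm y x) / norm x)\<^sup>2"

lemma dist_line_square_nonneg: "dist_line_square x y \<ge> 0"
proof (cases "x = 0")
  case False
  then have "cmod (herm y x) / norm x \<le> norm y"
    using herm_Cauchy_Schwarz[of y x] by (simp add: divide_le_eq)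
  then show ?thesis by (simp add: dist_line_square_def power_mono)
qed (simp add: dist_line_square_def)

text \<open>Unitary coordinates \<open>a\<close>, \<open>b\<close>, \<open>w\<close> of which the first runs along \<open>x\<close> and the second along the component of \<open>y\<close>
  orthogonal to \<open>x\<close>, or along any direction orthogonal to \<open>x\<close> if that component vanishes.\<close>

lemma dim3_frame:
  fixes x y :: "complex^'n"
  assumes n: "CARD('n) = 3" and x: "x \<noteq> 0"
  obtains F :: "(complex \<times> complex) \<times> complex \<Rightarrow> complex^'n" and c :: complex where
    "linear_isometry F" "cmod c = cmod (herm y x) / norm x"
    "\<And>w b a. cmod (herm x (F ((w, b), a))) = norm x * cmod a"
    "\<And>w b a. cmod (herm y (F ((w, b), a))) = cmod (c * a + of_real (sqrt (dist_line_square x y)) * b)"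
proof -
  define e1 where "e1 = sgn x"
  have e1: "norm e1 = 1" using x by (simp add: e1_def norm_sgn)
  have xe: "x = of_real (norm x) *s e1" using x by (simp add: e1_def sgn_div_norm flip: scaleR_eq_smult)
  define k where "k = herm y e1"
  define w where "w = y - k *s e1"
  have we: "herm w e1 = 0" by (simp add: w_def herm_diff_left herm_smult_left herm_self e1 k_def)
  have ck: "cmod k = cmod (herm y x) / norm x"
    using x by (subst xe) (simp add: herm_smult_right norm_mult k_def)
  have ew: "herm e1 w = 0" using we herm_commute[of e1 w] by simp
  have "(norm w)\<^sup>2 = dist_line_square x y"
  proof -
    have "herm w w = herm y w" using ew by (subst w_def) (simp add: herm_diff_left herm_smult_left)
    also have "\<dots> = herm y y - cnj k * k" by (subst w_def) (simp add: herm_diff_right herm_smult_right k_def)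
    finally have "complex_of_real ((norm w)\<^sup>2) = of_real ((norm y)\<^sup>2 - (cmod k)\<^sup>2)"
      by (simp only: herm_self complex_norm_square mult.commute of_real_diff)
    then have "(norm w)\<^sup>2 = (norm y)\<^sup>2 - (cmod k)\<^sup>2" by (simp only: of_real_eq_iff)
    then show ?thesis by (simp add: dist_line_square_def ck)
  qed
  then have nw: "norm w = sqrt (dist_line_square x y)" by (metis norm_ge_zero real_sqrt_unique)
  have D: "DIM(complex \<times> complex) + 2 = DIM(complex^'n)" using n by simp
  obtain E0 :: "complex \<times> complex \<Rightarrow> complex^'n" where E0: "linear_isometry E0" "range E0 = complex_hyperplane e1"
    "linear_isometry (\<lambda>(u, w). u *s e1 + E0 w)" "\<And>u w. herm (u *s e1 + E0 w) e1 = u"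
    by (rule line_coordinates[OF e1 D]) simp_all
  define e2 where "e2 = (if w = 0 then E0 (1, 0) else sgn w)"
  have e2: "norm e2 = 1" by (auto simp: e2_def norm_sgn linear_isometry_norm[OF E0(1)] norm_Pair)
  have e21: "herm e2 e1 = 0"
  proof (cases "w = 0")
    case True
    have "E0 (1, 0) \<in> complex_hyperplane e1" using E0(2) by blast
    then show ?thesis using True by (simp add: e2_def complex_hyperplane_herm)
  qed (simp add: e2_def sgn_div_norm herm_scaleR_left we)
  have e12: "herm e1 e2 = 0" using e21 herm_commute[of e1 e2] by simp
  have ye: "y = k *s e1 + of_real (sqrt (dist_line_square x y)) *s e2"
  proof -
    have "w = of_real (norm w) *s e2" by (cases "w = 0") (simp_all add: e2_def sgn_div_norm flip: scaleR_eq_smult)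
    then show ?thesis unfolding nw[symmetric] by (simp add: w_def)
  qed
  define G where "G = (\<lambda>(a, b). a *s e1 + b *s e2)"
  have G: "linear_isometry G"
    unfolding linear_isometry_def
  proof (intro conjI allI linearI)
    fix p :: "complex \<times> complex"
    obtain a b where p: "p = (a, b)" by force
    have "orthogonal (a *s e1) (b *s e2)"
      by (simp add: orthogonal_def herm_smult_left herm_smult_right e12 flip: Re_herm)
    then have "(norm (a *s e1 + b *s e2))\<^sup>2 = (cmod a)\<^sup>2 + (cmod b)\<^sup>2"
      by (simp add: norm_add_Pythagorean norm_smult e1 e2)
    then show "norm (G p) = norm p" by (simp add: G_def p norm_Pair real_sqrt_unique)
  qed (auto simp: G_def vec_eq_iff algebra_simps)
  obtain E :: "complex \<Rightarrow> complex^'n" where E: "linear_isometry E" "range E = {y. \<forall>p. orthogonal (G p) y}"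
    "linear_isometry (\<lambda>(p, w). G p + E w)"
    by (rule complete_linear_isometry[where 'c=complex, OF G]) (use n in simp_all)
  define F where "F = (\<lambda>((w, b), a). a *s e1 + b *s e2 + E w)"
  have F: "linear_isometry F"
    unfolding linear_isometry_def
  proof (intro conjI allI linearI)
    fix z z' :: "(complex \<times> complex) \<times> complex" and r
    have linE: "linear E" using E(1) by (rule linear_isometry_linear)
    show "F (z + z') = F z + F z'"
      by (cases z; cases z') (auto simp: F_def linear_add[OF linE] vec_eq_iff algebra_simps)
    show "F (r *\<^sub>R z) = r *\<^sub>R F z"
      by (cases z) (auto simp: F_def linear_scale[OF linE] vec_eq_iff algebra_simps)
    obtain w b a where z: "z = ((w, b), a)" by (metis surj_pair)
    have "norm (F z) = norm ((a, b), w)"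
      using linear_isometry_norm[OF E(3), of "((a, b), w)"] by (simp add: F_def G_def z)
    then show "norm (F z) = norm z" by (simp add: z norm_Pair ac_simps)
  qed
  have hE: "herm (E w) e1 = 0" "herm (E w) e2 = 0" for w
  proof -
    have o: "orthogonal (G p) (E w)" for p using E(2) by blast
    have "\<forall>c. orthogonal (c *s e1) (E w)" using o[of "(_, 0)"] by (simp add: G_def)
    then show "herm (E w) e1 = 0" by (simp only: orthogonal_complex_line)
    have "\<forall>c. orthogonal (c *s e2) (E w)" using o[of "(0, _)"] by (simp add: G_def)
    then show "herm (E w) e2 = 0" by (simp only: orthogonal_complex_line)
  qed
  have h: "herm (F ((w, b), a)) e1 = a" "herm (F ((w, b), a)) e2 = b" for w b a
    by (simp_all add: F_def herm_add_left herm_smult_left hE e12 e21 herm_self e1 e2)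
  have flip: "cmod (herm u v) = cmod (herm v u)" for u v :: "complex^'n" using herm_commute[of v u] by simp
  show ?thesis
  proof (rule that[OF F, of "cnj k"])
    show "cmod (cnj k) = cmod (herm y x) / norm x" by (simp add: ck)
    show "cmod (herm x (F ((w, b), a))) = norm x * cmod a" for w b a
      unfolding flip[of x] by (subst xe) (simp add: herm_smult_right h norm_mult)
    show "cmod (herm y (F ((w, b), a))) = cmod (cnj k * a + of_real (sqrt (dist_line_square x y)) * b)" for w b a
      unfolding flip[of y] by (subst ye) (simp add: herm_add_right herm_smult_right h)
  qed
qed

lemma tube_directions_measurable: "tube_directions s r x y \<in> sets borel"
proof -
  have "closed (tube_directions s r x y)"
    unfolding tube_directions_def Collect_conj_eq Collect_mem_eq
    by (intro closed_Int closed_Collect_le continuous_intros closed_cball)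
  then show ?thesis by simp
qed

lemma emeasure_triple_coordinates:
  fixes F :: "(complex \<times> complex) \<times> complex \<Rightarrow> complex^'n"
  assumes F: "linear_isometry F" and n: "CARD('n) = 3" and A: "A \<in> sets borel"
  shows "emeasure lborel A = (\<integral>\<^sup>+w. \<integral>\<^sup>+b. \<integral>\<^sup>+a. indicator A (F ((w, b), a)) \<partial>lborel \<partial>lborel \<partial>lborel)"
proof -
  note [measurable] = A linear_isometry_measurable[OF F]
  have "emeasure lborel A = (\<integral>\<^sup>+\<xi>. indicator A \<xi> \<partial>lborel)" using A by simp
  also have "\<dots> = (\<integral>\<^sup>+p. \<integral>\<^sup>+a. indicator A (F (p, a)) \<partial>lborel \<partial>lborel)"
    by (rule nn_integral_fibers[OF F]) (use n A in simp_all)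
  also have "\<dots> = (\<integral>\<^sup>+w. \<integral>\<^sup>+b. \<integral>\<^sup>+a. indicator A (F ((w, b), a)) \<partial>lborel \<partial>lborel \<partial>lborel)"
  proof -
    have "(\<lambda>p. \<integral>\<^sup>+a. indicator A (F (p, a)) \<partial>lborel) \<in> borel_measurable borel"
      by measurable
    then have "(\<lambda>p. \<integral>\<^sup>+a. indicator A (F (p, a)) \<partial>lborel) \<in> borel_measurable (lborel \<Otimes>\<^sub>M lborel)"
      by (simp add: lborel_prod)
    from lborel.nn_integral_fst[OF this] show ?thesis by (simp add: lborel_prod)
  qed
  finally show ?thesis .
qed

text \<open>In adapted coordinates the first condition confines \<open>a\<close> to a narrow cone around the
  hyperplane \<open>a = 0\<close>; in the second it moves the width \<open>r\<close> by at most \<open>cmod c * s / norm x\<close>.\<close>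

lemma tube_directions_upper:
  fixes x y :: "complex^'n"
  assumes n: "CARD('n) = 3" and x: "x \<noteq> 0" and s: "0 < s" and r: "0 < r"
    and \<alpha>: "\<alpha> = (s / norm x)\<^sup>2" "\<alpha> < 1" and \<rho>: "\<rho> = r + cmod (herm y x) / norm x * (s / norm x)"
  shows "emeasure lborel (tube_directions s r x y) \<le>
    ennreal (pi ^ 3 / 3 * \<alpha> / (1 - \<alpha>)\<^sup>2 * (\<rho>\<^sup>2 / max (dist_line_square x y) (\<rho>\<^sup>2)))"
proof -
  obtain F :: "(complex \<times> complex) \<times> complex \<Rightarrow> complex^'n" and c :: complex where F: "linear_isometry F"
    and c: "cmod c = cmod (herm y x) / norm x"
    and hx: "\<And>w b a. cmod (herm x (F ((w, b), a))) = norm x * cmod a"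
    and hy: "\<And>w b a. cmod (herm y (F ((w, b), a))) = cmod (c * a + of_real (sqrt (dist_line_square x y)) * b)"
    by (rule dim3_frame[OF n x, of y]) blast
  define q where "q = dist_line_square x y"
  define m where "m = max q (\<rho>\<^sup>2)"
  define \<beta> where "\<beta> = \<rho>\<^sup>2 / m"
  have q: "q \<ge> 0" by (simp add: q_def dist_line_square_nonneg)
  have \<rho>0: "\<rho> > 0" using r s by (simp add: \<rho> add_pos_nonneg)
  have \<alpha>0: "\<alpha> > 0" using s x by (simp add: \<alpha>(1))
  have m: "m > 0" using \<rho>0 by (simp add: m_def less_max_iff_disj)
  have \<beta>: "\<beta> > 0" using \<rho>0 m by (simp add: \<beta>_def)
  have cone: "indicator (tube_directions s r x y) (F ((w, b), a)) \<le>
      (if split_cone (\<alpha> / (1 - \<alpha>)) (\<beta> / (1 - \<alpha>)) 1 w b a then 1 else (0::ennreal))"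
    for w b a
  proof (cases "F ((w, b), a) \<in> tube_directions s r x y")
    case True
    define N where "N = norm (F ((w, b), a))"
    define Q where "Q = (cmod b)\<^sup>2 + (cmod w)\<^sup>2"
    have N0: "N \<ge> 0" by (simp add: N_def)
    have NQ: "N\<^sup>2 = (cmod a)\<^sup>2 + Q" by (simp add: N_def Q_def linear_isometry_norm[OF F] norm_Pair)
    have N1: "N \<le> 1" and ax: "norm x * cmod a \<le> s * N" and bx: "cmod (c * a + sqrt q * b) \<le> r * N"
      using True unfolding tube_directions_def mem_Collect_eq hx hy q_def N_def by auto
    have a: "cmod a \<le> s / norm x * N" using ax x by (simp add: field_simps)
    then have "(cmod a)\<^sup>2 \<le> (s / norm x * N)\<^sup>2" by (intro power_mono) auto
    then have a2: "(cmod a)\<^sup>2 \<le> \<alpha> * N\<^sup>2" by (simp add: \<alpha>(1) power_mult_distrib power_divide)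
    then have "(1 - \<alpha>) * N\<^sup>2 \<le> Q" using NQ by (simp add: algebra_simps)
    then have NQ': "N\<^sup>2 \<le> Q / (1 - \<alpha>)" using \<alpha>(2) by (simp add: pos_le_divide_eq mult.commute)
    have "sqrt q * cmod b \<le> cmod (c * a + sqrt q * b) + cmod (c * a)"
      using norm_triangle_ineq4[of "c * a + sqrt q * b" "c * a"] q by (simp add: norm_mult)
    also have "\<dots> \<le> r * N + cmod c * (s / norm x * N)"
      unfolding norm_mult[of c] by (intro add_mono mult_left_mono bx a) simp
    also have "\<dots> = \<rho> * N" by (simp add: \<rho> c algebra_simps)
    finally have "(sqrt q * cmod b)\<^sup>2 \<le> (\<rho> * N)\<^sup>2" using q by (intro power_mono) auto
    then have b1: "q * (cmod b)\<^sup>2 \<le> \<rho>\<^sup>2 * N\<^sup>2" using q by (simp add: power_mult_distrib)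
    have "(cmod b)\<^sup>2 \<le> N\<^sup>2" by (simp add: NQ Q_def)
    then have b2: "\<rho>\<^sup>2 * (cmod b)\<^sup>2 \<le> \<rho>\<^sup>2 * N\<^sup>2" by (intro mult_left_mono) auto
    have "m * (cmod b)\<^sup>2 \<le> \<rho>\<^sup>2 * N\<^sup>2" using b1 b2 unfolding m_def by (cases "q \<le> \<rho>\<^sup>2") (simp_all add: max_def)
    then have "(cmod b)\<^sup>2 \<le> \<beta> * N\<^sup>2" using m by (simp add: \<beta>_def pos_le_divide_eq mult.commute)
    also have "\<dots> \<le> \<beta> * (Q / (1 - \<alpha>))" using NQ' \<beta> by (intro mult_left_mono) auto
    finally have b: "(cmod b)\<^sup>2 \<le> \<beta> / (1 - \<alpha>) * Q" by simp
    have "\<alpha> * N\<^sup>2 \<le> \<alpha> * (Q / (1 - \<alpha>))" using NQ' \<alpha>0 by (intro mult_left_mono) auto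
    then have a': "(cmod a)\<^sup>2 \<le> \<alpha> / (1 - \<alpha>) * Q" using a2 by simp
    have "N\<^sup>2 \<le> 1" using N0 N1 by (simp add: power_le_one)
    then have "Q \<le> 1" using NQ zero_le_power2[of "cmod a"] by linarith
    then show ?thesis using a' b unfolding split_cone_def Q_def[symmetric] by (simp add: indicator_def)
  qed simp
  have "emeasure lborel (tube_directions s r x y)
      = (\<integral>\<^sup>+w. \<integral>\<^sup>+b. \<integral>\<^sup>+a. indicator (tube_directions s r x y) (F ((w, b), a)) \<partial>lborel \<partial>lborel \<partial>lborel)"
    by (rule emeasure_triple_coordinates[OF F n tube_directions_measurable])
  also have "\<dots> \<le> (\<integral>\<^sup>+w. \<integral>\<^sup>+b. \<integral>\<^sup>+a. (if split_cone (\<alpha> / (1 - \<alpha>)) (\<beta> / (1 - \<alpha>)) 1 w b a then 1 else 0)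
       \<partial>lborel \<partial>lborel \<partial>lborel)"
    by (intro nn_integral_mono cone)
  also have "\<dots> = ennreal (pi ^ 3 * (\<alpha> / (1 - \<alpha>)) * min 1 (\<beta> / (1 - \<alpha>)) * 1 ^ 3 / 3)"
    by (rule cone_integral) (use \<alpha>0 \<alpha>(2) \<beta> in auto)
  also have "\<dots> \<le> ennreal (pi ^ 3 / 3 * \<alpha> / (1 - \<alpha>)\<^sup>2 * \<beta>)"
  proof (rule ennreal_leI)
    define d where "d = 1 - \<alpha>"
    have "pi ^ 3 * (\<alpha> / (1 - \<alpha>)) * min 1 (\<beta> / (1 - \<alpha>)) \<le> pi ^ 3 * (\<alpha> / (1 - \<alpha>)) * (\<beta> / (1 - \<alpha>))"
      using \<alpha>0 \<alpha>(2) by (intro mult_left_mono) auto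
    then have "pi ^ 3 * (\<alpha> / (1 - \<alpha>)) * min 1 (\<beta> / (1 - \<alpha>)) / 3 \<le> pi ^ 3 * (\<alpha> / d) * (\<beta> / d) / 3"
      unfolding d_def by (rule divide_right_mono) simp
    also have "\<dots> = pi ^ 3 / 3 * \<alpha> / d\<^sup>2 * \<beta>" by (simp add: power2_eq_square)
    finally show "pi ^ 3 * (\<alpha> / (1 - \<alpha>)) * min 1 (\<beta> / (1 - \<alpha>)) * 1 ^ 3 / 3 \<le> pi ^ 3 / 3 * \<alpha> / (1 - \<alpha>)\<^sup>2 * \<beta>"
      by (simp only: d_def power_one mult_1_right)
  qed
  finally show ?thesis by (simp add: \<beta>_def m_def q_def)
qed

lemma tube_directions_lower:
  fixes x y :: "complex^'n"
  assumes n: "CARD('n) = 3" and x: "x \<noteq> 0" and s: "0 < s"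
    and \<alpha>: "\<alpha> = (s / norm x)\<^sup>2" "\<alpha> < 1" and \<rho>: "\<rho> = r - cmod (herm y x) / norm x * (s / norm x)" "\<rho> > 0"
  shows "ennreal (pi ^ 3 / 3 * \<alpha> * (1 - \<alpha>) ^ 3 * (\<rho>\<^sup>2 / max (dist_line_square x y) (\<rho>\<^sup>2)))
    \<le> emeasure lborel (tube_directions s r x y)"
proof -
  obtain F :: "(complex \<times> complex) \<times> complex \<Rightarrow> complex^'n" and c :: complex where F: "linear_isometry F"
    and c: "cmod c = cmod (herm y x) / norm x"
    and hx: "\<And>w b a. cmod (herm x (F ((w, b), a))) = norm x * cmod a"
    and hy: "\<And>w b a. cmod (herm y (F ((w, b), a))) = cmod (c * a + of_real (sqrt (dist_line_square x y)) * b)"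
    by (rule dim3_frame[OF n x, of y]) blast
  define q where "q = dist_line_square x y"
  define m where "m = max q (\<rho>\<^sup>2)"
  define \<beta> where "\<beta> = \<rho>\<^sup>2 / m"
  have q: "q \<ge> 0" by (simp add: q_def dist_line_square_nonneg)
  have \<alpha>0: "\<alpha> > 0" using s x by (simp add: \<alpha>(1))
  have m: "m > 0" "q \<le> m" "\<rho>\<^sup>2 \<le> m" using \<rho>(2) by (auto simp: m_def less_max_iff_disj)
  have \<beta>: "\<beta> > 0" "\<beta> \<le> 1" using \<rho>(2) m by (simp_all add: \<beta>_def)
  have "q * \<rho>\<^sup>2 \<le> m * \<rho>\<^sup>2" using m by (intro mult_right_mono) auto
  then have "q * \<rho>\<^sup>2 / m \<le> \<rho>\<^sup>2" using m(1) by (subst pos_divide_le_eq) (simp_all only: mult.commute)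
  then have q\<beta>: "q * \<beta> \<le> \<rho>\<^sup>2" by (simp add: \<beta>_def)
  have cone: "(if split_cone \<alpha> \<beta> (1 - \<alpha>) w b a then 1 else (0::ennreal))
      \<le> indicator (tube_directions s r x y) (F ((w, b), a))" (is "(if ?c then _ else _) \<le> _")
    for w b a
  proof (cases ?c)
    case True
    define N where "N = norm (F ((w, b), a))"
    define Q where "Q = (cmod b)\<^sup>2 + (cmod w)\<^sup>2"
    note cond = True[unfolded split_cone_def]
    have a: "(cmod a)\<^sup>2 \<le> \<alpha> * Q" unfolding Q_def by (rule conjunct1[OF cond])
    have b: "(cmod b)\<^sup>2 \<le> \<beta> * Q" unfolding Q_def by (rule conjunct1[OF conjunct2[OF cond]])
    have Q1: "Q \<le> 1 - \<alpha>" unfolding Q_def by (rule conjunct2[OF conjunct2[OF cond]])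
    have N0: "N \<ge> 0" by (simp add: N_def)
    have NQ: "N\<^sup>2 = (cmod a)\<^sup>2 + Q" by (simp add: N_def Q_def linear_isometry_norm[OF F] norm_Pair)
    have QN: "Q \<le> N\<^sup>2" using NQ by simp
    have "N\<^sup>2 \<le> \<alpha> * Q + Q" using NQ a by linarith
    also have "\<alpha> * Q + Q = (1 + \<alpha>) * Q" by (simp add: algebra_simps)
    also have "(1 + \<alpha>) * Q \<le> (1 + \<alpha>) * (1 - \<alpha>)" using Q1 \<alpha>0 by (intro mult_left_mono) auto
    also have "(1 + \<alpha>) * (1 - \<alpha>) \<le> 1" by (simp add: algebra_simps)
    finally have "N\<^sup>2 \<le> 1\<^sup>2" by simp
    then have N1: "N \<le> 1" by (rule power2_le_imp_le) simp
    have "(cmod a)\<^sup>2 \<le> \<alpha> * N\<^sup>2" using a mult_left_mono[OF QN, of \<alpha>] \<alpha>0 by linarith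
    then have "(cmod a)\<^sup>2 \<le> (s / norm x * N)\<^sup>2" by (simp add: \<alpha>(1) power_mult_distrib power_divide)
    then have a': "cmod a \<le> s / norm x * N" 
      by (rule power2_le_imp_le) (use s N0 in simp)
    have "(sqrt q * cmod b)\<^sup>2 = q * (cmod b)\<^sup>2" using q by (simp add: power_mult_distrib)
    also have "\<dots> \<le> q * (\<beta> * Q)" using b q by (intro mult_left_mono) auto
    also have "\<dots> = (q * \<beta>) * Q" by simp
    also have "\<dots> \<le> \<rho>\<^sup>2 * N\<^sup>2" by (rule mult_mono[OF q\<beta> QN]) (simp_all add: Q_def)
    also have "\<dots> = (\<rho> * N)\<^sup>2" by (simp add: power_mult_distrib)
    finally have b': "sqrt q * cmod b \<le> \<rho> * N" 
      by (rule power2_le_imp_le[OF _ mult_nonneg_nonneg[OF less_imp_le[OF \<rho>(2)] N0]])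
    have "cmod (c * a + sqrt q * b) \<le> cmod c * cmod a + sqrt q * cmod b"
      using norm_triangle_ineq[of "c * a" "sqrt q * b"] q by (simp add: norm_mult)
    also have "\<dots> \<le> cmod c * (s / norm x * N) + \<rho> * N"
      by (intro add_mono mult_left_mono a' b') simp
    also have "\<dots> = r * N" by (simp add: \<rho>(1) c algebra_simps)
    finally have "cmod (c * a + sqrt q * b) \<le> r * N" .
    moreover have "norm x * cmod a \<le> s * N" using mult_left_mono[OF a', of "norm x"] x by simp
    ultimately have "F ((w, b), a) \<in> tube_directions s r x y"
      using N1 by (simp add: tube_directions_def hx hy N_def q_def)
    then have "indicator (tube_directions s r x y) (F ((w, b), a)) = (1::ennreal)" by (rule indicator_simps)
    then show ?thesis by simp
  next
    case False
    then show ?thesis by (simp only: if_False zero_le)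
  qed
  have "ennreal (pi ^ 3 / 3 * \<alpha> * (1 - \<alpha>) ^ 3 * \<beta>) = ennreal (pi ^ 3 * \<alpha> * min 1 \<beta> * (1 - \<alpha>) ^ 3 / 3)"
    using \<beta>(2) by (simp add: min_absorb2 mult.assoc mult.commute[of "(1 - \<alpha>) ^ 3"])
  also have "\<dots> = (\<integral>\<^sup>+w. \<integral>\<^sup>+b. \<integral>\<^sup>+a. (if split_cone \<alpha> \<beta> (1 - \<alpha>) w b a then 1 else 0)
       \<partial>lborel \<partial>lborel \<partial>lborel)"
    by (rule cone_integral[symmetric]) (use \<alpha>0 \<alpha>(2) \<beta> in auto)
  also have "\<dots> \<le> (\<integral>\<^sup>+w. \<integral>\<^sup>+b. \<integral>\<^sup>+a. indicator (tube_directions s r x y) (F ((w, b), a)) \<partial>lborel \<partial>lborel \<partial>lborel)"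
    by (intro nn_integral_mono cone)
  also have "\<dots> = emeasure lborel (tube_directions s r x y)"
    by (rule emeasure_triple_coordinates[OF F n tube_directions_measurable, symmetric])
  finally show ?thesis by (simp add: \<beta>_def m_def q_def)
qed

section \<open>Pairing tubes of two bodies\<close>

lemma borel_measurable_projections [measurable]:
  "fst \<in> borel_measurable (borel :: ('a::euclidean_space \<times> 'b::euclidean_space) measure)"
  "snd \<in> borel_measurable (borel :: ('a::euclidean_space \<times> 'b::euclidean_space) measure)"
  by (intro borel_measurable_continuous_onI continuous_intros)+

text \<open>A tube depends only on the direction of \<open>\<xi>\<close>, so the unit ball can stand in for the unit sphere.\<close>

definition tube_pairing :: "(complex^'n) set \<Rightarrow> (complex^'n) set \<Rightarrow> real \<Rightarrow> real \<Rightarrow> ennreal" where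
  "tube_pairing K M s r =
    (\<integral>\<^sup>+\<xi>. indicator (cball 0 1) \<xi> * (emeasure lborel (tube M s \<xi>) * emeasure lborel (tube K r \<xi>)) \<partial>lborel)"

definition incidence :: "(complex^'n) set \<Rightarrow> (complex^'n) set \<Rightarrow> real \<Rightarrow> real \<Rightarrow> ((complex^'n) \<times> (complex^'n) \<times> (complex^'n)) set" where
  "incidence K M s r = {(\<xi>, x, y). \<xi> \<in> cball 0 1 \<and> x \<in> tube M s \<xi> \<and> y \<in> tube K r \<xi>}"

lemma incidence_measurable:
  assumes "compact K" "compact M" shows "incidence K M s r \<in> sets borel"
proof -
  have eq: "incidence K M s r = (cball 0 1 \<times> M \<times> K) \<inter> {z. cmod (herm (fst (snd z)) (fst z)) \<le> s * norm (fst z)}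
     \<inter> {z. cmod (herm (snd (snd z)) (fst z)) \<le> r * norm (fst z)}"
    by (auto simp: incidence_def tube_def)
  have "closed (incidence K M s r)"
    unfolding eq using assms
    by (intro closed_Int closed_Times closed_Collect_le continuous_intros closed_cball compact_imp_closed)
  then show ?thesis by simp
qed

lemma incidence_section:
  "{\<xi>. (\<xi>, x, y) \<in> incidence K M s r} = (if x \<in> M \<and> y \<in> K then tube_directions s r x y else {})"
  by (auto simp: incidence_def tube_directions_def tube_def)

lemma nn_integral_incidence:
  "(\<integral>\<^sup>+\<xi>. indicator (incidence K M s r) (\<xi>, z) \<partial>lborel) =
     indicator M (fst z) * indicator K (snd z) * emeasure lborel (tube_directions s r (fst z) (snd z))"
proof -
  have "(\<integral>\<^sup>+\<xi>. indicator (incidence K M s r) (\<xi>, z) \<partial>lborel)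
     = (\<integral>\<^sup>+\<xi>. indicator {\<xi>. (\<xi>, fst z, snd z) \<in> incidence K M s r} \<xi> \<partial>lborel)"
    by (intro nn_integral_cong) (simp add: indicator_def)
  also have "\<dots> = (\<integral>\<^sup>+\<xi>. indicator M (fst z) * indicator K (snd z) * indicator (tube_directions s r (fst z) (snd z)) \<xi> \<partial>lborel)"
    unfolding incidence_section by (intro nn_integral_cong) (simp add: indicator_def)
  also have "\<dots> = indicator M (fst z) * indicator K (snd z) * emeasure lborel (tube_directions s r (fst z) (snd z))"
    by (rule nn_integral_cmult_indicator) (simp add: tube_directions_measurable)
  finally show ?thesis .
qed

lemma tube_pairing_eq:
  fixes K M :: "(complex^'n) set"
  assumes K: "compact K" and M: "compact M"
  shows "tube_pairing K M s r =
    (\<integral>\<^sup>+z. indicator M (fst z) * indicator K (snd z) * emeasure lborel (tube_directions s r (fst z) (snd z)) \<partial>lborel)"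
proof -
  have [measurable]: "M \<in> sets borel" "K \<in> sets borel" using K M by (simp_all add: compact_imp_closed)
  note [measurable] = incidence_measurable[OF K M, of s r]
  have "tube_pairing K M s r = (\<integral>\<^sup>+\<xi>. \<integral>\<^sup>+z. indicator (incidence K M s r) (\<xi>, z) \<partial>lborel \<partial>lborel)"
    unfolding tube_pairing_def
  proof (rule nn_integral_cong)
    fix \<xi> :: "complex^'n"
    have "(\<integral>\<^sup>+z. indicator (incidence K M s r) (\<xi>, z) \<partial>lborel)
       = (\<integral>\<^sup>+z. indicator (cball 0 1) \<xi> * indicator (tube M s \<xi> \<times> tube K r \<xi>) z \<partial>lborel)"
      by (intro nn_integral_cong) (auto simp: incidence_def indicator_def)
    also have "\<dots> = indicator (cball 0 1) \<xi> * emeasure lborel (tube M s \<xi> \<times> tube K r \<xi>)"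
      by (rule nn_integral_cmult_indicator) (simp add: borel_Times tube_measurable)
    also have "emeasure lborel (tube M s \<xi> \<times> tube K r \<xi>) = emeasure lborel (tube M s \<xi>) * emeasure lborel (tube K r \<xi>)"
      unfolding lborel_prod[symmetric] by (rule lborel.emeasure_pair_measure_Times) (simp_all add: tube_measurable)
    finally show "indicator (cball 0 1) \<xi> * (emeasure lborel (tube M s \<xi>) * emeasure lborel (tube K r \<xi>))
      = (\<integral>\<^sup>+z. indicator (incidence K M s r) (\<xi>, z) \<partial>lborel)" by simp
  qed
  also have "\<dots> = (\<integral>\<^sup>+z. \<integral>\<^sup>+\<xi>. indicator (incidence K M s r) (\<xi>, z) \<partial>lborel \<partial>lborel)"
    by (rule lborel_pair.Fubini') measurable
  also have "\<dots> = (\<integral>\<^sup>+z. indicator M (fst z) * indicator K (snd z) * emeasure lborel (tube_directions s r (fst z) (snd z)) \<partial>lborel)"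
    by (simp only: nn_integral_incidence)
  finally show ?thesis .
qed

text \<open>The limit of \<open>tube_directions\<close> volumes found below, without its constant factor and \<open>r\<^sup>2\<close>.\<close>

definition pairing_kernel :: "real \<Rightarrow> complex^'n \<Rightarrow> complex^'n \<Rightarrow> real" where
  "pairing_kernel r x y = 1 / (norm x)\<^sup>2 * (1 / max (dist_line_square x y) (r\<^sup>2))"

lemma dist_line_square_measurable [measurable (raw)]:
  assumes [measurable]: "f \<in> borel_measurable M" "g \<in> borel_measurable M"
  shows "(\<lambda>x. dist_line_square (f x) (g x)) \<in> borel_measurable M"
  unfolding dist_line_square_def by measurable

text \<open>As \<open>s\<close> tends to \<open>0\<close>, almost all of the weight lies on \<open>\<xi>\<close> orthogonal to \<open>x\<close>, a complex plane, in which the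
  second condition cuts out the fraction \<open>min 1 (r\<^sup>2 / q)\<close>, where \<open>q = dist_line_square x y\<close>.\<close>

lemma tube_directions_limit:
  fixes x y :: "complex^'n"
  assumes n: "CARD('n) = 3" and x: "x \<noteq> 0" and r: "0 < r" and s: "s \<longlonglongrightarrow> 0" "\<And>i. 0 < s i"
  shows "(\<lambda>i. ennreal (1 / (s i)\<^sup>2) * emeasure lborel (tube_directions (s i) r x y))
     \<longlonglongrightarrow> ennreal (pi ^ 3 / 3 * r\<^sup>2 * pairing_kernel r x y)"
proof -
  define q where "q = dist_line_square x y"
  define k where "k = cmod (herm y x) / norm x"
  define \<alpha> where "\<alpha> i = (s i / norm x)\<^sup>2" for i
  define u where "u i = r + k * (s i / norm x)" for i
  define l where "l i = r - k * (s i / norm x)" for i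
  have "\<alpha> \<longlonglongrightarrow> (0 / norm x)\<^sup>2" unfolding \<alpha>_def by (intro tendsto_intros s) (use x in auto)
  then have \<alpha>: "\<alpha> \<longlonglongrightarrow> 0" by simp
  have "u \<longlonglongrightarrow> r + k * (0 / norm x)" unfolding u_def by (intro tendsto_intros s) (use x in auto)
  then have u: "u \<longlonglongrightarrow> r" by simp
  have "l \<longlonglongrightarrow> r - k * (0 / norm x)" unfolding l_def by (intro tendsto_intros s) (use x in auto)
  then have l: "l \<longlonglongrightarrow> r" by simp
  have m: "max q (r\<^sup>2) \<noteq> 0" using r by (auto simp: max_def)
  have target: "ennreal (pi ^ 3 / 3 * r\<^sup>2 * pairing_kernel r x y) = ennreal (pi ^ 3 / 3 * (1 / (norm x)\<^sup>2) * (r\<^sup>2 / max q (r\<^sup>2)))"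
    by (simp add: pairing_kernel_def q_def mult.assoc)
  have scale: "1 / (s i)\<^sup>2 * (pi ^ 3 / 3 * \<alpha> i * c) = pi ^ 3 / 3 * (1 / (norm x)\<^sup>2) * c" for i c
    using s(2)[of i] x by (simp add: \<alpha>_def power_divide)
  have ev: "\<forall>\<^sub>F i in sequentially. \<alpha> i < 1" "\<forall>\<^sub>F i in sequentially. l i > 0"
    using order_tendstoD(2)[OF \<alpha>, of 1] order_tendstoD(1)[OF l, of 0] r by auto
  show ?thesis
    unfolding target
  proof (rule tendsto_sandwich)
    show "\<forall>\<^sub>F i in sequentially. ennreal (pi ^ 3 / 3 * (1 / (norm x)\<^sup>2) * ((1 - \<alpha> i) ^ 3 * ((l i)\<^sup>2 / max q ((l i)\<^sup>2))))
        \<le> ennreal (1 / (s i)\<^sup>2) * emeasure lborel (tube_directions (s i) r x y)"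
      using ev
    proof eventually_elim
      case (elim i)
      have "ennreal (1 / (s i)\<^sup>2) * ennreal (pi ^ 3 / 3 * \<alpha> i * (1 - \<alpha> i) ^ 3 * ((l i)\<^sup>2 / max (dist_line_square x y) ((l i)\<^sup>2)))
          \<le> ennreal (1 / (s i)\<^sup>2) * emeasure lborel (tube_directions (s i) r x y)"
        by (intro mult_left_mono tube_directions_lower[OF n x s(2) \<alpha>_def])
          (use elim in \<open>simp_all add: l_def k_def\<close>)
      also have "ennreal (1 / (s i)\<^sup>2) * ennreal (pi ^ 3 / 3 * \<alpha> i * (1 - \<alpha> i) ^ 3 * ((l i)\<^sup>2 / max (dist_line_square x y) ((l i)\<^sup>2)))
         = ennreal (1 / (s i)\<^sup>2 * (pi ^ 3 / 3 * \<alpha> i * ((1 - \<alpha> i) ^ 3 * ((l i)\<^sup>2 / max q ((l i)\<^sup>2)))))"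
        by (subst ennreal_mult'[symmetric]) (simp_all add: q_def mult.assoc)
      finally show ?case unfolding scale .
    qed
    show "\<forall>\<^sub>F i in sequentially. ennreal (1 / (s i)\<^sup>2) * emeasure lborel (tube_directions (s i) r x y)
        \<le> ennreal (pi ^ 3 / 3 * (1 / (norm x)\<^sup>2) * (1 / (1 - \<alpha> i)\<^sup>2 * ((u i)\<^sup>2 / max q ((u i)\<^sup>2))))"
      using ev
    proof eventually_elim
      case (elim i)
      have "ennreal (1 / (s i)\<^sup>2) * emeasure lborel (tube_directions (s i) r x y)
          \<le> ennreal (1 / (s i)\<^sup>2) * ennreal (pi ^ 3 / 3 * \<alpha> i / (1 - \<alpha> i)\<^sup>2 * ((u i)\<^sup>2 / max (dist_line_square x y) ((u i)\<^sup>2)))"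
        by (intro mult_left_mono tube_directions_upper[OF n x s(2) r \<alpha>_def])
          (use elim in \<open>simp_all add: u_def k_def\<close>)
      also have "\<dots> = ennreal (1 / (s i)\<^sup>2 * (pi ^ 3 / 3 * \<alpha> i * (1 / (1 - \<alpha> i)\<^sup>2 * ((u i)\<^sup>2 / max q ((u i)\<^sup>2)))))"
        by (subst ennreal_mult'[symmetric]) (simp_all add: q_def mult.assoc)
      finally show ?case unfolding scale .
    qed
    have "(\<lambda>i. pi ^ 3 / 3 * (1 / (norm x)\<^sup>2) * ((1 - \<alpha> i) ^ 3 * ((l i)\<^sup>2 / max q ((l i)\<^sup>2))))
       \<longlonglongrightarrow> pi ^ 3 / 3 * (1 / (norm x)\<^sup>2) * ((1 - 0) ^ 3 * (r\<^sup>2 / max q (r\<^sup>2)))"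
      by (intro tendsto_intros \<alpha> l m)
    then show "(\<lambda>i. ennreal (pi ^ 3 / 3 * (1 / (norm x)\<^sup>2) * ((1 - \<alpha> i) ^ 3 * ((l i)\<^sup>2 / max q ((l i)\<^sup>2)))))
       \<longlonglongrightarrow> ennreal (pi ^ 3 / 3 * (1 / (norm x)\<^sup>2) * (r\<^sup>2 / max q (r\<^sup>2)))"
      by (intro tendsto_ennrealI) simp
    have "(\<lambda>i. pi ^ 3 / 3 * (1 / (norm x)\<^sup>2) * (1 / (1 - \<alpha> i)\<^sup>2 * ((u i)\<^sup>2 / max q ((u i)\<^sup>2))))
       \<longlonglongrightarrow> pi ^ 3 / 3 * (1 / (norm x)\<^sup>2) * (1 / (1 - 0)\<^sup>2 * (r\<^sup>2 / max q (r\<^sup>2)))"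
      by (intro tendsto_intros \<alpha> u m) simp
    then show "(\<lambda>i. ennreal (pi ^ 3 / 3 * (1 / (norm x)\<^sup>2) * (1 / (1 - \<alpha> i)\<^sup>2 * ((u i)\<^sup>2 / max q ((u i)\<^sup>2)))))
       \<longlonglongrightarrow> ennreal (pi ^ 3 / 3 * (1 / (norm x)\<^sup>2) * (r\<^sup>2 / max q (r\<^sup>2)))"
      by (intro tendsto_ennrealI) simp
  qed
qed

text \<open>If \<open>s\<close> is not small compared with \<open>norm x\<close>, the volume of the whole unit ball is a sufficient bound.\<close>

lemma tube_directions_dominated:
  fixes x y :: "complex^'n"
  assumes n: "CARD('n) = 3" and x: "x \<noteq> 0" and r: "0 < r" and s: "0 < s"
  shows "ennreal (1 / s\<^sup>2) * emeasure lborel (tube_directions s r x y) \<le> ennreal (2 * pi ^ 3 / (norm x)\<^sup>2)"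
proof (cases "(s / norm x)\<^sup>2 < 1 / 2")
  case True
  define \<alpha> where "\<alpha> = (s / norm x)\<^sup>2"
  define \<rho> where "\<rho> = r + cmod (herm y x) / norm x * (s / norm x)"
  define \<beta> where "\<beta> = \<rho>\<^sup>2 / max (dist_line_square x y) (\<rho>\<^sup>2)"
  have \<alpha>: "0 \<le> \<alpha>" "\<alpha> < 1 / 2" using True by (simp_all add: \<alpha>_def)
  have \<beta>: "\<beta> \<le> 1" "\<beta> \<ge> 0"
    unfolding \<beta>_def by (auto intro!: divide_le_eq_1[THEN iffD2] divide_nonneg_nonneg simp: le_max_iff_disj less_max_iff_disj linorder_not_less zero_less_power2)
  have "(1 / 2)\<^sup>2 \<le> (1 - \<alpha>)\<^sup>2" using \<alpha> by (intro power_mono) auto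
  then have d: "1 / (1 - \<alpha>)\<^sup>2 \<le> 4" using \<alpha> by (simp add: divide_le_eq power2_eq_square)
  have "ennreal (1 / s\<^sup>2) * emeasure lborel (tube_directions s r x y)
      \<le> ennreal (1 / s\<^sup>2) * ennreal (pi ^ 3 / 3 * \<alpha> / (1 - \<alpha>)\<^sup>2 * \<beta>)"
    unfolding \<beta>_def by (intro mult_left_mono tube_directions_upper[OF n x s r \<alpha>_def _ \<rho>_def]) (use \<alpha> in auto)
  also have "\<dots> = ennreal (1 / s\<^sup>2 * \<alpha> * (pi ^ 3 / 3 * (1 / (1 - \<alpha>)\<^sup>2 * \<beta>)))"
    by (subst ennreal_mult'[symmetric]) (simp_all add: ac_simps)
  also have "1 / s\<^sup>2 * \<alpha> = 1 / (norm x)\<^sup>2" using s by (simp add: \<alpha>_def power_divide)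
  also have "1 / (norm x)\<^sup>2 * (pi ^ 3 / 3 * (1 / (1 - \<alpha>)\<^sup>2 * \<beta>)) \<le> 1 / (norm x)\<^sup>2 * (pi ^ 3 / 3 * (4 * 1))"
    using d \<beta> by (intro mult_left_mono mult_mono) auto
  also have "1 / (norm x)\<^sup>2 * (pi ^ 3 / 3 * (4 * 1)) \<le> 1 / (norm x)\<^sup>2 * (2 * pi ^ 3)"
    by (intro mult_left_mono) auto
  also have "1 / (norm x)\<^sup>2 * (2 * pi ^ 3) = 2 * pi ^ 3 / (norm x)\<^sup>2" by simp
  finally show ?thesis by (simp add: ennreal_leI)
next
  case False
  then have le: "1 / s\<^sup>2 \<le> 2 / (norm x)\<^sup>2" using s x by (simp add: power_divide field_simps)
  have "emeasure lborel (tube_directions s r x y) \<le> emeasure lborel (cball (0 :: complex^'n) 1)"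
    by (intro emeasure_mono) (auto simp: tube_directions_def)
  also have "\<dots> = ennreal (pi ^ 3 / 6)" using n by (simp add: emeasure_cball eval_unit_ball_vol)
  finally have "ennreal (1 / s\<^sup>2) * emeasure lborel (tube_directions s r x y) \<le> ennreal (2 / (norm x)\<^sup>2) * ennreal (pi ^ 3 / 6)"
    using le by (intro mult_mono ennreal_leI) auto
  also have "\<dots> = ennreal (2 / (norm x)\<^sup>2 * (pi ^ 3 / 6))" by (subst ennreal_mult') simp_all
  also have "2 / (norm x)\<^sup>2 * (pi ^ 3 / 6) \<le> 2 / (norm x)\<^sup>2 * pi ^ 3" by (intro mult_left_mono) auto
  finally show ?thesis by (simp add: ennreal_leI)
qed

text \<open>Dominated convergence, since \<open>1 / (norm x)\<^sup>2\<close> is integrable over \<open>M\<close>: it is the inverse square of the norm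
  whose unit ball is the Euclidean one.\<close>

lemma tube_pairing_limit:
  fixes K M :: "(complex^'n) set"
  assumes n: "CARD('n) = 3" and K: "compact K" and M: "symmetric_body M" and r: "0 < r" and s: "s \<longlonglongrightarrow> 0" "\<And>i. 0 < s i"
  defines "A \<equiv> (\<integral>\<^sup>+z. indicator M (fst z) * indicator K (snd z) * ennreal (pairing_kernel r (fst z) (snd z)) \<partial>lborel)"
  shows "(\<lambda>i. ennreal (1 / (s i)\<^sup>2) * tube_pairing K M (s i) r) \<longlonglongrightarrow> ennreal (pi ^ 3 / 3 * r\<^sup>2) * A" "A < \<infinity>"
proof -
  interpret M: symmetric_body M by fact
  have MK[measurable]: "M \<in> sets borel" "K \<in> sets borel" using K M.compact_body by (simp_all add: compact_imp_closed)
  have dim: "DIM(complex^'n) = 2 * 3" "2 \<le> (3::nat)" using n by simp_all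
  define w where "w z = indicator M (fst z) * indicator K (snd z) * ennreal (2 * pi ^ 3 / (norm (fst z))\<^sup>2)"
    for z :: "(complex^'n) \<times> (complex^'n)"
  have w_m[measurable]: "w \<in> borel_measurable borel" unfolding w_def by measurable
  have td_m: "(\<lambda>z. indicator M (fst z) * indicator K (snd z) * emeasure lborel (tube_directions (s i) r (fst z) (snd z)))
     \<in> borel_measurable borel" for i
  proof -
    note [measurable] = incidence_measurable[OF K M.compact_body, of "s i" r]
    have "(\<lambda>z. \<integral>\<^sup>+\<xi>. indicator (incidence K M (s i) r) (\<xi>, z) \<partial>lborel) \<in> borel_measurable borel" by measurable
    also have "(\<lambda>z. \<integral>\<^sup>+\<xi>. indicator (incidence K M (s i) r) (\<xi>, z) \<partial>lborel) =
       (\<lambda>z. indicator M (fst z) * indicator K (snd z) * emeasure lborel (tube_directions (s i) r (fst z) (snd z)))"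
      by (simp only: nn_integral_incidence)
    finally show ?thesis .
  qed
  have ae: "AE z in (lborel :: ((complex^'n) \<times> (complex^'n)) measure). fst z \<noteq> 0"
  proof -
    have "AE x in (lborel :: (complex^'n) measure). AE y in (lborel :: (complex^'n) measure). fst (x, y) \<noteq> 0"
      using AE_lborel_singleton[of "0 :: complex^'n"] by eventually_elim simp
    then have "AE z in (lborel :: (complex^'n) measure) \<Otimes>\<^sub>M (lborel :: (complex^'n) measure). fst z \<noteq> 0"
      by (intro lborel_pair.AE_pair_measure) measurable
    then show ?thesis unfolding lborel_prod .
  qed
  have w_fin: "(\<integral>\<^sup>+z. w z \<partial>lborel) < \<infinity>"
  proof -
    interpret N: symmetric_body "cball (0 :: complex^'n) 1" by (rule symmetric_body_cball) simp
    have "(\<integral>\<^sup>+z. w z \<partial>lborel) = (\<integral>\<^sup>+x. \<integral>\<^sup>+y. w (x, y) \<partial>lborel \<partial>lborel)"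
      unfolding lborel_prod[symmetric] by (rule lborel.nn_integral_fst[symmetric]) (simp add: lborel_prod)
    also have "\<dots> = (\<integral>\<^sup>+x. \<integral>\<^sup>+y. (ennreal (2 * pi ^ 3) * (ennreal (1 / (body_norm (cball 0 1) x)\<^sup>2) * indicator M x)) * indicator K y \<partial>lborel \<partial>lborel)"
      unfolding w_def by (intro nn_integral_cong) (simp add: body_norm_cball ac_simps flip: ennreal_mult')
    also have "\<dots> = (\<integral>\<^sup>+x. (ennreal (2 * pi ^ 3) * (ennreal (1 / (body_norm (cball 0 1) x)\<^sup>2) * indicator M x)) * emeasure lborel K \<partial>lborel)"
      by (intro nn_integral_cong nn_integral_cmult_indicator) simp
    also have "\<dots> = ennreal (2 * pi ^ 3) * (\<integral>\<^sup>+x. ennreal (1 / (body_norm (cball 0 1) x)\<^sup>2) * indicator M x \<partial>lborel) * emeasure lborel K"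
      by (subst nn_integral_multc, simp, subst nn_integral_cmult) simp_all
    also have "\<dots> < \<infinity>"
      using N.inverse_square_body_norm_integral_le[OF dim MK(1) M.emeasure_body] emeasure_compact_finite[OF K]
      by (auto simp: ennreal_mult_less_top intro: le_less_trans)
    finally show ?thesis .
  qed
  have lim_point: "AE z in lborel. (\<lambda>i. ennreal (1 / (s i)\<^sup>2) * (indicator M (fst z) * indicator K (snd z) * emeasure lborel (tube_directions (s i) r (fst z) (snd z))))
     \<longlonglongrightarrow> indicator M (fst z) * indicator K (snd z) * ennreal (pi ^ 3 / 3 * r\<^sup>2 * pairing_kernel r (fst z) (snd z))"
    using ae
  proof eventually_elim
    case (elim z)
    from tube_directions_limit[OF n elim r s, of "snd z"] show ?case by (simp add: indicator_def)
  qed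
  have bound: "AE z in lborel. ennreal (1 / (s i)\<^sup>2) * (indicator M (fst z) * indicator K (snd z) * emeasure lborel (tube_directions (s i) r (fst z) (snd z))) \<le> w z" for i
    using ae
  proof eventually_elim
    case (elim z)
    from tube_directions_dominated[OF n elim r s(2), of i "snd z"] show ?case by (simp add: w_def indicator_def)
  qed
  have ker_m[measurable]: "(\<lambda>z. pairing_kernel r (fst z) (snd z)) \<in> borel_measurable borel"
    unfolding pairing_kernel_def by measurable
  let ?A = "\<integral>\<^sup>+z. indicator M (fst z) * indicator K (snd z) * ennreal (pi ^ 3 / 3 * r\<^sup>2 * pairing_kernel r (fst z) (snd z)) \<partial>lborel"
  have "(\<lambda>i. \<integral>\<^sup>+z. ennreal (1 / (s i)\<^sup>2) * (indicator M (fst z) * indicator K (snd z) * emeasure lborel (tube_directions (s i) r (fst z) (snd z))) \<partial>lborel) \<longlonglongrightarrow> ?A"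
    by (rule nn_integral_dominated_convergence[OF _ _ _ bound w_fin lim_point]) (use td_m in simp_all)
  moreover have "(\<integral>\<^sup>+z. ennreal (1 / (s i)\<^sup>2) * (indicator M (fst z) * indicator K (snd z) * emeasure lborel (tube_directions (s i) r (fst z) (snd z))) \<partial>lborel)
      = ennreal (1 / (s i)\<^sup>2) * tube_pairing K M (s i) r" for i
    unfolding tube_pairing_eq[OF K M.compact_body] by (rule nn_integral_cmult) (use td_m in simp)
  moreover have A: "?A = ennreal (pi ^ 3 / 3 * r\<^sup>2) * A"
  proof -
    have "?A = (\<integral>\<^sup>+z. ennreal (pi ^ 3 / 3 * r\<^sup>2) * (indicator M (fst z) * indicator K (snd z) * ennreal (pairing_kernel r (fst z) (snd z))) \<partial>lborel)"
    proof (rule nn_integral_cong)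
      fix z :: "(complex^'n) \<times> (complex^'n)"
      have "ennreal (pi ^ 3 / 3 * r\<^sup>2 * pairing_kernel r (fst z) (snd z))
         = ennreal (pi ^ 3 / 3 * r\<^sup>2) * ennreal (pairing_kernel r (fst z) (snd z))"
        by (rule ennreal_mult') simp
      then show "indicator M (fst z) * indicator K (snd z) * ennreal (pi ^ 3 / 3 * r\<^sup>2 * pairing_kernel r (fst z) (snd z))
        = ennreal (pi ^ 3 / 3 * r\<^sup>2) * (indicator M (fst z) * indicator K (snd z) * ennreal (pairing_kernel r (fst z) (snd z)))"
        by (simp only: ac_simps)
    qed
    then show ?thesis unfolding A_def by (subst (asm) nn_integral_cmult) simp_all
  qed
  ultimately show "(\<lambda>i. ennreal (1 / (s i)\<^sup>2) * tube_pairing K M (s i) r) \<longlonglongrightarrow> ennreal (pi ^ 3 / 3 * r\<^sup>2) * A" by simp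
  have "?A \<le> (\<integral>\<^sup>+z. w z \<partial>lborel)"
  proof (rule nn_integral_mono_AE)
    show "AE z in lborel. indicator M (fst z) * indicator K (snd z) * ennreal (pi ^ 3 / 3 * r\<^sup>2 * pairing_kernel r (fst z) (snd z)) \<le> w z"
      using lim_point bound[THEN AE_all_countable[THEN iffD2, OF allI]]
      by eventually_elim (rule LIMSEQ_le_const2, auto)
  qed
  then have "ennreal (pi ^ 3 / 3 * r\<^sup>2) * A < \<infinity>" using w_fin A by (auto intro: le_less_trans)
  then show "A < \<infinity>" using r by (auto simp: ennreal_mult_less_top)
qed

section \<open>Complex dimension three\<close>

lemma ennreal_rearrangement:
  fixes X Y p q :: ennreal
  assumes "X \<le> Y" "q \<le> p" shows "X * p + Y * q \<le> X * q + Y * p"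
proof -
  obtain d e where "p = q + d" "Y = X + e" using assms by (auto simp: le_iff_add)
  then have "X * q + Y * p = (X * p + Y * q) + e * d" by (simp add: distrib_left distrib_right ac_simps)
  then show ?thesis by simp
qed

lemma tube_emeasure_measurable:
  assumes "compact (M :: (complex^'n) set)"
  shows "(\<lambda>\<xi>. emeasure lborel (tube M s \<xi>)) \<in> borel_measurable borel"
proof -
  have "closed ((UNIV \<times> M) \<inter> {z. cmod (herm (snd z) (fst z)) \<le> s * norm (fst z)})"
    using assms by (intro closed_Int closed_Times closed_Collect_le continuous_intros compact_imp_closed) auto
  then have m: "(UNIV \<times> M) \<inter> {z. cmod (herm (snd z) (fst z)) \<le> s * norm (fst z)} \<in> sets borel" by simp
  have "(\<lambda>\<xi>. emeasure lborel (Pair \<xi> -` ((UNIV \<times> M) \<inter> {z. cmod (herm (snd z) (fst z)) \<le> s * norm (fst z)})))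
      \<in> borel_measurable lborel"
    by (rule lborel.measurable_emeasure_Pair) (use m in \<open>simp only: lborel_prod sets_lborel\<close>)
  also have "(\<lambda>\<xi>. emeasure lborel (Pair \<xi> -` ((UNIV \<times> M) \<inter> {z. cmod (herm (snd z) (fst z)) \<le> s * norm (fst z)})))
     = (\<lambda>\<xi>. emeasure lborel (tube M s \<xi>))"
    by (intro ext arg_cong[where f="emeasure lborel"]) (auto simp: tube_def)
  finally show ?thesis by simp
qed

text \<open>The factor accounts for replacing section volumes by tubes; it tends to \<open>1\<close> with \<open>t\<close> and serves all
  \<open>s \<le> t\<close> at once, so that \<open>s\<close> can tend to \<open>0\<close> first.\<close>

lemma tube_comparison:
  fixes K L D :: "(complex^'n) set"
  assumes n: "CARD('n) = 3" and K: "compact K" "convex K" "cball 0 e \<subseteq> K"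
    and L: "compact L" "convex L" "cball 0 e \<subseteq> L" and D: "compact D" "convex D" "cball 0 e \<subseteq> D"
    and le: "\<And>\<xi>. norm \<xi> = 1 \<Longrightarrow> section_volume K \<xi> \<le> section_volume L \<xi> + section_volume D \<xi>"
    and s: "0 < s" "s \<le> t" "t < e" and \<xi>: "norm \<xi> = 1"
  shows "emeasure lborel (tube K s \<xi>) \<le>
    ennreal (((1 + t / e) / (1 - t / e)) ^ 4) * (emeasure lborel (tube L s \<xi>) + emeasure lborel (tube D s \<xi>))"
proof -
  have n': "CARD('n) = 2 \<or> CARD('n) = 3" using n by simp
  have e: "e > 0" and se: "s < e" using s by auto
  define \<gamma> where "\<gamma> = ((1 + t / e) / (1 - t / e)) ^ 4"
  have te: "t / e < 1" "0 < t / e" "s / e \<le> t / e" "0 < s / e" using s e by (auto simp: divide_right_mono)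
  have "(1 + s / e) / (1 - s / e) \<le> (1 + t / e) / (1 - t / e)" using te by (intro frac_le) auto
  then have \<gamma>: "((1 + s / e) / (1 - s / e)) ^ 4 \<le> \<gamma>" unfolding \<gamma>_def using te by (intro power_mono) auto
  then have \<gamma>': "(1 + s / e) ^ 4 \<le> \<gamma> * (1 - s / e) ^ 4"
  proof -
    have "1 - s / e > 0" using te by linarith
    then have "(1 - s / e) ^ 4 > 0" by (rule zero_less_power)
    then show ?thesis using \<gamma> by (simp only: power_divide pos_divide_le_eq)
  qed
  have \<gamma>0: "\<gamma> \<ge> 0" using te by (simp add: \<gamma>_def)
  have S0: "section_volume M \<xi> \<ge> 0" for M :: "(complex^'n) set" by (simp add: section_volume_def)
  have "emeasure lborel (tube K s \<xi>) \<le> ennreal (pi * s\<^sup>2 * (1 + s / e) ^ 4 * section_volume K \<xi>)"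
    using tube_bounds(2)[OF n' K s(1) se \<xi>] n by simp
  also have "\<dots> \<le> ennreal (\<gamma> * (pi * s\<^sup>2 * (1 - s / e) ^ 4 * section_volume L \<xi> + pi * s\<^sup>2 * (1 - s / e) ^ 4 * section_volume D \<xi>))"
  proof (rule ennreal_leI)
    have "pi * s\<^sup>2 * (1 + s / e) ^ 4 * section_volume K \<xi>
       \<le> pi * s\<^sup>2 * (\<gamma> * (1 - s / e) ^ 4) * (section_volume L \<xi> + section_volume D \<xi>)"
      using \<gamma>' le[OF \<xi>] S0 \<gamma>0 te by (intro mult_mono mult_left_mono) auto
    then show "pi * s\<^sup>2 * (1 + s / e) ^ 4 * section_volume K \<xi>
       \<le> \<gamma> * (pi * s\<^sup>2 * (1 - s / e) ^ 4 * section_volume L \<xi> + pi * s\<^sup>2 * (1 - s / e) ^ 4 * section_volume D \<xi>)"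
      by (simp only: distrib_left distrib_right ac_simps)
  qed
  also have "\<dots> = ennreal \<gamma> * (ennreal (pi * s\<^sup>2 * (1 - s / e) ^ 4 * section_volume L \<xi>)
      + ennreal (pi * s\<^sup>2 * (1 - s / e) ^ 4 * section_volume D \<xi>))"
    using S0 te by (subst ennreal_mult'[OF \<gamma>0], subst ennreal_plus) auto
  also have "\<dots> \<le> ennreal \<gamma> * (emeasure lborel (tube L s \<xi>) + emeasure lborel (tube D s \<xi>))"
    using tube_bounds(1)[OF n' L s(1) se \<xi>] tube_bounds(1)[OF n' D s(1) se \<xi>] n
    by (intro mult_left_mono add_mono) simp_all
  finally show ?thesis by (simp add: \<gamma>_def)
qed

text \<open>The hypothesis on tubes is multiplied by the nonnegative weight \<open>4 * V\<^sub>K (t / 2) - V\<^sub>K t\<close> and integrated; the negative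
  terms are moved to the other side to stay within \<open>ennreal\<close>.\<close>

lemma tube_pairing_comparison:
  fixes K L D :: "(complex^'n) set"
  assumes n: "CARD('n) = 3" and K: "compact K" "convex K" "origin_symmetric K" and L: "compact L" and D: "compact D"
    and le: "\<And>\<xi>. norm \<xi> = 1 \<Longrightarrow> emeasure lborel (tube K s \<xi>) \<le>
      \<gamma> * (emeasure lborel (tube L s \<xi>) + emeasure lborel (tube D s \<xi>))"
  shows "4 * tube_pairing K K s (t / 2) + \<gamma> * (tube_pairing K L s t + tube_pairing K D s t)
    \<le> tube_pairing K K s t + \<gamma> * (4 * tube_pairing K L s (t / 2) + 4 * tube_pairing K D s (t / 2))"
proof -
  define V where "V M r \<xi> = emeasure lborel (tube M r \<xi>)" for M r and \<xi> :: "complex^'n"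
  define B where "B \<xi> = (indicator (cball 0 1) \<xi> :: ennreal)" for \<xi> :: "complex^'n"
  have [measurable]: "V K r \<in> borel_measurable borel" "V L r \<in> borel_measurable borel" "V D r \<in> borel_measurable borel" for r
    unfolding V_def using tube_emeasure_measurable K(1) L D by auto
  have [measurable]: "B \<in> borel_measurable borel" unfolding B_def by (intro borel_measurable_indicator) simp
  have tp: "tube_pairing K M s r = (\<integral>\<^sup>+\<xi>. B \<xi> * (V M s \<xi> * V K r \<xi>) \<partial>lborel)" for M r
    by (simp add: tube_pairing_def V_def B_def)
  have 1: "4 * tube_pairing K K s (t / 2) + \<gamma> * (tube_pairing K L s t + tube_pairing K D s t)
     = (\<integral>\<^sup>+\<xi>. B \<xi> * (V K s \<xi> * (4 * V K (t / 2) \<xi>) + (\<gamma> * (V L s \<xi> + V D s \<xi>)) * V K t \<xi>) \<partial>lborel)"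
    unfolding tp by (simp add: distrib_left distrib_right nn_integral_add nn_integral_cmult ac_simps
        flip: nn_integral_cmult)
  have 2: "tube_pairing K K s t + \<gamma> * (4 * tube_pairing K L s (t / 2) + 4 * tube_pairing K D s (t / 2))
     = (\<integral>\<^sup>+\<xi>. B \<xi> * (V K s \<xi> * V K t \<xi> + (\<gamma> * (V L s \<xi> + V D s \<xi>)) * (4 * V K (t / 2) \<xi>)) \<partial>lborel)"
    unfolding tp by (simp add: distrib_left distrib_right nn_integral_add nn_integral_cmult ac_simps
        flip: nn_integral_cmult)
  show ?thesis
    unfolding 1 2
  proof (rule nn_integral_mono_AE, rule AE_mp[OF AE_lborel_singleton[of 0]], rule AE_I2, rule impI, rule mult_left_mono)
    fix \<xi> :: "complex^'n" assume \<xi>: "\<xi> \<noteq> 0"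
    then have sgn: "norm (sgn \<xi>) = 1" by (simp add: norm_sgn)
    show "V K s \<xi> * (4 * V K (t / 2) \<xi>) + (\<gamma> * (V L s \<xi> + V D s \<xi>)) * V K t \<xi>
       \<le> V K s \<xi> * V K t \<xi> + (\<gamma> * (V L s \<xi> + V D s \<xi>)) * (4 * V K (t / 2) \<xi>)"
    proof (rule ennreal_rearrangement)
      show "V K s \<xi> \<le> \<gamma> * (V L s \<xi> + V D s \<xi>)"
        using le[OF sgn] by (simp add: V_def tube_sgn[OF \<xi>])
      show "V K t \<xi> \<le> 4 * V K (t / 2) \<xi>"
        using tube_halving[OF n K(2) _ K(3) sgn, of t] K(1)
        by (simp add: V_def tube_sgn[OF \<xi>] compact_imp_closed)
    qed
  qed simp
qed

definition kernel_integral :: "(complex^'n) set \<Rightarrow> (complex^'n) set \<Rightarrow> real \<Rightarrow> ennreal" where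
  "kernel_integral K M r =
    (\<integral>\<^sup>+z. indicator M (fst z) * indicator K (snd z) * ennreal (pairing_kernel r (fst z) (snd z)) \<partial>lborel)"

text \<open>The limit for \<open>s\<close> tending to \<open>0\<close>; since \<open>4 * (t / 2)\<^sup>2 = t\<^sup>2\<close>, all limits carry the same constant.\<close>

lemma kernel_integral_comparison:
  fixes K L D :: "(complex^'n) set"
  assumes n: "CARD('n) = 3" and K: "symmetric_body K" and L: "symmetric_body L" and D: "symmetric_body D"
    and e: "cball 0 e \<subseteq> K" "cball 0 e \<subseteq> L" "cball 0 e \<subseteq> D"
    and le: "\<And>\<xi>. norm \<xi> = 1 \<Longrightarrow> section_volume K \<xi> \<le> section_volume L \<xi> + section_volume D \<xi>"
    and t: "0 < t" "t < e" and \<gamma>: "\<gamma> = ennreal (((1 + t / e) / (1 - t / e)) ^ 4)"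
  shows "kernel_integral K K (t / 2) + \<gamma> * (kernel_integral K L t + kernel_integral K D t)
     \<le> kernel_integral K K t + \<gamma> * (kernel_integral K L (t / 2) + kernel_integral K D (t / 2))"
proof -
  interpret K: symmetric_body K by fact
  interpret L: symmetric_body L by fact
  interpret D: symmetric_body D by fact
  define s where "s i = t / (real i + 1)" for i :: nat
  have s: "0 < s i" "s i \<le> t" for i using t(1) by (auto simp: s_def divide_le_eq distrib_left)
  have s0: "s \<longlonglongrightarrow> 0" unfolding s_def by real_asymp
  have lim: "(\<lambda>i. ennreal (1 / (s i)\<^sup>2) * tube_pairing K M (s i) r) \<longlonglongrightarrow> ennreal (pi ^ 3 / 3 * r\<^sup>2) * kernel_integral K M r"
    if "symmetric_body M" "r > 0" for M r
    unfolding kernel_integral_def by (rule tube_pairing_limit(1)[OF n K.compact_body that s0 s(1)])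
  have \<gamma>fin: "\<gamma> < top" "(4::ennreal) < top" by (simp_all add: \<gamma> less_top[symmetric])
  have t2: "t / 2 > 0" using t by simp
  let ?P = "\<lambda>M r i. ennreal (1 / (s i)\<^sup>2) * tube_pairing K M (s i) r"
  have ineq: "4 * ?P K (t / 2) i + \<gamma> * (?P L t i + ?P D t i) \<le> ?P K t i + \<gamma> * (4 * ?P L (t / 2) i + 4 * ?P D (t / 2) i)" for i
  proof -
    have "4 * tube_pairing K K (s i) (t / 2) + \<gamma> * (tube_pairing K L (s i) t + tube_pairing K D (s i) t)
      \<le> tube_pairing K K (s i) t + \<gamma> * (4 * tube_pairing K L (s i) (t / 2) + 4 * tube_pairing K D (s i) (t / 2))"
      unfolding \<gamma>
      by (rule tube_pairing_comparison[OF n K.compact_body K.convex_body K.symmetric L.compact_body D.compact_body])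
        (rule tube_comparison[OF n K.compact_body K.convex_body e(1) L.compact_body L.convex_body e(2)
            D.compact_body D.convex_body e(3) le s t(2)])
    then have "ennreal (1 / (s i)\<^sup>2) * (4 * tube_pairing K K (s i) (t / 2) + \<gamma> * (tube_pairing K L (s i) t + tube_pairing K D (s i) t))
      \<le> ennreal (1 / (s i)\<^sup>2) * (tube_pairing K K (s i) t + \<gamma> * (4 * tube_pairing K L (s i) (t / 2) + 4 * tube_pairing K D (s i) (t / 2)))"
      by (rule mult_left_mono) simp
    then show ?thesis by (simp only: distrib_left ac_simps)
  qed
  let ?c = "ennreal (pi ^ 3 / 3 * t\<^sup>2)"
  have c4: "4 * (ennreal (pi ^ 3 / 3 * (t / 2)\<^sup>2) * k) = ?c * k" for k
  proof -
    have "4 * ennreal (pi ^ 3 / 3 * (t / 2)\<^sup>2) = ennreal (4 * (pi ^ 3 / 3 * (t / 2)\<^sup>2))"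
      by (subst ennreal_mult') simp_all
    also have "4 * (pi ^ 3 / 3 * (t / 2)\<^sup>2) = pi ^ 3 / 3 * t\<^sup>2" by (simp add: power_divide)
    finally show ?thesis by (simp only: mult.assoc[symmetric])
  qed
  have ev: "\<forall>\<^sub>F i in sequentially. 4 * ?P K (t / 2) i + \<gamma> * (?P L t i + ?P D t i)
      \<le> ?P K t i + \<gamma> * (4 * ?P L (t / 2) i + 4 * ?P D (t / 2) i)"
    using ineq by (rule always_eventually[OF allI])
  have "4 * (ennreal (pi ^ 3 / 3 * (t / 2)\<^sup>2) * kernel_integral K K (t / 2)) + \<gamma> * (?c * kernel_integral K L t + ?c * kernel_integral K D t)
    \<le> ?c * kernel_integral K K t + \<gamma> * (4 * (ennreal (pi ^ 3 / 3 * (t / 2)\<^sup>2) * kernel_integral K L (t / 2))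
        + 4 * (ennreal (pi ^ 3 / 3 * (t / 2)\<^sup>2) * kernel_integral K D (t / 2)))"
    by (rule tendsto_le[OF trivial_limit_sequentially _ _ ev];
        intro tendsto_add ennreal_tendsto_cmult \<gamma>fin lim K L D t(1) t2)
  then have "?c * (kernel_integral K K (t / 2) + \<gamma> * (kernel_integral K L t + kernel_integral K D t))
     \<le> ?c * (kernel_integral K K t + \<gamma> * (kernel_integral K L (t / 2) + kernel_integral K D (t / 2)))"
    unfolding c4 by (simp only: distrib_left distrib_right ac_simps)
  moreover have "?c \<noteq> 0" "?c \<noteq> top" using t by simp_all
  ultimately show ?thesis using ennreal_mult_le_mult_iff by blast
qed

section \<open>Concentration near the complex line\<close>

text \<open>The difference of the pairing kernels for the widths \<open>t / 2\<close> and \<open>t\<close>, without the factor \<open>1 / (norm x)\<^sup>2\<close>, as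
  a function of the squared distance \<open>q\<close> from the complex line through \<open>x\<close>.\<close>

definition bump :: "real \<Rightarrow> real \<Rightarrow> real" where
  "bump t q = 1 / max q ((t / 2)\<^sup>2) - 1 / max q (t\<^sup>2)"

lemma half_square_le: "(t / 2)\<^sup>2 \<le> (t::real)\<^sup>2"
  by (simp add: power_divide)

lemma bump_nonneg: "t > 0 \<Longrightarrow> bump t q \<ge> 0"
proof -
  assume "t > 0"
  then have "0 < max q ((t / 2)\<^sup>2)" by (simp add: less_max_iff_disj)
  moreover have "max q ((t / 2)\<^sup>2) \<le> max q (t\<^sup>2)" by (intro max.mono half_square_le order_refl)
  ultimately show ?thesis unfolding bump_def by (simp add: frac_le)
qed

lemma bump_eq_0: "t > 0 \<Longrightarrow> t\<^sup>2 \<le> q \<Longrightarrow> bump t q = 0"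
proof -
  assume "t\<^sup>2 \<le> q"
  then have "max q ((t / 2)\<^sup>2) = q" "max q (t\<^sup>2) = q"
    using half_square_le[of t] by (simp_all only: max_absorb1 order_trans)
  then show ?thesis by (simp add: bump_def)
qed

lemma bump_le: "t > 0 \<Longrightarrow> bump t q \<le> 4 / t\<^sup>2"
proof -
  assume t: "t > 0"
  have "1 / max q ((t / 2)\<^sup>2) \<le> 1 / ((t / 2)\<^sup>2)" using t by (intro frac_le) auto
  also have "1 / ((t / 2)\<^sup>2) = 4 / t\<^sup>2" by (simp add: power_divide)
  finally have "1 / max q ((t / 2)\<^sup>2) \<le> 4 / t\<^sup>2" .
  moreover have "0 \<le> 1 / max q (t\<^sup>2)" by (intro divide_nonneg_nonneg) (auto simp: le_max_iff_disj)
  ultimately show ?thesis unfolding bump_def by linarith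
qed

lemma bump_integral:
  assumes t: "t > 0"
  defines "c \<equiv> (\<integral>\<^sup>+w. ennreal (bump t ((norm w)\<^sup>2)) \<partial>(lborel :: (complex \<times> complex) measure))"
  shows "c \<noteq> 0" "c < \<infinity>"
proof -
  have "0 < ennreal (3 / t\<^sup>2) * emeasure lborel (cball (0 :: complex \<times> complex) (t / 2))"
    using t by (simp add: emeasure_cball eval_unit_ball_vol ennreal_zero_less_mult_iff)
  also have "\<dots> = (\<integral>\<^sup>+w. ennreal (3 / t\<^sup>2) * indicator (cball (0 :: complex \<times> complex) (t / 2)) w \<partial>lborel)"
    by (subst nn_integral_cmult_indicator) auto
  also have "\<dots> \<le> c" unfolding c_def
  proof (rule nn_integral_mono)
    fix w :: "complex \<times> complex"
    have "bump t ((norm w)\<^sup>2) = 3 / t\<^sup>2" if "norm w \<le> t / 2"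
    proof -
      have "(norm w)\<^sup>2 \<le> (t / 2)\<^sup>2" using that by (intro power_mono) auto
      moreover from this have "(norm w)\<^sup>2 \<le> t\<^sup>2" using half_square_le[of t] by linarith
      ultimately show ?thesis by (simp add: bump_def max_absorb2 power_divide)
    qed
    then show "ennreal (3 / t\<^sup>2) * indicator (cball 0 (t / 2)) w \<le> ennreal (bump t ((norm w)\<^sup>2))"
      by (auto simp: indicator_def)
  qed
  finally show "c \<noteq> 0" by simp
  have "c \<le> (\<integral>\<^sup>+w. ennreal (4 / t\<^sup>2) * indicator (cball (0 :: complex \<times> complex) t) w \<partial>lborel)"
    unfolding c_def
  proof (rule nn_integral_mono)
    fix w :: "complex \<times> complex"
    have "bump t ((norm w)\<^sup>2) = 0" if "\<not> norm w \<le> t"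
      using that t by (intro bump_eq_0 power_mono) auto
    then show "ennreal (bump t ((norm w)\<^sup>2)) \<le> ennreal (4 / t\<^sup>2) * indicator (cball 0 t) w"
      using bump_le[OF t] by (auto simp: indicator_def intro!: ennreal_leI)
  qed
  also have "\<dots> = ennreal (4 / t\<^sup>2) * emeasure lborel (cball (0 :: complex \<times> complex) t)"
    by (subst nn_integral_cmult_indicator) auto
  also have "\<dots> < \<infinity>" using t by (simp add: emeasure_cball ennreal_mult_less_top)
  finally show "c < \<infinity>" .
qed

text \<open>Integrate first along the line of \<open>x\<close>.  The weight only sees lines within distance \<open>t\<close> of it, and those cut
  nearly the same area out of \<open>K\<close> as the central one.\<close>

lemma (in complex_body) bump_integral_bounds:
  fixes x :: "complex^'n"
  assumes n: "CARD('n) = 3" and e: "cball 0 e \<subseteq> K" and t: "0 < t" "t < e" and x: "x \<noteq> 0"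
  defines "c \<equiv> (\<integral>\<^sup>+w. ennreal (bump t ((norm w)\<^sup>2)) \<partial>(lborel :: (complex \<times> complex) measure))"
  shows "ennreal ((1 - t / e)\<^sup>2) * (ennreal (pi * (norm x)\<^sup>2 / (body_norm K x)\<^sup>2) * c)
      \<le> (\<integral>\<^sup>+y. indicator K y * ennreal (bump t (dist_line_square x y)) \<partial>lborel)" (is "?lower \<le> ?I")
    "(\<integral>\<^sup>+y. indicator K y * ennreal (bump t (dist_line_square x y)) \<partial>lborel)
      \<le> ennreal ((1 + t / e)\<^sup>2) * (ennreal (pi * (norm x)\<^sup>2 / (body_norm K x)\<^sup>2) * c)" (is "_ \<le> ?upper")
proof -
  define u where "u = sgn x"
  have u: "norm u = 1" "u \<noteq> 0" using x by (auto simp: u_def norm_sgn sgn_zero_iff)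
  have xu: "x = of_real (norm x) *s u" using x by (simp add: u_def sgn_div_norm flip: scaleR_eq_smult)
  have D: "DIM(complex \<times> complex) + 2 = DIM(complex^'n)" using n by simp
  obtain E :: "complex \<times> complex \<Rightarrow> complex^'n" where E: "linear_isometry E" "range E = complex_hyperplane u"
    "linear_isometry (\<lambda>(a, w). a *s u + E w)" "\<And>a w. herm (a *s u + E w) u = a"
    by (rule line_coordinates[OF u(1) D]) simp_all
  define F where "F = (\<lambda>(w, a). a *s u + E w)"
  have F: "linear_isometry F"
    unfolding linear_isometry_def
  proof (intro conjI allI linearI)
    fix z z' :: "(complex \<times> complex) \<times> complex" and r
    have linE: "linear E" using E(1) by (rule linear_isometry_linear)
    show "F (z + z') = F z + F z'"
      by (cases z; cases z') (auto simp: F_def linear_add[OF linE] vec_eq_iff algebra_simps)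
    show "F (r *\<^sub>R z) = r *\<^sub>R F z"
      by (cases z) (auto simp: F_def linear_scale[OF linE] vec_eq_iff algebra_simps)
    obtain w a where z: "z = (w, a)" by (cases z)
    have "norm (F z) = norm (a, w)"
      using linear_isometry_norm[OF E(3), of "(a, w)"] by (simp add: F_def z)
    then show "norm (F z) = norm z" by (simp add: z norm_Pair ac_simps)
  qed
  have q: "dist_line_square x (F (w, a)) = (norm w)\<^sup>2" for w a
  proof -
    have "herm (F (w, a)) x = of_real (norm x) * a"
      by (subst xu) (simp add: herm_smult_right F_def E(4))
    then have "cmod (herm (F (w, a)) x) / norm x = cmod a" using x by (simp add: norm_mult)
    moreover have "(norm (F (w, a)))\<^sup>2 = (norm w)\<^sup>2 + (cmod a)\<^sup>2"
      unfolding linear_isometry_norm[OF F] by (simp add: norm_Pair)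
    ultimately show ?thesis by (simp add: dist_line_square_def)
  qed
  have bump_m[measurable]: "bump t \<in> borel_measurable borel" unfolding bump_def by measurable
  note [measurable] = linear_isometry_measurable[OF F]
  have I: "?I = (\<integral>\<^sup>+w. ennreal (bump t ((norm w)\<^sup>2)) * emeasure lborel {a. F (w, a) \<in> K} \<partial>lborel)"
  proof -
    have "?I = (\<integral>\<^sup>+w. \<integral>\<^sup>+a. indicator K (F (w, a)) * ennreal (bump t (dist_line_square x (F (w, a)))) \<partial>lborel \<partial>lborel)"
      by (rule nn_integral_fibers[OF F]) (use n in \<open>simp, measurable\<close>)
    also have "\<dots> = (\<integral>\<^sup>+w. \<integral>\<^sup>+a. ennreal (bump t ((norm w)\<^sup>2)) * indicator {a. F (w, a) \<in> K} a \<partial>lborel \<partial>lborel)"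
      unfolding q by (intro nn_integral_cong) (simp add: indicator_def)
    also have "\<dots> = (\<integral>\<^sup>+w. ennreal (bump t ((norm w)\<^sup>2)) * emeasure lborel {a. F (w, a) \<in> K} \<partial>lborel)"
      using slice_measurable[OF F body_measurable]
      by (intro nn_integral_cong nn_integral_cmult_indicator) simp
    finally show ?thesis .
  qed
  have central: "emeasure lborel {a. F (0, a) \<in> K} = ennreal (pi * (norm x)\<^sup>2 / (body_norm K x)\<^sup>2)"
  proof -
    have "emeasure lborel {a. F (0, a) \<in> K} = ennreal (pi / (body_norm K u)\<^sup>2)"
      using line_section[OF u(2)] by (simp add: F_def linear_0[OF linear_isometry_linear[OF E(1)]])
    also have "body_norm K u = body_norm K x / norm x"
      unfolding u_def sgn_div_norm by (simp add: body_norm_scaleR[OF body symmetric] divide_inverse mult.commute)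
    finally show ?thesis by (simp add: power_divide)
  qed
  have factor: "k * (ennreal (pi * (norm x)\<^sup>2 / (body_norm K x)\<^sup>2) * c)
      = (\<integral>\<^sup>+w. ennreal (bump t ((norm w)\<^sup>2)) * (k * emeasure lborel {a. F (0, a) \<in> K})
          \<partial>(lborel :: (complex \<times> complex) measure))" for k
    unfolding c_def central by (subst nn_integral_multc) (simp_all add: ac_simps)
  have far: "bump t ((norm w)\<^sup>2) = 0" if "\<not> norm w \<le> t" for w :: "complex \<times> complex"
    using that t by (intro bump_eq_0 power_mono) auto
  show "?lower \<le> ?I"
    unfolding I factor
  proof (rule nn_integral_mono)
    fix w :: "complex \<times> complex"
    show "ennreal (bump t ((norm w)\<^sup>2)) * (ennreal ((1 - t / e)\<^sup>2) * emeasure lborel {a. F (0, a) \<in> K})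
      \<le> ennreal (bump t ((norm w)\<^sup>2)) * emeasure lborel {a. F (w, a) \<in> K}"
      using slice_emeasure_bounds(1)[OF F convex_body body_measurable e _ t(2), of w] far[of w]
      by (cases "norm w \<le> t") (auto intro!: mult_left_mono)
  qed
  show "?I \<le> ?upper"
    unfolding I factor
  proof (rule nn_integral_mono)
    fix w :: "complex \<times> complex"
    show "ennreal (bump t ((norm w)\<^sup>2)) * emeasure lborel {a. F (w, a) \<in> K}
      \<le> ennreal (bump t ((norm w)\<^sup>2)) * (ennreal ((1 + t / e)\<^sup>2) * emeasure lborel {a. F (0, a) \<in> K})"
      using slice_emeasure_bounds(2)[OF F convex_body body_measurable e _ t(2), of w] far[of w]
      by (cases "norm w \<le> t") (auto intro!: mult_left_mono)
  qed
qed

definition bump_pairing :: "(complex^'n) set \<Rightarrow> (complex^'n) set \<Rightarrow> real \<Rightarrow> ennreal" where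
  "bump_pairing K M t = (\<integral>\<^sup>+x. ennreal (1 / (norm x)\<^sup>2) * indicator M x *
     (\<integral>\<^sup>+y. indicator K y * ennreal (bump t (dist_line_square x y)) \<partial>lborel) \<partial>lborel)"

lemma kernel_integral_split:
  fixes K M :: "(complex^'n) set"
  assumes K[measurable]: "K \<in> sets borel" and M[measurable]: "M \<in> sets borel" and t: "t > 0"
  shows "kernel_integral K M (t / 2) = kernel_integral K M t + bump_pairing K M t"
proof -
  have [measurable]: "(\<lambda>z. pairing_kernel r (fst z) (snd z)) \<in> borel_measurable (borel :: ((complex^'n) \<times> (complex^'n)) measure)" for r
    unfolding pairing_kernel_def by measurable
  have [measurable]: "bump t \<in> borel_measurable borel" unfolding bump_def by measurable
  have split: "pairing_kernel (t / 2) x y = pairing_kernel t x y + 1 / (norm x)\<^sup>2 * bump t (dist_line_square x y)"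
    for x y :: "complex^'n"
    by (simp add: pairing_kernel_def bump_def algebra_simps)
  have nonneg: "pairing_kernel t x y \<ge> 0" for x y :: "complex^'n"
    unfolding pairing_kernel_def by (intro mult_nonneg_nonneg divide_nonneg_nonneg) (auto simp: le_max_iff_disj)
  let ?h = "\<lambda>z :: (complex^'n) \<times> (complex^'n). indicator M (fst z) * indicator K (snd z) *
      ennreal (1 / (norm (fst z))\<^sup>2 * bump t (dist_line_square (fst z) (snd z)))"
  have "kernel_integral K M (t / 2) = (\<integral>\<^sup>+z. indicator M (fst z) * indicator K (snd z) * ennreal (pairing_kernel t (fst z) (snd z)) + ?h z \<partial>lborel)"
    unfolding kernel_integral_def split
    using bump_nonneg[OF t] nonneg by (intro nn_integral_cong) (simp add: ennreal_plus distrib_left)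
  also have "\<dots> = kernel_integral K M t + (\<integral>\<^sup>+z. ?h z \<partial>lborel)"
    unfolding kernel_integral_def by (rule nn_integral_add) measurable
  also have "(\<integral>\<^sup>+z. ?h z \<partial>lborel) = (\<integral>\<^sup>+x. \<integral>\<^sup>+y. ?h (x, y) \<partial>lborel \<partial>lborel)"
  proof -
    have "?h \<in> borel_measurable borel" by measurable
    then have "?h \<in> borel_measurable (lborel \<Otimes>\<^sub>M lborel)" by (simp only: lborel_prod measurable_lborel2)
    from lborel.nn_integral_fst[OF this] show ?thesis unfolding lborel_prod by simp
  qed
  also have "\<dots> = bump_pairing K M t"
    unfolding bump_pairing_def
  proof (rule nn_integral_cong)
    fix x :: "complex^'n"
    have "(\<integral>\<^sup>+y. ?h (x, y) \<partial>lborel) = (\<integral>\<^sup>+y. ennreal (1 / (norm x)\<^sup>2) * indicator M x *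
        (indicator K y * ennreal (bump t (dist_line_square x y))) \<partial>lborel)"
    proof (rule nn_integral_cong)
      fix y :: "complex^'n"
      have "ennreal (1 / (norm x)\<^sup>2 * bump t (dist_line_square x y)) = ennreal (1 / (norm x)\<^sup>2) * ennreal (bump t (dist_line_square x y))"
        by (rule ennreal_mult') simp
      then show "?h (x, y) = ennreal (1 / (norm x)\<^sup>2) * indicator M x * (indicator K y * ennreal (bump t (dist_line_square x y)))"
        by (simp only: fst_conv snd_conv ac_simps)
    qed
    also have "\<dots> = ennreal (1 / (norm x)\<^sup>2) * indicator M x *
        (\<integral>\<^sup>+y. indicator K y * ennreal (bump t (dist_line_square x y)) \<partial>lborel)"
      by (rule nn_integral_cmult) measurable
    finally show "(\<integral>\<^sup>+y. ?h (x, y) \<partial>lborel) = ennreal (1 / (norm x)\<^sup>2) * indicator M x *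
        (\<integral>\<^sup>+y. indicator K y * ennreal (bump t (dist_line_square x y)) \<partial>lborel)" .
  qed
  finally show ?thesis .
qed

lemma (in complex_body) bump_pairing_bounds:
  fixes M :: "(complex^'n) set"
  assumes n: "CARD('n) = 3" and e: "cball 0 e \<subseteq> K" and t: "0 < t" "t < e" and [measurable]: "M \<in> sets borel"
  defines "c \<equiv> ennreal pi * (\<integral>\<^sup>+w. ennreal (bump t ((norm w)\<^sup>2)) \<partial>(lborel :: (complex \<times> complex) measure))"
    and "\<Phi> \<equiv> (\<integral>\<^sup>+x. ennreal (1 / (body_norm K x)\<^sup>2) * indicator M x \<partial>lborel)"
  shows "ennreal ((1 - t / e)\<^sup>2) * (c * \<Phi>) \<le> bump_pairing K M t"
    "bump_pairing K M t \<le> ennreal ((1 + t / e)\<^sup>2) * (c * \<Phi>)"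
proof -
  let ?c = "\<integral>\<^sup>+w. ennreal (bump t ((norm w)\<^sup>2)) \<partial>(lborel :: (complex \<times> complex) measure)"
  let ?b = "\<lambda>k x. k * (ennreal (pi * (norm x)\<^sup>2 / (body_norm K x)\<^sup>2) * ?c)"
  have factor: "k * (c * \<Phi>) = (\<integral>\<^sup>+x. ennreal (1 / (norm x)\<^sup>2) * indicator M x * ?b k x \<partial>lborel)" for k
  proof -
    have "k * (c * \<Phi>) = (\<integral>\<^sup>+x. (k * c) * (ennreal (1 / (body_norm K x)\<^sup>2) * indicator M x) \<partial>lborel)"
      unfolding \<Phi>_def by (subst nn_integral_cmult) (simp_all add: mult.assoc)
    also have "\<dots> = (\<integral>\<^sup>+x. ennreal (1 / (norm x)\<^sup>2) * indicator M x * ?b k x \<partial>lborel)"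
    proof (rule nn_integral_cong_AE, rule AE_mp[OF AE_lborel_singleton[of 0]], rule AE_I2, rule impI)
      fix x :: "complex^'n" assume x: "x \<noteq> 0"
      have "ennreal (1 / (norm x)\<^sup>2) * ennreal (pi * (norm x)\<^sup>2 / (body_norm K x)\<^sup>2)
        = ennreal (1 / (norm x)\<^sup>2 * (pi * (norm x)\<^sup>2 / (body_norm K x)\<^sup>2))"
        by (rule ennreal_mult'[symmetric]) simp
      also have "1 / (norm x)\<^sup>2 * (pi * (norm x)\<^sup>2 / (body_norm K x)\<^sup>2) = pi * (1 / (body_norm K x)\<^sup>2)"
        using x by simp
      also have "ennreal \<dots> = ennreal pi * ennreal (1 / (body_norm K x)\<^sup>2)" by (rule ennreal_mult') simp
      finally have eq: "ennreal (1 / (norm x)\<^sup>2) * ennreal (pi * (norm x)\<^sup>2 / (body_norm K x)\<^sup>2)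
        = ennreal pi * ennreal (1 / (body_norm K x)\<^sup>2)" .
      have "ennreal (1 / (norm x)\<^sup>2) * indicator M x * ?b k x
        = (ennreal (1 / (norm x)\<^sup>2) * ennreal (pi * (norm x)\<^sup>2 / (body_norm K x)\<^sup>2)) * (indicator M x * k * ?c)"
        by (simp only: ac_simps)
      then show "(k * c) * (ennreal (1 / (body_norm K x)\<^sup>2) * indicator M x) = ennreal (1 / (norm x)\<^sup>2) * indicator M x * ?b k x"
        unfolding eq c_def by (simp only: ac_simps)
    qed
    finally show ?thesis .
  qed
  show "ennreal ((1 - t / e)\<^sup>2) * (c * \<Phi>) \<le> bump_pairing K M t"
    unfolding factor bump_pairing_def
    by (rule nn_integral_mono_AE, rule AE_mp[OF AE_lborel_singleton[of 0]], rule AE_I2, rule impI,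
        rule mult_left_mono, rule bump_integral_bounds(1)[OF n e t]) simp_all
  show "bump_pairing K M t \<le> ennreal ((1 + t / e)\<^sup>2) * (c * \<Phi>)"
    unfolding factor bump_pairing_def
    by (rule nn_integral_mono_AE, rule AE_mp[OF AE_lborel_singleton[of 0]], rule AE_I2, rule impI,
        rule mult_left_mono, rule bump_integral_bounds(2)[OF n e t]) simp_all
qed

text \<open>For each small \<open>t\<close> the comparison of kernels holds up to factors that tend to \<open>1\<close> with \<open>t\<close>; the constant \<open>c\<close>,
  which depends on \<open>t\<close>, cancels.\<close>

lemma inverse_square_integral_comparison_dim3:
  fixes K L D :: "(complex^'n) set"
  assumes n: "CARD('n) = 3" and K: "complex_body K" and L: "complex_body L" and D: "complex_body D"
    and le: "\<And>\<xi>. norm \<xi> = 1 \<Longrightarrow> section_volume K \<xi> \<le> section_volume L \<xi> + section_volume D \<xi>"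
  defines "\<Phi> \<equiv> \<lambda>M. (\<integral>\<^sup>+x. ennreal (1 / (body_norm K x)\<^sup>2) * indicator M x \<partial>lborel)"
  shows "\<Phi> K \<le> \<Phi> L + \<Phi> D"
proof -
  interpret K: complex_body K by fact
  interpret L: complex_body L by fact
  interpret D: complex_body D by fact
  have dim: "DIM(complex^'n) = 2 * 3" "2 \<le> (3::nat)" using n by simp_all
  obtain eK eL eD where e3: "eK > 0" "cball 0 eK \<subseteq> K" "eL > 0" "cball 0 eL \<subseteq> L" "eD > 0" "cball 0 eD \<subseteq> D"
    using cball_subset_body[OF K.body K.symmetric] cball_subset_body[OF L.body L.symmetric]
      cball_subset_body[OF D.body D.symmetric] by metis
  define e where "e = min eK (min eL eD)"
  have e: "e > 0" using e3 by (simp add: e_def)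
  have "cball (0 :: complex^'n) e \<subseteq> cball 0 eK" "cball (0 :: complex^'n) e \<subseteq> cball 0 eL" "cball (0 :: complex^'n) e \<subseteq> cball 0 eD"
    by (rule subset_cball, simp add: e_def)+
  then have sub: "cball 0 e \<subseteq> K" "cball 0 e \<subseteq> L" "cball 0 e \<subseteq> D" using e3 by blast+
  have sym: "symmetric_body K" "symmetric_body L" "symmetric_body D" by unfold_locales
  have fin: "\<Phi> M < top" if "symmetric_body M" for M
    using K.inverse_square_body_norm_integral_le[OF dim symmetric_body.body_measurable[OF that] symmetric_body.emeasure_body[OF that]]
    unfolding \<Phi>_def by (rule le_less_trans) simp
  define \<phi> where "\<phi> M = enn2real (\<Phi> M)" for M
  have \<Phi>: "\<Phi> M = ennreal (\<phi> M)" if "symmetric_body M" for M using fin[OF that] by (simp add: \<phi>_def)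
  have \<phi>0: "\<phi> M \<ge> 0" for M by (simp add: \<phi>_def)
  have key: "(1 - t / e)\<^sup>2 * \<phi> K \<le> ((1 + t / e) / (1 - t / e)) ^ 4 * ((1 + t / e)\<^sup>2 * (\<phi> L + \<phi> D))"
    if t: "0 < t" "t < e" for t
  proof -
    define \<gamma> where "\<gamma> = ((1 + t / e) / (1 - t / e)) ^ 4"
    have \<gamma>0: "\<gamma> \<ge> 0" using t by (simp add: \<gamma>_def)
    define c where "c = ennreal pi * (\<integral>\<^sup>+w. ennreal (bump t ((norm w)\<^sup>2)) \<partial>(lborel :: (complex \<times> complex) measure))"
    have c: "c \<noteq> 0" "c \<noteq> top"
      using bump_integral[OF t(1)] by (auto simp: c_def ennreal_mult_eq_top_iff)
    have finA: "kernel_integral K M r < \<infinity>" if "symmetric_body M" "r > 0" for M r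
      unfolding kernel_integral_def
      by (rule tube_pairing_limit(2)[OF n K.compact_body that, of "\<lambda>i. 1 / (real i + 1)"])
        (real_asymp, simp)
    have "kernel_integral K K (t / 2) + ennreal \<gamma> * (kernel_integral K L t + kernel_integral K D t)
       \<le> kernel_integral K K t + ennreal \<gamma> * (kernel_integral K L (t / 2) + kernel_integral K D (t / 2))"
      by (rule kernel_integral_comparison[OF n sym sub le t]) (simp_all add: \<gamma>_def)
    then have "(kernel_integral K K t + ennreal \<gamma> * (kernel_integral K L t + kernel_integral K D t)) + bump_pairing K K t
       \<le> (kernel_integral K K t + ennreal \<gamma> * (kernel_integral K L t + kernel_integral K D t))
          + ennreal \<gamma> * (bump_pairing K L t + bump_pairing K D t)"
      unfolding kernel_integral_split[OF K.body_measurable K.body_measurable t(1)]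
        kernel_integral_split[OF K.body_measurable L.body_measurable t(1)]
        kernel_integral_split[OF K.body_measurable D.body_measurable t(1)]
      by (simp only: distrib_left ac_simps)
    moreover have "kernel_integral K K t + ennreal \<gamma> * (kernel_integral K L t + kernel_integral K D t) \<noteq> top"
      using finA[OF sym(1) t(1)] finA[OF sym(2) t(1)] finA[OF sym(3) t(1)]
      by (simp add: ennreal_mult_eq_top_iff less_top)
    ultimately have B: "bump_pairing K K t \<le> ennreal \<gamma> * (bump_pairing K L t + bump_pairing K D t)"
      by (simp add: ennreal_add_left_cancel_le)
    have "c * (ennreal ((1 - t / e)\<^sup>2) * \<Phi> K) = ennreal ((1 - t / e)\<^sup>2) * (c * \<Phi> K)" by (simp only: ac_simps)
    also have "\<dots> \<le> bump_pairing K K t"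
      unfolding c_def \<Phi>_def by (rule K.bump_pairing_bounds(1)[OF n sub(1) t K.body_measurable])
    also note B
    also have "ennreal \<gamma> * (bump_pairing K L t + bump_pairing K D t)
      \<le> ennreal \<gamma> * (ennreal ((1 + t / e)\<^sup>2) * (c * \<Phi> L) + ennreal ((1 + t / e)\<^sup>2) * (c * \<Phi> D))"
      unfolding c_def \<Phi>_def
      by (intro mult_left_mono add_mono K.bump_pairing_bounds(2)[OF n sub(1) t] L.body_measurable D.body_measurable) simp
    also have "\<dots> = c * (ennreal \<gamma> * (ennreal ((1 + t / e)\<^sup>2) * (\<Phi> L + \<Phi> D)))" by (simp only: distrib_left distrib_right ac_simps)
    finally have "ennreal ((1 - t / e)\<^sup>2) * \<Phi> K \<le> ennreal \<gamma> * (ennreal ((1 + t / e)\<^sup>2) * (\<Phi> L + \<Phi> D))"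
      using ennreal_mult_le_mult_iff[OF c] by blast
    then have "ennreal ((1 - t / e)\<^sup>2 * \<phi> K) \<le> ennreal (\<gamma> * ((1 + t / e)\<^sup>2 * (\<phi> L + \<phi> D)))"
      unfolding \<Phi>[OF sym(1)] \<Phi>[OF sym(2)] \<Phi>[OF sym(3)]
      using \<gamma>0 \<phi>0 by (simp add: ennreal_mult' ennreal_plus)
    moreover have "0 \<le> \<gamma> * ((1 + t / e)\<^sup>2 * (\<phi> L + \<phi> D))" using \<gamma>0 \<phi>0 by simp
    ultimately show ?thesis unfolding \<gamma>_def using ennreal_le_iff by blast
  qed
  have "(1 - 0 / e)\<^sup>2 * \<phi> K \<le> ((1 + 0 / e) / (1 - 0 / e)) ^ 4 * ((1 + 0 / e)\<^sup>2 * (\<phi> L + \<phi> D))"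
  proof (rule tendsto_le[of "at_right 0"])
    show "((\<lambda>t. ((1 + t / e) / (1 - t / e)) ^ 4 * ((1 + t / e)\<^sup>2 * (\<phi> L + \<phi> D))) \<longlongrightarrow>
       ((1 + 0 / e) / (1 - 0 / e)) ^ 4 * ((1 + 0 / e)\<^sup>2 * (\<phi> L + \<phi> D))) (at_right 0)"
      by (intro tendsto_intros) (use e in auto)
    show "((\<lambda>t. (1 - t / e)\<^sup>2 * \<phi> K) \<longlongrightarrow> (1 - 0 / e)\<^sup>2 * \<phi> K) (at_right 0)"
      by (intro tendsto_intros) (use e in auto)
    show "\<forall>\<^sub>F t in at_right 0. (1 - t / e)\<^sup>2 * \<phi> K \<le> ((1 + t / e) / (1 - t / e)) ^ 4 * ((1 + t / e)\<^sup>2 * (\<phi> L + \<phi> D))"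
      using eventually_at_right_real[OF e] by eventually_elim (rule key, auto)
  qed simp
  then show ?thesis unfolding \<Phi>[OF sym(1)] \<Phi>[OF sym(2)] \<Phi>[OF sym(3)]
    using \<phi>0 by (simp flip: ennreal_plus)
qed

lemma volume_comparison_dim3:
  fixes K L D :: "(complex^'n) set"
  assumes n: "CARD('n) = 3" and K: "complex_body K" and L: "complex_body L" and D: "complex_body D"
    and le: "\<And>\<xi>. norm \<xi> = 1 \<Longrightarrow> section_volume K \<xi> \<le> section_volume L \<xi> + section_volume D \<xi>"
  shows "measure lborel K powr ((real CARD('n) - 1) / real CARD('n)) \<le>
     measure lborel L powr ((real CARD('n) - 1) / real CARD('n)) + measure lborel D powr ((real CARD('n) - 1) / real CARD('n))"
proof -
  interpret K: complex_body K by fact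
  interpret L: complex_body L by fact
  interpret D: complex_body D by fact
  have dim: "DIM(complex^'n) = 2 * 3" "2 \<le> (3::nat)" using n by simp_all
  have "ennreal (real 3 / (real 3 - 1) * measure lborel K) \<le> (\<integral>\<^sup>+x. ennreal (1 / (body_norm K x)\<^sup>2) * indicator K x \<partial>lborel)"
    by (rule K.inverse_square_body_norm_integral_self[OF dim])
  also have "\<dots> \<le> (\<integral>\<^sup>+x. ennreal (1 / (body_norm K x)\<^sup>2) * indicator L x \<partial>lborel)
     + (\<integral>\<^sup>+x. ennreal (1 / (body_norm K x)\<^sup>2) * indicator D x \<partial>lborel)"
    by (rule inverse_square_integral_comparison_dim3[OF n K L D le])
  also have "\<dots> \<le> ennreal (real 3 / (real 3 - 1) * measure lborel L powr ((real 3 - 1) / real 3) * measure lborel K powr (1 / real 3))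
      + ennreal (real 3 / (real 3 - 1) * measure lborel D powr ((real 3 - 1) / real 3) * measure lborel K powr (1 / real 3))"
    by (intro add_mono K.inverse_square_body_norm_integral_le[OF dim]
        L.emeasure_body L.body_measurable D.emeasure_body D.body_measurable)
  finally have "real 3 / (real 3 - 1) * measure lborel K \<le>
     real 3 / (real 3 - 1) * measure lborel L powr ((real 3 - 1) / real 3) * measure lborel K powr (1 / real 3) +
     real 3 / (real 3 - 1) * measure lborel D powr ((real 3 - 1) / real 3) * measure lborel K powr (1 / real 3)"
    by (simp flip: ennreal_plus)
  from volume_comparison_from_integrals[OF dim(2) K.emeasure_body(2) _ _ this] show ?thesis
    using n by simp
qed

section \<open>Stability\<close>

text \<open>A ball \<open>D\<close> with constant section volume \<open>\<epsilon> + d\<close> turns the additive error into a third body; \<open>d > 0\<close> keeps it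
  nondegenerate when \<open>\<epsilon> = 0\<close>.\<close>

lemma volume_comparison:
  fixes K L :: "(complex^'n) set"
  assumes n: "CARD('n) = 2 \<or> CARD('n) = 3" and K: "complex_body K" and L: "complex_body L"
    and le: "\<And>\<xi>. norm \<xi> = 1 \<Longrightarrow> section_volume K \<xi> \<le> section_volume L \<xi> + \<epsilon>" and \<epsilon>: "\<epsilon> \<ge> 0"
  shows "measure lborel K powr ((real CARD('n) - 1) / real CARD('n)) \<le>
     measure lborel L powr ((real CARD('n) - 1) / real CARD('n)) + \<epsilon>"
proof (rule field_le_epsilon)
  fix d :: real assume d: "d > 0"
  obtain e1 :: "complex^'n" where e1: "norm e1 = 1" using vector_choose_size[of 1] by auto
  obtain \<rho> where \<rho>: "\<rho> > 0" "\<And>\<xi> :: complex^'n. norm \<xi> = 1 \<Longrightarrow> section_volume (cball 0 \<rho>) \<xi> = \<epsilon> + d"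
    using n
  proof
    assume n: "CARD('n) = 2"
    let ?\<rho> = "sqrt ((\<epsilon> + d) / pi)"
    have pos: "?\<rho> > 0" using d \<epsilon> by simp
    have "pi * ?\<rho>\<^sup>2 = \<epsilon> + d" using d \<epsilon> by simp
    then show ?thesis by (intro that[OF pos]) (rule section_volume_cball_dim2[OF n pos, THEN trans])
  next
    assume n: "CARD('n) = 3"
    let ?\<rho> = "root 4 (2 * (\<epsilon> + d) / pi\<^sup>2)"
    have pos: "?\<rho> > 0" using d \<epsilon> by simp
    have "pi\<^sup>2 / 2 * ?\<rho> ^ 4 = \<epsilon> + d" using d \<epsilon> by simp
    then show ?thesis by (intro that[OF pos]) (rule section_volume_cball_dim3[OF n pos, THEN trans])
  qed
  have D: "complex_body (cball (0 :: complex^'n) \<rho>)" by (rule complex_body_cball[OF \<rho>(1)])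
  have le': "section_volume K \<xi> \<le> section_volume L \<xi> + section_volume (cball 0 \<rho>) \<xi>" if "norm \<xi> = 1" for \<xi>
    using le[OF that] \<rho>(2)[OF that] d by simp
  have "measure lborel K powr ((real CARD('n) - 1) / real CARD('n)) \<le>
     measure lborel L powr ((real CARD('n) - 1) / real CARD('n))
      + measure lborel (cball (0 :: complex^'n) \<rho>) powr ((real CARD('n) - 1) / real CARD('n))"
    using n volume_comparison_dim2[OF _ K L D le'] volume_comparison_dim3[OF _ K L D le'] by blast
  also have "\<dots> \<le> measure lborel L powr ((real CARD('n) - 1) / real CARD('n)) + (\<epsilon> + d)"
    using volume_cball_powr_le_section_volume[OF n \<rho>(1) e1] \<rho>(2)[OF e1] by simp
  finally show "measure lborel K powr ((real CARD('n) - 1) / real CARD('n)) \<le>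
     measure lborel L powr ((real CARD('n) - 1) / real CARD('n)) + \<epsilon> + d" by simp
qed

lemma complex_bodyI: "convex_body K \<Longrightarrow> origin_symmetric K \<Longrightarrow> rotation_invariant K \<Longrightarrow> complex_body K"
  by (simp add: complex_body_def symmetric_body_def complex_body_axioms_def)

theorem corollary1:
  fixes K L :: "(complex^'n) set"
  assumes "CARD('n) = 2 \<or> CARD('n) = 3"
    and "convex_body K" "origin_symmetric K" "rotation_invariant K"
    and "convex_body L" "origin_symmetric L" "rotation_invariant L"
  shows "\<exists>\<xi>\<in>sphere 0 1.
      (\<forall>\<eta>\<in>sphere 0 1. \<bar>section_volume K \<eta> - section_volume L \<eta>\<bar>
                     \<le> \<bar>section_volume K \<xi> - section_volume L \<xi>\<bar>) \<and>
      \<bar>measure lborel K powr ((real CARD('n) - 1) / real CARD('n))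
        - measure lborel L powr ((real CARD('n) - 1) / real CARD('n))\<bar>
      \<le> \<bar>section_volume K \<xi> - section_volume L \<xi>\<bar>"
proof -
  have K: "complex_body K" and L: "complex_body L" using assms by (auto intro: complex_bodyI)
  have cont: "continuous_on (sphere 0 1) (section_volume M)" if "complex_body M" for M :: "(complex^'n) set"
  proof -
    interpret complex_body M by fact
    obtain e where "e > 0" "cball 0 e \<subseteq> M" using cball_subset_body[OF body symmetric] by blast
    then show ?thesis using continuous_on_section_volume[OF assms(1) compact_body convex_body] by blast
  qed
  have "continuous_on (sphere 0 1) (\<lambda>\<xi>. \<bar>section_volume K \<xi> - section_volume L \<xi>\<bar>)"
    by (intro continuous_intros cont K L)
  moreover obtain e1 :: "complex^'n" where "norm e1 = 1" using vector_choose_size[of 1] by auto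
  then have "sphere (0 :: complex^'n) 1 \<noteq> {}" by auto
  ultimately obtain \<xi> :: "complex^'n" where \<xi>: "\<xi> \<in> sphere 0 1"
    and max: "\<forall>\<eta>\<in>sphere 0 1. \<bar>section_volume K \<eta> - section_volume L \<eta>\<bar> \<le> \<bar>section_volume K \<xi> - section_volume L \<xi>\<bar>"
    using continuous_attains_sup[OF compact_sphere] by blast
  define \<epsilon> where "\<epsilon> = \<bar>section_volume K \<xi> - section_volume L \<xi>\<bar>"
  have "section_volume K \<eta> \<le> section_volume L \<eta> + \<epsilon>" "section_volume L \<eta> \<le> section_volume K \<eta> + \<epsilon>"
    if "norm \<eta> = 1" for \<eta>
    using bspec[OF max, of \<eta>] that unfolding \<epsilon>_def by (auto simp: abs_le_iff)
  then have "\<bar>measure lborel K powr ((real CARD('n) - 1) / real CARD('n))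
        - measure lborel L powr ((real CARD('n) - 1) / real CARD('n))\<bar> \<le> \<epsilon>"
    using volume_comparison[OF assms(1) K L, of \<epsilon>] volume_comparison[OF assms(1) L K, of \<epsilon>]
    by (simp add: \<epsilon>_def abs_le_iff)
  with \<xi> max show ?thesis unfolding \<epsilon>_def by blast
qed

end
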